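(* The function $[\mathcal G,\mathcal H]_\theta:=\mathcal G'_\theta\mathcal H-\mathcal G\mathcal H'_\theta$ is semi-definite on $\Omega_\epsilon=\{(\rho,\theta)\in\mathbb R^2:0<\rho<\epsilon,\ |\theta|<\epsilon\}$ for some $\epsilon>0$ (i.e. it is either $\ge0$ throughout $\Omega_\epsilon$ or $\le0$ throughout $\Omega_\epsilon$) if either (L1) $j_{s(\mathcal G)}+\tilde j_{s(\mathcal H)}>0$ and conditions (P1) and (Q) hold, or (L2) $j_{s(\mathcal G)}=\tilde j_{s(\mathcal H)}=0$, conditions (P2), (Q) and (S) hold, and one of conditions (H1), (H2), (H3), (H4) holds (all conditions are stated in the context). Moreover, it is semi-positive ($\ge 0$ on some $\Omega_\epsilon$) if $C_0>0$ and semi-negative ($\le0$ on some $\Omega_\epsilon$) if $C_0<0$, where $C_0=(j_0-\tilde j_0)\,a_{i_0,j_0}(\mathcal G)\,a_{\tilde i_0,\tilde j_0}(\mathcal H)$.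
   Context: **Vector field.** Let $\mathcal X=\sum_{k\ge m}X_k$ and $\mathcal Y=\sum_{k\ge m}Y_k$ be real analytic near $(0,0)\in\mathbb R^2$, where $X_k,Y_k$ are homogeneous polynomials of degree $k$, $m\ge 2$, $X_m^2+Y_m^2\not\equiv 0$, and the origin $O$ is an isolated singular point of the system $\dot x=\mathcal X(x,y),\ \dot y=\mathcal Y(x,y)$. In polar coordinates, after dividing by $\rho^{m-1}$, the system becomes $\dot\rho=\rho\mathcal H(\rho,\theta),\ \dot\theta=\mathcal G(\rho,\theta)$ with $\mathcal H=\sum_{k\ge0}H_k(\theta)\rho^k$, $\mathcal G=\sum_{k\ge0}G_k(\theta)\rho^k$, $G_k(\theta)=Y_{k+m}(\cos\theta,\sin\theta)\cos\theta-X_{k+m}(\cos\theta,\sin\theta)\sin\theta$, $H_k(\theta)=X_{k+m}(\cos\theta,\sin\theta)\cos\theta+Y_{k+m}(\cos\theta,\sin\theta)\sin\theta$. It is assumed throughout that neither $\mathcal G$ nor $\mathcal H$ is identically $0$, and that $G_0(0)=H_0(0)=0$. **Newton polygons.** For a nonzero real analytic $F(\rho,\theta)=\sum a_{i,j}(F)\rho^i\theta^j$ near $(0,0)$, let $\Delta(F)=\{(i,j)\in\mathbb Z_{\ge0}^2:a_{i,j}(F)\ne0\}$ (valid indices) and let the Newton polygon $\mathcal N_F$ be the compact polygon in the boundary of $\mathrm{conv}(\Delta(F)+\mathbb R_{\ge0}^2)$ in the $(u,v)$-plane (the boundary minus its vertical and horizontal rays; possibly a single point). Its vertices, ordered by increasing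 abscissa, are $V_0(F),\dots,V_{s(F)}(F)$; write $V_k(\mathcal G)=(i_k,j_k)$ and $V_k(\mathcal H)=(\tilde i_k,\tilde j_k)$. $E_k(F)$ is the edge (closed segment) from $V_{k-1}(F)$ to $V_k(F)$, with slope $\zeta(E_k(F))<0$; put $\zeta(E_0(F))=-\infty$, $\zeta(E_{s(F)+1}(F))=0$, $\zeta^-(V_k(F))=\zeta(E_k(F))$, $\zeta^+(V_k(F))=\zeta(E_{k+1}(F))$. $\mathfrak S(F)$ is the set of slopes of edges of $\mathcal N_F$. For $\xi<0$ the $\xi$-component $\sigma(F,\xi)$ is $E_k(F)$ if $\xi=\zeta(E_k(F))$, and $V_k(F)$ if $\zeta^-(V_k(F))<\xi<\zeta^+(V_k(F))$. The $\xi$-componential polynomial is $\mathcal K_\xi(F)(\theta)=\sum_{(i,j)\in\sigma(F,\xi)\cap\Delta(F)}a_{i,j}(F)\theta^j$. **Slope sequences.** Let $\xi_1<\dots<\xi_{s(\mathcal G,\mathcal H)}$ be the elements of $\mathfrak S(\mathcal G)\cup\mathfrak S(\mathcal H)$ and $\xi_{s_1}<\dots<\xi_{s_r}$ ($r=r(\mathcal G,\mathcal H)\ge0$) those of $\mathfrak S(\mathcal G)\cap\mathfrak S(\mathcal H)$. The vertex sequence $(V_0(\mathcal G),\dots,V_{s(\mathcal G)}(\mathcal G))$ is divided into $r+1$ consecutive subsequences $\Lambda_\varrho(\mathcal G)=(V_{k_{\varrho-1}+1}(\mathcal G),\dots,V_{k_\varrho}(\mathcal G))$, $\varrho=0,\dots,r$,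 where $-1=k_{-1}<k_0<\dots<k_r=s(\mathcal G)$ and $\zeta^+(V_{k_\varrho}(\mathcal G))=\xi_{s_{\varrho+1}}$ for $\varrho=0,\dots,r-1$. $\Lambda_\varrho(\mathcal H)$ is defined similarly. **Conditions.** (P1): for each $\varrho=0,\dots,r$, the ordinates of the points in $\Lambda_\varrho(\mathcal G)$ all have the same parity, those in $\Lambda_\varrho(\mathcal H)$ all have the same parity, and these two parities are different. (P2): the same for each $\varrho=0,\dots,r-1$; moreover the ordinates of the points of $\Lambda_r(\mathcal G)$ with its last element $V_{s(\mathcal G)}(\mathcal G)$ removed are all odd, and those of $\Lambda_r(\mathcal H)$ are all even. (Q): for each $k=1,\dots,s(\mathcal G,\mathcal H)$ the polynomial $[\mathcal K_{\xi_k}(\mathcal G),\mathcal K_{\xi_k}(\mathcal H)]:=(\mathcal K_{\xi_k}(\mathcal G))'\mathcal K_{\xi_k}(\mathcal H)-\mathcal K_{\xi_k}(\mathcal G)(\mathcal K_{\xi_k}(\mathcal H))'$ has no nonzero real roots. (S): $\mathcal N_{\mathcal G}$ (and $\mathcal N_{\mathcal H}$) contains at least two valid indices of $\mathcal G$ (of $\mathcal H$), the last two of which, in order of increasing abscissa along the polygon, are $V_*(\mathcal G)=(i_*,j_* )$ and $V_{s(\mathcal G)}(\mathcal G)=(i_{s(\mathcal G)},0)$ (respectively $V_*(\mathcal H)=(\tilde i_*,\tilde j_* )$ and $V_{s(\mathcal H)}(\mathcal H)=(\tilde i_{s(\mathcal H)},0)$), and $\{(i,j)\in\Delta(\mathcal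 G):0<j<j_*\}=\emptyset$ and $\{(i,j)\in\Delta(\mathcal H):0<j<\tilde j_*\}=\emptyset$. (H1): $\zeta(E_{s(\mathcal G)}(\mathcal G))>\zeta(E_{s(\mathcal H)}(\mathcal H))$ and $j_*\le\tilde j_*$. (H2): $\zeta(E_{s(\mathcal G)}(\mathcal G))>\zeta(E_{s(\mathcal H)}(\mathcal H))$, $j_*>\tilde j_*$, $\tilde j_*$ odd, and $a_{i_*,j_*}(\mathcal G)a_{\tilde i_{s(\mathcal H)},\tilde j_{s(\mathcal H)}}(\mathcal H)a_{i_{s(\mathcal G)},j_{s(\mathcal G)}}(\mathcal G)a_{\tilde i_*,\tilde j_*}(\mathcal H)<0$. (H3): $\zeta(E_{s(\mathcal G)}(\mathcal G))=\zeta(E_{s(\mathcal H)}(\mathcal H))$ and $j_*<\tilde j_*$. (H4): $\zeta(E_{s(\mathcal G)}(\mathcal G))=\zeta(E_{s(\mathcal H)}(\mathcal H))$, $j_*=\tilde j_*$ and $a_{i_*,j_*}(\mathcal G)a_{\tilde i_{s(\mathcal H)},\tilde j_{s(\mathcal H)}}(\mathcal H)\ne a_{i_{s(\mathcal G)},j_{s(\mathcal G)}}(\mathcal G)a_{\tilde i_*,\tilde j_*}(\mathcal H)$. *)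

theory Defs
  imports "HOL-Analysis.Analysis"
begin

section \<open>Germs of real analytic functions of two variables\<close>

definition has_power_series :: "(real \<Rightarrow> real \<Rightarrow> real) \<Rightarrow> (nat \<Rightarrow> nat \<Rightarrow> real) \<Rightarrow> bool" where
  "has_power_series F c \<longleftrightarrow>
     (\<exists>r>0. \<forall>x y. \<bar>x\<bar> < r \<and> \<bar>y\<bar> < r \<longrightarrow>
        ((\<lambda>(i, j). c i j * x ^ i * y ^ j) has_sum F x y) UNIV)"

definition analytic_at_origin :: "(real \<Rightarrow> real \<Rightarrow> real) \<Rightarrow> bool" where
  "analytic_at_origin F \<longleftrightarrow> (\<exists>c. has_power_series F c)"

text \<open>The coefficient \<open>a\<^sub>i\<^sub>,\<^sub>j(F)\<close>; only meaningful when \<open>F\<close> is analytic at the origin,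
  in which case the coefficients are unique.\<close>
definition ps_coeff :: "(real \<Rightarrow> real \<Rightarrow> real) \<Rightarrow> nat \<Rightarrow> nat \<Rightarrow> real" where
  "ps_coeff F = (THE c. has_power_series F c)"

definition nonzero_germ :: "(real \<Rightarrow> real \<Rightarrow> real) \<Rightarrow> bool" where
  "nonzero_germ F \<longleftrightarrow> \<not> (\<forall>\<^sub>F (x, y) in nhds (0, 0). F x y = 0)"

definition homogeneous_part :: "(real \<Rightarrow> real \<Rightarrow> real) \<Rightarrow> nat \<Rightarrow> real \<Rightarrow> real \<Rightarrow> real" where
  "homogeneous_part F k x y = (\<Sum>i\<le>k. ps_coeff F i (k - i) * x ^ i * y ^ (k - i))"


section \<open>The vector field in polar coordinates\<close>

definition isolated_singular_origin :: "(real \<Rightarrow> real \<Rightarrow> real) \<Rightarrow> (real \<Rightarrow> real \<Rightarrow> real) \<Rightarrow> bool" where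
  "isolated_singular_origin X Y \<longleftrightarrow>
     X 0 0 = 0 \<and> Y 0 0 = 0 \<and> (\<forall>\<^sub>F (x, y) in at (0, 0). \<not> (X x y = 0 \<and> Y x y = 0))"

definition angular_part ::
    "(real \<Rightarrow> real \<Rightarrow> real) \<Rightarrow> (real \<Rightarrow> real \<Rightarrow> real) \<Rightarrow> nat \<Rightarrow> nat \<Rightarrow> real \<Rightarrow> real" where
  "angular_part X Y m k \<theta> =
     homogeneous_part Y (k + m) (cos \<theta>) (sin \<theta>) * cos \<theta>
     - homogeneous_part X (k + m) (cos \<theta>) (sin \<theta>) * sin \<theta>"

definition radial_part ::
    "(real \<Rightarrow> real \<Rightarrow> real) \<Rightarrow> (real \<Rightarrow> real \<Rightarrow> real) \<Rightarrow> nat \<Rightarrow> nat \<Rightarrow> real \<Rightarrow> real" where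
  "radial_part X Y m k \<theta> =
     homogeneous_part X (k + m) (cos \<theta>) (sin \<theta>) * cos \<theta>
     + homogeneous_part Y (k + m) (cos \<theta>) (sin \<theta>) * sin \<theta>"

text \<open>The functions \<open>\<G>(\<rho>, \<theta>)\<close> and \<open>\<H>(\<rho>, \<theta>)\<close>; the series converge
  for \<open>\<rho>\<close> near \<open>0\<close> and all \<open>\<theta>\<close>.\<close>
definition angular ::
    "(real \<Rightarrow> real \<Rightarrow> real) \<Rightarrow> (real \<Rightarrow> real \<Rightarrow> real) \<Rightarrow> nat \<Rightarrow> real \<Rightarrow> real \<Rightarrow> real" where
  "angular X Y m \<rho> \<theta> = (\<Sum>k. angular_part X Y m k \<theta> * \<rho> ^ k)"

definition radial ::
    "(real \<Rightarrow> real \<Rightarrow> real) \<Rightarrow> (real \<Rightarrow> real \<Rightarrow> real) \<Rightarrow> nat \<Rightarrow> real \<Rightarrow> real \<Rightarrow> real" where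
  "radial X Y m \<rho> \<theta> = (\<Sum>k. radial_part X Y m k \<theta> * \<rho> ^ k)"

definition theta_bracket ::
    "(real \<Rightarrow> real \<Rightarrow> real) \<Rightarrow> (real \<Rightarrow> real \<Rightarrow> real) \<Rightarrow> real \<Rightarrow> real \<Rightarrow> real" where
  "theta_bracket G H \<rho> \<theta> = deriv (G \<rho>) \<theta> * H \<rho> \<theta> - G \<rho> \<theta> * deriv (H \<rho>) \<theta>"

definition Omega :: "real \<Rightarrow> (real \<times> real) set" where
  "Omega \<epsilon> = {(\<rho>, \<theta>). 0 < \<rho> \<and> \<rho> < \<epsilon> \<and> \<bar>\<theta>\<bar> < \<epsilon>}"


section \<open>Newton polygons\<close>

definition valid_indices :: "(real \<Rightarrow> real \<Rightarrow> real) \<Rightarrow> (nat \<times> nat) set" where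
  "valid_indices F = {(i, j). ps_coeff F i j \<noteq> 0}"

definition lattice_point :: "nat \<times> nat \<Rightarrow> real \<times> real" where
  "lattice_point p = (real (fst p), real (snd p))"

definition newton_region :: "(real \<Rightarrow> real \<Rightarrow> real) \<Rightarrow> (real \<times> real) set" where
  "newton_region F =
     convex hull {lattice_point p + (u, v) | p u v. p \<in> valid_indices F \<and> 0 \<le> u \<and> 0 \<le> v}"

text \<open>The faces of the region (other than itself) are its vertices, its compact edges and one
  vertical and one horizontal ray, so the union of the compact faces is the boundary without
  the two rays.\<close>
definition newton_polygon :: "(real \<Rightarrow> real \<Rightarrow> real) \<Rightarrow> (real \<times> real) set" where
  "newton_polygon F = \<Union>{f. f face_of newton_region F \<and> compact f}"

text \<open>Distinct vertices, and more generally distinct valid indices on the polygon, have distinct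
  abscissae, so that sorting by abscissa is unambiguous.\<close>
definition newton_vertices :: "(real \<Rightarrow> real \<Rightarrow> real) \<Rightarrow> (nat \<times> nat) list" where
  "newton_vertices F =
     sorted_key_list_of_set fst {p. lattice_point p extreme_point_of newton_region F}"

definition newton_s :: "(real \<Rightarrow> real \<Rightarrow> real) \<Rightarrow> nat" where
  "newton_s F = length (newton_vertices F) - 1"

definition newton_vertex :: "(real \<Rightarrow> real \<Rightarrow> real) \<Rightarrow> nat \<Rightarrow> nat \<times> nat" where
  "newton_vertex F k = newton_vertices F ! k"

text \<open>Meaningful for \<open>1 \<le> k \<le> newton_s F\<close>.\<close>
definition newton_edge :: "(real \<Rightarrow> real \<Rightarrow> real) \<Rightarrow> nat \<Rightarrow> (real \<times> real) set" where
  "newton_edge F k =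
     closed_segment (lattice_point (newton_vertex F (k - 1))) (lattice_point (newton_vertex F k))"

text \<open>\<open>\<zeta>(E\<^sub>k(F))\<close>, including the conventions for \<open>k = 0\<close> and \<open>k = s(F) + 1\<close>. Hence
  \<open>\<zeta>\<^sup>-(V\<^sub>k(F))\<close> is \<open>edge_slope F k\<close> and \<open>\<zeta>\<^sup>+(V\<^sub>k(F))\<close> is \<open>edge_slope F (k + 1)\<close>.\<close>
definition edge_slope :: "(real \<Rightarrow> real \<Rightarrow> real) \<Rightarrow> nat \<Rightarrow> ereal" where
  "edge_slope F k =
     (if k = 0 then -\<infinity>
      else if k > newton_s F then 0
      else ereal ((real (snd (newton_vertex F k)) - real (snd (newton_vertex F (k - 1)))) /
                  (real (fst (newton_vertex F k)) - real (fst (newton_vertex F (k - 1))))))"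

definition slopes :: "(real \<Rightarrow> real \<Rightarrow> real) \<Rightarrow> real set" where
  "slopes F = {\<xi>. \<exists>k\<in>{1..newton_s F}. ereal \<xi> = edge_slope F k}"

definition xi_component :: "(real \<Rightarrow> real \<Rightarrow> real) \<Rightarrow> real \<Rightarrow> (real \<times> real) set" where
  "xi_component F \<xi> =
     (if \<xi> \<in> slopes F
      then newton_edge F (THE k. k \<in> {1..newton_s F} \<and> edge_slope F k = ereal \<xi>)
      else {lattice_point (newton_vertex F
              (THE k. k \<le> newton_s F \<and> edge_slope F k < ereal \<xi> \<and> ereal \<xi> < edge_slope F (k + 1)))})"

definition componential_poly :: "(real \<Rightarrow> real \<Rightarrow> real) \<Rightarrow> real \<Rightarrow> real poly" where
  "componential_poly F \<xi> =
     (\<Sum>(i, j)\<in>{p \<in> valid_indices F. lattice_point p \<in> xi_component F \<xi>}. monom (ps_coeff F i j) j)"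

definition poly_bracket :: "real poly \<Rightarrow> real poly \<Rightarrow> real poly" where
  "poly_bracket p q = pderiv p * q - p * pderiv q"


section \<open>Subdivision of the vertex sequences\<close>

text \<open>The list \<open>[\<xi>\<^bsub>s\<^sub>1\<^esub>, \<dots>, \<xi>\<^bsub>s\<^sub>r\<^esub>]\<close>; being a list it is indexed from \<open>0\<close>.\<close>
definition common_slopes ::
    "(real \<Rightarrow> real \<Rightarrow> real) \<Rightarrow> (real \<Rightarrow> real \<Rightarrow> real) \<Rightarrow> real list" where
  "common_slopes G H = sorted_list_of_set (slopes G \<inter> slopes H)"

definition num_common :: "(real \<Rightarrow> real \<Rightarrow> real) \<Rightarrow> (real \<Rightarrow> real \<Rightarrow> real) \<Rightarrow> nat" where
  "num_common G H = length (common_slopes G H)"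

text \<open>In the following two definitions \<open>F\<close> is either \<open>G\<close> or \<open>H\<close>; \<open>cut_index G H F \<kappa>\<close> is
  \<open>k\<^sub>\<kappa>\<close>, and \<open>vertex_block G H F \<kappa>\<close> is \<open>\<Lambda>\<^sub>\<kappa>(F)\<close>.\<close>
definition cut_index ::
    "(real \<Rightarrow> real \<Rightarrow> real) \<Rightarrow> (real \<Rightarrow> real \<Rightarrow> real) \<Rightarrow> (real \<Rightarrow> real \<Rightarrow> real) \<Rightarrow> nat \<Rightarrow> nat" where
  "cut_index G H F \<kappa> =
     (if \<kappa> < num_common G H
      then (THE k. k \<le> newton_s F \<and> edge_slope F (k + 1) = ereal (common_slopes G H ! \<kappa>))
      else newton_s F)"

definition vertex_block ::
    "(real \<Rightarrow> real \<Rightarrow> real) \<Rightarrow> (real \<Rightarrow> real \<Rightarrow> real) \<Rightarrow> (real \<Rightarrow> real \<Rightarrow> real) \<Rightarrow> nat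
      \<Rightarrow> (nat \<times> nat) list" where
  "vertex_block G H F \<kappa> =
     map (newton_vertex F)
       [(if \<kappa> = 0 then 0 else cut_index G H F (\<kappa> - 1) + 1)..<cut_index G H F \<kappa> + 1]"


section \<open>The conditions\<close>

definition opposite_parities :: "(nat \<times> nat) list \<Rightarrow> (nat \<times> nat) list \<Rightarrow> bool" where
  "opposite_parities vs ws \<longleftrightarrow>
     (\<forall>p\<in>set vs. \<forall>q\<in>set vs. even (snd p) \<longleftrightarrow> even (snd q)) \<and>
     (\<forall>p\<in>set ws. \<forall>q\<in>set ws. even (snd p) \<longleftrightarrow> even (snd q)) \<and>
     (\<forall>p\<in>set vs. \<forall>q\<in>set ws. even (snd p) \<noteq> even (snd q))"

definition cond_P1 :: "(real \<Rightarrow> real \<Rightarrow> real) \<Rightarrow> (real \<Rightarrow> real \<Rightarrow> real) \<Rightarrow> bool" where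
  "cond_P1 G H \<longleftrightarrow>
     (\<forall>\<kappa>\<le>num_common G H. opposite_parities (vertex_block G H G \<kappa>) (vertex_block G H H \<kappa>))"

definition cond_P2 :: "(real \<Rightarrow> real \<Rightarrow> real) \<Rightarrow> (real \<Rightarrow> real \<Rightarrow> real) \<Rightarrow> bool" where
  "cond_P2 G H \<longleftrightarrow>
     (\<forall>\<kappa><num_common G H. opposite_parities (vertex_block G H G \<kappa>) (vertex_block G H H \<kappa>)) \<and>
     (\<forall>p\<in>set (butlast (vertex_block G H G (num_common G H))). odd (snd p)) \<and>
     (\<forall>q\<in>set (vertex_block G H H (num_common G H)). even (snd q))"

definition cond_Q :: "(real \<Rightarrow> real \<Rightarrow> real) \<Rightarrow> (real \<Rightarrow> real \<Rightarrow> real) \<Rightarrow> bool" where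
  "cond_Q G H \<longleftrightarrow>
     (\<forall>\<xi>\<in>slopes G \<union> slopes H. \<forall>t. t \<noteq> 0 \<longrightarrow>
        poly (poly_bracket (componential_poly G \<xi>) (componential_poly H \<xi>)) t \<noteq> 0)"

definition polygon_indices :: "(real \<Rightarrow> real \<Rightarrow> real) \<Rightarrow> (nat \<times> nat) list" where
  "polygon_indices F =
     sorted_key_list_of_set fst {p \<in> valid_indices F. lattice_point p \<in> newton_polygon F}"

definition last_vertex :: "(real \<Rightarrow> real \<Rightarrow> real) \<Rightarrow> nat \<times> nat" where
  "last_vertex F = newton_vertex F (newton_s F)"

text \<open>\<open>V\<^sub>*(F)\<close>, the last but one valid index on the polygon; it need not be a vertex.\<close>
definition star_index :: "(real \<Rightarrow> real \<Rightarrow> real) \<Rightarrow> nat \<times> nat" where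
  "star_index F = polygon_indices F ! (length (polygon_indices F) - 2)"

definition cond_S1 :: "(real \<Rightarrow> real \<Rightarrow> real) \<Rightarrow> bool" where
  "cond_S1 F \<longleftrightarrow>
     length (polygon_indices F) \<ge> 2 \<and>
     last (polygon_indices F) = last_vertex F \<and> snd (last_vertex F) = 0 \<and>
     {(i, j) \<in> valid_indices F. 0 < j \<and> j < snd (star_index F)} = {}"

definition cond_S :: "(real \<Rightarrow> real \<Rightarrow> real) \<Rightarrow> (real \<Rightarrow> real \<Rightarrow> real) \<Rightarrow> bool" where
  "cond_S G H \<longleftrightarrow> cond_S1 G \<and> cond_S1 H"

definition coeff_at :: "(real \<Rightarrow> real \<Rightarrow> real) \<Rightarrow> nat \<times> nat \<Rightarrow> real" where
  "coeff_at F p = ps_coeff F (fst p) (snd p)"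

definition cond_H1 :: "(real \<Rightarrow> real \<Rightarrow> real) \<Rightarrow> (real \<Rightarrow> real \<Rightarrow> real) \<Rightarrow> bool" where
  "cond_H1 G H \<longleftrightarrow>
     edge_slope G (newton_s G) > edge_slope H (newton_s H) \<and>
     snd (star_index G) \<le> snd (star_index H)"

definition cond_H2 :: "(real \<Rightarrow> real \<Rightarrow> real) \<Rightarrow> (real \<Rightarrow> real \<Rightarrow> real) \<Rightarrow> bool" where
  "cond_H2 G H \<longleftrightarrow>
     edge_slope G (newton_s G) > edge_slope H (newton_s H) \<and>
     snd (star_index G) > snd (star_index H) \<and> odd (snd (star_index H)) \<and>
     coeff_at G (star_index G) * coeff_at H (last_vertex H)
       * coeff_at G (last_vertex G) * coeff_at H (star_index H) < 0"

definition cond_H3 :: "(real \<Rightarrow> real \<Rightarrow> real) \<Rightarrow> (real \<Rightarrow> real \<Rightarrow> real) \<Rightarrow> bool" where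
  "cond_H3 G H \<longleftrightarrow>
     edge_slope G (newton_s G) = edge_slope H (newton_s H) \<and>
     snd (star_index G) < snd (star_index H)"

definition cond_H4 :: "(real \<Rightarrow> real \<Rightarrow> real) \<Rightarrow> (real \<Rightarrow> real \<Rightarrow> real) \<Rightarrow> bool" where
  "cond_H4 G H \<longleftrightarrow>
     edge_slope G (newton_s G) = edge_slope H (newton_s H) \<and>
     snd (star_index G) = snd (star_index H) \<and>
     coeff_at G (star_index G) * coeff_at H (last_vertex H)
       \<noteq> coeff_at G (last_vertex G) * coeff_at H (star_index H)"

definition cond_L1 :: "(real \<Rightarrow> real \<Rightarrow> real) \<Rightarrow> (real \<Rightarrow> real \<Rightarrow> real) \<Rightarrow> bool" where
  "cond_L1 G H \<longleftrightarrow>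
     snd (last_vertex G) + snd (last_vertex H) > 0 \<and> cond_P1 G H \<and> cond_Q G H"

definition cond_L2 :: "(real \<Rightarrow> real \<Rightarrow> real) \<Rightarrow> (real \<Rightarrow> real \<Rightarrow> real) \<Rightarrow> bool" where
  "cond_L2 G H \<longleftrightarrow>
     snd (last_vertex G) = 0 \<and> snd (last_vertex H) = 0 \<and>
     cond_P2 G H \<and> cond_Q G H \<and> cond_S G H \<and>
     (cond_H1 G H \<or> cond_H2 G H \<or> cond_H3 G H \<or> cond_H4 G H)"

definition C0 :: "(real \<Rightarrow> real \<Rightarrow> real) \<Rightarrow> (real \<Rightarrow> real \<Rightarrow> real) \<Rightarrow> real" where
  "C0 G H =
     (real (snd (newton_vertex G 0)) - real (snd (newton_vertex H 0)))
       * coeff_at G (newton_vertex G 0) * coeff_at H (newton_vertex H 0)"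

end

theory Submission
  imports Defs
begin

text \<open>Write \<open>B\<close> for the bracket. Since \<open>\<theta> B = (\<theta> \<partial>\<^sub>\<theta>\<G>) \<H> - \<G> (\<theta> \<partial>\<^sub>\<theta>\<H>)\<close> and the operator \<open>\<theta> \<partial>\<^sub>\<theta>\<close>
multiplies the coefficient of \<open>\<rho>\<^sup>i \<theta>\<^sup>j\<close> by \<open>j\<close>, the asymptotics of \<open>B\<close> at the origin can be read off the
Newton polygons of \<open>\<G>\<close> and \<open>\<H>\<close>. The heart of the proof is that \<open>B\<close> has no zero with \<open>\<rho> > 0\<close> and
\<open>\<theta> \<noteq> 0\<close> near the origin (\<open>bracket_nonzero_punctured\<close>).

Suppose that such zeros accumulate at the origin, and take a filter of such zeros. An edge of slope
\<open>-w\<close> makes itself felt through the quantity \<open>\<tau> = \<theta> \<rho> powr (-1 / w)\<close>. There are finitely many edges,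
so by compactness the filter can be refined until all these quantities have limits in the extended
real line (\<open>refine_filter\<close>).

\<^item> If for some edge of one of the two polygons the limit \<open>t\<close> is finite and not \<open>0\<close>, then, up to powers
  of \<open>\<rho>\<close>, the functions \<open>\<G>\<close> and \<open>\<H>\<close> tend to the values at \<open>t\<close> of their componential polynomials, and
  \<open>\<theta> B\<close> tends to \<open>t\<close> times the bracket of these polynomials at \<open>t\<close>. By condition (Q) this is not \<open>0\<close>
  (\<open>bracket_nonzero_on_slope\<close>).

\<^item> If all limits are \<open>0\<close> or infinite, the monomial of a single vertex \<open>(i, j)\<close> dominates all the others
  in \<open>\<G>\<close>, and likewise \<open>(k, l)\<close> in \<open>\<H>\<close> (\<open>vertex_dominates\<close>). Then \<open>\<theta> B\<close>, divided by both
  monomials, tends to \<open>(j - l) a b\<close> with nonzero coefficients \<open>a\<close> and \<open>b\<close>. Both vertices come after the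
  edges with limit \<open>0\<close> and before those with infinite limit, so they belong to blocks with the same
  number, and the parity conditions give \<open>j \<noteq> l\<close> (\<open>bracket_nonzero_between_slopes\<close>).

\<^item> The parity argument says nothing when, under (L2), the vertex \<open>(i, j)\<close> is the last one of \<open>\<G>\<close>. Then
  \<open>(k, l)\<close> is the last one of \<open>\<H>\<close> and \<open>j = l = 0\<close>. By (S) the leading terms of \<open>\<theta> \<partial>\<^sub>\<theta>\<G>\<close> and \<open>\<theta> \<partial>\<^sub>\<theta>\<H>\<close> are
  now those of the last but one indices on the polygons, so \<open>\<theta> B\<close> is a difference of two explicit
  terms, and each of (H1) to (H4) prevents these terms from cancelling (\<open>bracket_nonzero_near_axis\<close>).

Hence \<open>B\<close> has constant sign on each of two small squares, one on each side of the axis \<open>\<theta> = 0\<close>. On the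
curve \<open>\<rho> = \<bar>\<theta>\<bar>\<^sup>N\<close> with \<open>N\<close> large the first vertices \<open>(i\<^sub>0, j\<^sub>0)\<close> and \<open>(k\<^sub>0, l\<^sub>0)\<close> dominate, so that \<open>B\<close> has
there the sign of \<open>C\<^sub>0 \<theta> ^ (j\<^sub>0 + l\<^sub>0 - 1)\<close>, where the exponent is even by the parity
conditions. So \<open>B\<close> has the sign of \<open>C\<^sub>0 \<noteq> 0\<close> on both sides, and the points with \<open>\<theta> = 0\<close> are limits of
others (\<open>bracket_sign\<close>).\<close>

section \<open>Double power series\<close>

text \<open>For real series summability in the sense of \<open>has_sum\<close> is absolute, so the value at one point with
positive coordinates dominates the series on a whole closed square.\<close>
lemma has_power_series_absolutely:
  assumes "has_power_series F c"
  obtains r where "r > 0"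
    "\<And>x y. \<bar>x\<bar> \<le> r \<Longrightarrow> \<bar>y\<bar> \<le> r \<Longrightarrow> ((\<lambda>(i, j). c i j * x ^ i * y ^ j) has_sum F x y) UNIV"
    "(\<lambda>(i, j). \<bar>c i j\<bar> * r ^ i * r ^ j) summable_on UNIV"
proof -
  obtain r where r: "r > 0"
    "\<And>x y. \<bar>x\<bar> < r \<and> \<bar>y\<bar> < r \<Longrightarrow> ((\<lambda>(i, j). c i j * x ^ i * y ^ j) has_sum F x y) UNIV"
    using assms unfolding has_power_series_def by blast
  have "(\<lambda>(i, j). c i j * (r/2) ^ i * (r/2) ^ j) summable_on UNIV"
    using r(2)[of "r/2" "r/2"] r(1) by (auto simp: summable_on_def)
  then have "(\<lambda>p. norm (case p of (i, j) \<Rightarrow> c i j * (r/2) ^ i * (r/2) ^ j)) summable_on UNIV"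
    by (subst (asm) summable_on_iff_abs_summable_on_real)
  then have "(\<lambda>(i, j). \<bar>c i j\<bar> * (r/2) ^ i * (r/2) ^ j) summable_on UNIV"
    using r(1) by (simp add: abs_mult power_abs case_prod_unfold del: power_divide)
  then show ?thesis
    using r by (intro that[of "r/2"]) auto
qed

lemma summable_dominated_monomials:
  fixes c :: "nat \<Rightarrow> nat \<Rightarrow> real"
  assumes "(\<lambda>(i, j). \<bar>c i j\<bar> * r ^ i * r ^ j) summable_on UNIV" "\<bar>x\<bar> \<le> r" "\<bar>y\<bar> \<le> r"
  shows "(\<lambda>(i, j). \<bar>c i j * x ^ i * y ^ j\<bar>) summable_on A"
    and "(\<lambda>(i, j). c i j * x ^ i * y ^ j) summable_on A"
proof -
  show *: "(\<lambda>(i, j). \<bar>c i j * x ^ i * y ^ j\<bar>) summable_on A" for A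
    by (rule summable_on_subset_banach[of _ UNIV], rule summable_on_comparison_test[OF assms(1)])
       (use assms in \<open>auto simp: abs_mult power_abs intro!: mult_mono power_mono\<close>)
  then show "(\<lambda>(i, j). c i j * x ^ i * y ^ j) summable_on A"
    by (subst summable_on_iff_abs_summable_on_real) (simp add: case_prod_unfold)
qed

text \<open>Once the lower coefficients are known to vanish, the series can be divided by \<open>x ^ n\<close>, and the limit
of the quotient at \<open>0\<close> is the coefficient in question.\<close>
lemma power_series_zero_coeff:
  fixes a :: "nat \<Rightarrow> real"
  assumes "r > 0" "\<And>x. \<bar>x\<bar> < r \<Longrightarrow> (\<lambda>n. a n * x ^ n) sums 0"
  shows "a n = 0"
proof (induction n rule: less_induct)
  case (less n)
  have "(\<lambda>k. a (k + n) * x ^ k) sums 0" if "x \<noteq> 0" "\<bar>x\<bar> < r" for x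
  proof -
    have "(\<lambda>k. a (k + n) * x ^ (k + n)) sums (0 - (\<Sum>k<n. a k * x ^ k))"
      using assms(2)[OF that(2)] by (rule sums_split_initial_segment)
    then have "(\<lambda>k. a (k + n) * x ^ (k + n) * inverse (x ^ n)) sums (0 * inverse (x ^ n))"
      using less by (intro sums_mult2) simp
    then show ?thesis using that by (simp add: power_add field_simps)
  qed
  then have "((\<lambda>_::real. 0::real) \<longlongrightarrow> a (0 + n)) (at 0)"
    by (intro powser_limit_0_strong[OF assms(1)]) auto
  then have "(0::real) = a (0 + n)" by (rule LIM_unique[OF tendsto_const])
  then show ?case by simp
qed

text \<open>Fixing the second variable gives a power series in the first one that vanishes, so all its
coefficients vanish; these coefficients are themselves power series in the second variable. This
makes \<open>ps_coeff\<close> meaningful.\<close>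
lemma has_power_series_unique:
  assumes "has_power_series F c" "has_power_series F d"
  shows "c = d"
proof -
  obtain r where r: "r > 0"
    "\<And>x y. \<bar>x\<bar> \<le> r \<Longrightarrow> \<bar>y\<bar> \<le> r \<Longrightarrow> ((\<lambda>(i, j). c i j * x ^ i * y ^ j) has_sum F x y) UNIV"
    "(\<lambda>(i, j). \<bar>c i j\<bar> * r ^ i * r ^ j) summable_on UNIV"
    by (rule has_power_series_absolutely[OF assms(1)]) blast
  obtain r' where r': "r' > 0"
    "\<And>x y. \<bar>x\<bar> \<le> r' \<Longrightarrow> \<bar>y\<bar> \<le> r' \<Longrightarrow> ((\<lambda>(i, j). d i j * x ^ i * y ^ j) has_sum F x y) UNIV"
    "(\<lambda>(i, j). \<bar>d i j\<bar> * r' ^ i * r' ^ j) summable_on UNIV"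
    by (rule has_power_series_absolutely[OF assms(2)]) blast
  define R where "R = min r r'"
  define e where "e i j = c i j - d i j" for i j
  have R: "R > 0" using r r' by (simp add: R_def)
  have z: "((\<lambda>(i, j). e i j * x ^ i * y ^ j) has_sum 0) (UNIV \<times> UNIV)" if "\<bar>x\<bar> < R" "\<bar>y\<bar> < R" for x y
    using has_sum_add[OF r(2)[of x y] has_sum_uminusI[OF r'(2)[of x y]]] that
    by (simp add: R_def e_def case_prod_unfold algebra_simps)
  have row: "((\<lambda>j. e i j * y ^ j) has_sum infsum (\<lambda>j. e i j * y ^ j) UNIV) UNIV"
    if "\<bar>y\<bar> < R" for i y
  proof -
    have "(\<lambda>j. e i j * (R/2) ^ i * y ^ j) summable_on UNIV"
      using z[of "R/2" y] that R
      by (intro summable_on_SigmaD1[where A = UNIV and B = "\<lambda>_. UNIV"]) (auto simp: summable_on_def)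
    then have "(\<lambda>j. (e i j * (R/2) ^ i * y ^ j) * inverse ((R/2)^i)) summable_on UNIV"
      by (rule summable_on_cmult_left)
    then show ?thesis using R by (intro has_sum_infsum) (simp add: field_simps)
  qed
  have rowz: "infsum (\<lambda>j. e i j * y ^ j) UNIV = 0" if y: "\<bar>y\<bar> < R" for i y
  proof (rule power_series_zero_coeff[OF R])
    fix x assume x: "\<bar>x\<bar> < R"
    have "((\<lambda>i. x ^ i * infsum (\<lambda>j. e i j * y ^ j) UNIV) has_sum 0) UNIV"
    proof (rule has_sum_SigmaD[OF z[OF x y]])
      fix i show "((\<lambda>j. case (i, j) of (i, j) \<Rightarrow> e i j * x ^ i * y ^ j) has_sum
                   x ^ i * infsum (\<lambda>j. e i j * y ^ j) UNIV) UNIV"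
        using has_sum_cmult_right[OF row[OF y, of i], of "x ^ i"] by (simp add: mult_ac)
    qed
    then show "(\<lambda>i. infsum (\<lambda>j. e i j * y ^ j) UNIV * x ^ i) sums 0"
      using has_sum_imp_sums by (auto simp: mult_ac)
  qed
  have "e i j = 0" for i j
  proof (rule power_series_zero_coeff[OF R])
    fix y assume y: "\<bar>y\<bar> < R"
    show "(\<lambda>j. e i j * y ^ j) sums 0"
      using has_sum_imp_sums[OF row[OF y, of i]] rowz[OF y] by simp
  qed
  then show ?thesis by (auto simp: e_def)
qed

lemma ps_coeff_eqI:
  assumes "has_power_series F c"
  shows "ps_coeff F = c"
  unfolding ps_coeff_def using assms has_power_series_unique by blast

lemma has_power_series_ps_coeff:
  "analytic_at_origin F \<Longrightarrow> has_power_series F (ps_coeff F)"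
  by (auto simp: analytic_at_origin_def ps_coeff_eqI)

lemma valid_indices_nonempty:
  assumes "analytic_at_origin F" "nonzero_germ F"
  shows "valid_indices F \<noteq> {}"
proof
  assume e: "valid_indices F = {}"
  obtain r where r: "r > 0" "\<And>x y. \<bar>x\<bar> < r \<and> \<bar>y\<bar> < r \<Longrightarrow>
      ((\<lambda>(i, j). ps_coeff F i j * x ^ i * y ^ j) has_sum F x y) UNIV"
    using has_power_series_ps_coeff[OF assms(1)] unfolding has_power_series_def by blast
  have c0: "ps_coeff F i j = 0" for i j using e by (auto simp: valid_indices_def)
  have 0: "F x y = 0" if "\<bar>x\<bar> < r \<and> \<bar>y\<bar> < r" for x y
    using has_sum_unique[OF r(2)[OF that]] by (simp add: c0 case_prod_unfold)
  have "eventually (\<lambda>z. z \<in> {-r<..<r} \<times> {-r<..<r}) (nhds (0::real, 0::real))"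
    using r by (intro eventually_nhds_in_open open_Times) auto
  then have "\<forall>\<^sub>F (x, y) in nhds (0, 0). F x y = 0"
    by eventually_elim (auto intro!: 0)
  then show False using assms by (simp add: nonzero_germ_def)
qed

section \<open>Differentiation in the second variable, and continuity\<close>

lemma Suc_le_two_power: "real (Suc j) \<le> 2 ^ j"
  by (induction j) auto

text \<open>For fixed \<open>x\<close> this is termwise differentiation of the power series in \<open>y\<close> with coefficients \<open>e x j\<close>.
The factors \<open>Suc j\<close> are at most \<open>2 ^ j\<close>, so that absolute convergence persists on the square of half
the size.\<close>
lemma theta_derivative_power_series:
  assumes "has_power_series F c"
  shows "has_power_series (\<lambda>x y. deriv (F x) y) (\<lambda>i j. real (Suc j) * c i (Suc j))"
proof -
  obtain r where r: "r > 0"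
    and s: "\<And>x y. \<bar>x\<bar> \<le> r \<Longrightarrow> \<bar>y\<bar> \<le> r \<Longrightarrow> ((\<lambda>(i, j). c i j * x ^ i * y ^ j) has_sum F x y) UNIV"
    and a: "(\<lambda>(i, j). \<bar>c i j\<bar> * r ^ i * r ^ j) summable_on UNIV"
    by (rule has_power_series_absolutely[OF assms]) blast
  define d where "d i j = real (Suc j) * c i (Suc j)" for i j
  define e where "e x j = infsum (\<lambda>i. c i j * x ^ i) UNIV" for x j
  have col: "((\<lambda>i. c i j * x ^ i) has_sum e x j) UNIV" if "\<bar>x\<bar> \<le> r" for x j
  proof -
    have "(\<lambda>(i, j). c i j * x ^ i * r ^ j) summable_on (UNIV \<times> UNIV)"
      using summable_dominated_monomials(2)[OF a, of x r] that r by auto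
    then have "(\<lambda>(j, i). c i j * x ^ i * r ^ j) summable_on (UNIV \<times> UNIV)"
      by (subst (asm) summable_on_swap) (simp add: case_prod_unfold)
    then have "(\<lambda>i. c i j * x ^ i * r ^ j) summable_on UNIV"
      by (rule summable_on_SigmaD1) auto
    then have "(\<lambda>i. (c i j * x ^ i * r ^ j) * inverse (r ^ j)) summable_on UNIV"
      by (rule summable_on_cmult_left)
    then show ?thesis unfolding e_def using r by (intro has_sum_infsum) (simp add: field_simps)
  qed
  have Fs: "(\<lambda>j. e x j * y ^ j) sums F x y" if "\<bar>x\<bar> \<le> r" "\<bar>y\<bar> \<le> r" for x y
  proof -
    have "((\<lambda>(j, i). c i j * x ^ i * y ^ j) has_sum F x y) (UNIV \<times> UNIV)"
      using s[OF that] by (subst has_sum_swap) (simp add: case_prod_unfold)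
    then have "((\<lambda>j. e x j * y ^ j) has_sum F x y) UNIV"
    proof (rule has_sum_SigmaD)
      fix j show "((\<lambda>i. case (j, i) of (j, i) \<Rightarrow> c i j * x ^ i * y ^ j) has_sum e x j * y ^ j) UNIV"
        using has_sum_cmult_left[OF col[OF that(1), of j], of "y ^ j"] by simp
    qed
    then show ?thesis by (rule has_sum_imp_sums)
  qed
  have D: "deriv (F x) y = (\<Sum>j. real (Suc j) * e x (Suc j) * y ^ j)" if "\<bar>x\<bar> < r" "\<bar>y\<bar> < r" for x y
  proof -
    have "DERIV (\<lambda>y. \<Sum>j. e x j * y ^ j) y :> (\<Sum>j. diffs (e x) j * y ^ j)"
      using Fs[of x r] that r by (intro termdiffs_strong[of _ r]) (auto simp: sums_iff)
    then have "DERIV (F x) y :> (\<Sum>j. diffs (e x) j * y ^ j)"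
      by (rule has_field_derivative_transform_within_open[of _ _ _ "{-r<..<r}"])
         (use Fs that in \<open>auto simp: sums_iff abs_less_iff abs_le_iff\<close>)
    then show ?thesis by (simp add: DERIV_imp_deriv diffs_def)
  qed
  have ad: "(\<lambda>(i, j). \<bar>d i j\<bar> * (r/2) ^ i * (r/2) ^ j) summable_on UNIV"
  proof -
    have "(\<lambda>(i, j). \<bar>c i j\<bar> * r ^ i * r ^ j) summable_on ((\<lambda>(i, j). (i, Suc j)) ` UNIV)"
      by (rule summable_on_subset_banach[OF a]) auto
    then have "((\<lambda>(i, j). \<bar>c i j\<bar> * r ^ i * r ^ j) \<circ> (\<lambda>(i, j). (i, Suc j))) summable_on UNIV"
      by (subst (asm) summable_on_reindex) (auto simp: inj_on_def)
    then have "(\<lambda>(i, j). \<bar>c i (Suc j)\<bar> * r ^ i * r ^ Suc j) summable_on UNIV"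
      by (simp add: o_def case_prod_unfold)
    then have "(\<lambda>p. (case p of (i, j) \<Rightarrow> \<bar>c i (Suc j)\<bar> * r ^ i * r ^ Suc j) * inverse r) summable_on UNIV"
      by (rule summable_on_cmult_left)
    then show ?thesis
    proof (rule summable_on_comparison_test, goal_cases)
      case (1 p)
      obtain i j where p: "p = (i, j)" by force
      have "real (Suc j) * (r/2) ^ j \<le> r ^ j"
        using mult_right_mono[OF Suc_le_two_power[of j], of "(r/2) ^ j"] r
        by (simp add: power_divide)
      moreover have "(r/2) ^ i \<le> r ^ i" using r by (intro power_mono) auto
      ultimately have "(r/2) ^ i * (real (Suc j) * (r/2) ^ j) \<le> r ^ i * r ^ j"
        using r by (intro mult_mono) auto
      then have "\<bar>c i (Suc j)\<bar> * ((r/2) ^ i * (real (Suc j) * (r/2) ^ j)) \<le> \<bar>c i (Suc j)\<bar> * (r ^ i * r ^ j)"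
        by (intro mult_left_mono) auto
      then have "\<bar>d i j\<bar> * (r/2) ^ i * (r/2) ^ j \<le> \<bar>c i (Suc j)\<bar> * r ^ i * r ^ j"
        by (simp only: d_def abs_mult abs_of_nat mult_ac)
      also have "\<dots> = \<bar>c i (Suc j)\<bar> * r ^ i * r ^ Suc j * inverse r" using r by simp
      finally show ?case by (simp only: p prod.case)
    qed (use r in auto)
  qed
  show ?thesis
    unfolding has_power_series_def
  proof (intro exI[of _ "r/2"] conjI allI impI)
    fix x y assume xy: "\<bar>x\<bar> < r/2 \<and> \<bar>y\<bar> < r/2"
    obtain S where S: "((\<lambda>(i, j). d i j * x ^ i * y ^ j) has_sum S) (UNIV \<times> UNIV)"
      using summable_dominated_monomials(2)[OF ad, of x y] xy by (auto simp: summable_on_def)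
    have "((\<lambda>(j, i). d i j * x ^ i * y ^ j) has_sum S) (UNIV \<times> UNIV)"
      using S by (subst has_sum_swap) (simp add: case_prod_unfold)
    then have "((\<lambda>j. real (Suc j) * e x (Suc j) * y ^ j) has_sum S) UNIV"
    proof (rule has_sum_SigmaD)
      fix j show "((\<lambda>i. case (j, i) of (j, i) \<Rightarrow> d i j * x ^ i * y ^ j) has_sum
            real (Suc j) * e x (Suc j) * y ^ j) UNIV"
        using has_sum_cmult_right[OF col[of x "Suc j"], of "real (Suc j) * y ^ j"] xy r
        by (simp add: d_def mult_ac)
    qed
    then have "S = deriv (F x) y"
      using D[of x y] xy r by (simp add: has_sum_imp_sums sums_unique)
    then show "((\<lambda>(i, j). real (Suc j) * c i (Suc j) * x ^ i * y ^ j) has_sum deriv (F x) y) UNIV"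
      using S by (simp add: d_def)
  qed (use r in auto)
qed

text \<open>The operator \<open>y \<partial>\<^sub>y\<close> acts diagonally on monomials and keeps their exponents. For this reason it is used
below in place of the derivative.\<close>
lemma euler_theta_power_series:
  assumes "has_power_series F c"
  shows "has_power_series (\<lambda>x y. y * deriv (F x) y) (\<lambda>i j. real j * c i j)"
proof -
  obtain r where r: "r > 0"
    and s: "\<And>x y. \<bar>x\<bar> < r \<and> \<bar>y\<bar> < r \<Longrightarrow>
      ((\<lambda>(i, j). real (Suc j) * c i (Suc j) * x ^ i * y ^ j) has_sum deriv (F x) y) UNIV"
    using theta_derivative_power_series[OF assms] unfolding has_power_series_def by blast
  show ?thesis
    unfolding has_power_series_def
  proof (intro exI[of _ r] conjI allI impI)
    fix x y assume xy: "\<bar>x\<bar> < r \<and> \<bar>y\<bar> < r"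
    have "((\<lambda>(i, j). real j * c i j * x ^ i * y ^ j) has_sum y * deriv (F x) y)
            ((\<lambda>(i, j). (i, Suc j)) ` UNIV)"
      using has_sum_cmult_right[OF s[OF xy], of y]
      by (subst has_sum_reindex) (auto simp: inj_on_def o_def case_prod_unfold mult_ac)
    then show "((\<lambda>(i, j). real j * c i j * x ^ i * y ^ j) has_sum y * deriv (F x) y) UNIV"
    proof (rule has_sum_cong_neutral[THEN iffD1, rotated 3])
      fix p :: "nat \<times> nat" assume "p \<in> UNIV - (\<lambda>(i, j). (i, Suc j)) ` UNIV"
      then have "snd p = 0" by (cases p; cases "snd p") auto
      then show "(case p of (i, j) \<Rightarrow> real j * c i j * x ^ i * y ^ j) = 0"
        by (simp add: case_prod_unfold)
    qed auto
  qed (rule r)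
qed

lemma power_series_continuous:
  assumes "has_power_series F c"
  obtains r where "r > 0" "continuous_on ({-r..r} \<times> {-r..r}) (\<lambda>(x, y). F x y)"
proof -
  obtain r where r: "r > 0"
    and s: "\<And>x y. \<bar>x\<bar> \<le> r \<Longrightarrow> \<bar>y\<bar> \<le> r \<Longrightarrow> ((\<lambda>(i, j). c i j * x ^ i * y ^ j) has_sum F x y) UNIV"
    and a: "(\<lambda>(i, j). \<bar>c i j\<bar> * r ^ i * r ^ j) summable_on UNIV"
    by (rule has_power_series_absolutely[OF assms]) blast
  have "uniform_limit ({-r..r} \<times> {-r..r})
          (\<lambda>X z. \<Sum>p\<in>X. c (fst p) (snd p) * fst z ^ fst p * snd z ^ snd p) (\<lambda>(x, y). F x y)
          (finite_subsets_at_top UNIV)"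
    by (rule Weierstrass_m_test_general'[where M = "\<lambda>(i, j). \<bar>c i j\<bar> * r ^ i * r ^ j"])
       (use a s in \<open>auto simp: abs_mult power_abs case_prod_unfold intro!: mult_mono power_mono\<close>)
  then have "continuous_on ({-r..r} \<times> {-r..r}) (\<lambda>(x, y). F x y)"
    by (rule uniform_limit_theorem[rotated]) (auto intro!: continuous_intros always_eventually)
  then show ?thesis using that r by blast
qed

section \<open>Analyticity of the polar components\<close>

text \<open>A bound for the sum of the absolute values of the Taylor coefficients. This norm is submultiplicative,
which makes the growth of trigonometric polynomials in terms of their degree obvious.\<close>
definition wiener_bounded :: "(real \<Rightarrow> real) \<Rightarrow> real \<Rightarrow> bool" where
  "wiener_bounded g M \<longleftrightarrow> (\<exists>f. summable (\<lambda>n. \<bar>f n\<bar>) \<and> (\<Sum>n. \<bar>f n\<bar>) \<le> M \<and>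
     (\<forall>t. \<bar>t\<bar> \<le> 1 \<longrightarrow> (\<lambda>n. f n * t ^ n) sums g t))"

lemma wiener_bounded_nonneg: "wiener_bounded g M \<Longrightarrow> M \<ge> 0"
  unfolding wiener_bounded_def by (meson abs_ge_zero order_trans suminf_nonneg)

lemma wiener_bounded_const: "wiener_bounded (\<lambda>_. c) \<bar>c\<bar>"
proof -
  have s: "(\<lambda>n. if n = 0 then \<bar>c\<bar> else 0) sums \<bar>c\<bar>"
    using sums_single[of 0 "\<lambda>_. \<bar>c\<bar>"] by simp
  have e: "(\<lambda>n. \<bar>if n = 0 then c else 0\<bar>) = (\<lambda>n::nat. if n = 0 then \<bar>c\<bar> else 0)" by auto
  have t: "(\<lambda>n. (if n = 0 then c else 0) * t ^ n) sums c" for t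
  proof -
    have "(\<lambda>n. (if n = 0 then c else 0) * t ^ n) = (\<lambda>n. if n = 0 then c else 0)" by auto
    then show ?thesis using sums_single[of 0 "\<lambda>_. c"] by simp
  qed
  show ?thesis
    unfolding wiener_bounded_def
    by (rule exI[of _ "\<lambda>n. if n = 0 then c else 0"]) (use s t in \<open>simp add: e sums_iff\<close>)
qed

lemma wiener_bounded_add:
  assumes "wiener_bounded g M" "wiener_bounded h N"
  shows "wiener_bounded (\<lambda>t. g t + h t) (M + N)"
proof -
  obtain a where a: "summable (\<lambda>n. \<bar>a n\<bar>)" "(\<Sum>n. \<bar>a n\<bar>) \<le> M"
    "\<And>t. \<bar>t\<bar> \<le> 1 \<Longrightarrow> (\<lambda>n. a n * t ^ n) sums g t"
    using assms(1) unfolding wiener_bounded_def by blast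
  obtain b where b: "summable (\<lambda>n. \<bar>b n\<bar>)" "(\<Sum>n. \<bar>b n\<bar>) \<le> N"
    "\<And>t. \<bar>t\<bar> \<le> 1 \<Longrightarrow> (\<lambda>n. b n * t ^ n) sums h t"
    using assms(2) unfolding wiener_bounded_def by blast
  have s: "summable (\<lambda>n. \<bar>a n\<bar> + \<bar>b n\<bar>)" using a b by (intro summable_add)
  have s': "summable (\<lambda>n. \<bar>a n + b n\<bar>)"
    by (rule summable_comparison_test[OF _ s]) (auto intro!: exI[of _ 0])
  have "(\<Sum>n. \<bar>a n + b n\<bar>) \<le> (\<Sum>n. \<bar>a n\<bar> + \<bar>b n\<bar>)"
    by (rule suminf_le[OF _ s' s]) auto
  also have "\<dots> \<le> M + N" using a b by (simp add: suminf_add[symmetric])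
  finally have "(\<Sum>n. \<bar>a n + b n\<bar>) \<le> M + N" .
  then show ?thesis
    unfolding wiener_bounded_def using s' a(3) b(3)
    by (intro exI[of _ "\<lambda>n. a n + b n"]) (auto simp: algebra_simps intro!: sums_add)
qed

lemma wiener_bounded_mult:
  assumes "wiener_bounded g M" "wiener_bounded h N"
  shows "wiener_bounded (\<lambda>t. g t * h t) (M * N)"
proof -
  obtain a where a: "summable (\<lambda>n. \<bar>a n\<bar>)" "(\<Sum>n. \<bar>a n\<bar>) \<le> M"
    "\<And>t. \<bar>t\<bar> \<le> 1 \<Longrightarrow> (\<lambda>n. a n * t ^ n) sums g t"
    using assms(1) unfolding wiener_bounded_def by blast
  obtain b where b: "summable (\<lambda>n. \<bar>b n\<bar>)" "(\<Sum>n. \<bar>b n\<bar>) \<le> N"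
    "\<And>t. \<bar>t\<bar> \<le> 1 \<Longrightarrow> (\<lambda>n. b n * t ^ n) sums h t"
    using assms(2) unfolding wiener_bounded_def by blast
  define c where "c k = (\<Sum>i\<le>k. a i * b (k - i))" for k
  have P: "(\<lambda>k. \<Sum>i\<le>k. \<bar>a i\<bar> * \<bar>b (k - i)\<bar>) sums ((\<Sum>k. \<bar>a k\<bar>) * (\<Sum>k. \<bar>b k\<bar>))"
    using a b by (intro Cauchy_product_sums) auto
  have le: "\<bar>c k\<bar> \<le> (\<Sum>i\<le>k. \<bar>a i\<bar> * \<bar>b (k - i)\<bar>)" for k
    unfolding c_def by (rule order_trans[OF sum_abs]) (simp add: abs_mult)
  have s': "summable (\<lambda>n. \<bar>c n\<bar>)"
    by (rule summable_comparison_test[OF _ sums_summable[OF P]]) (use le in auto)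
  have "(\<Sum>n. \<bar>c n\<bar>) \<le> (\<Sum>k. \<bar>a k\<bar>) * (\<Sum>k. \<bar>b k\<bar>)"
    using suminf_le[OF le s' sums_summable[OF P]] P by (simp add: sums_iff)
  also have "\<dots> \<le> M * N"
    using a b wiener_bounded_nonneg[OF assms(1)] by (intro mult_mono suminf_nonneg) auto
  finally have "(\<Sum>n. \<bar>c n\<bar>) \<le> M * N" .
  moreover have "(\<lambda>k. c k * t ^ k) sums (g t * h t)" if t: "\<bar>t\<bar> \<le> 1" for t
  proof -
    have dom: "summable (\<lambda>n. norm (x n * t ^ n))" if "summable (\<lambda>n. \<bar>x n\<bar>)" for x
      by (rule summable_comparison_test[OF _ that])
         (use t in \<open>auto simp: abs_mult power_abs power_le_one intro!: mult_left_le exI[of _ 0]\<close>)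
    have "(\<lambda>k. \<Sum>i\<le>k. (a i * t ^ i) * (b (k - i) * t ^ (k - i))) sums
            ((\<Sum>k. a k * t ^ k) * (\<Sum>k. b k * t ^ k))"
      by (intro Cauchy_product_sums dom a b)
    moreover have "(\<Sum>i\<le>k. (a i * t ^ i) * (b (k - i) * t ^ (k - i))) = c k * t ^ k" for k
    proof -
      have "(\<Sum>i\<le>k. (a i * t ^ i) * (b (k - i) * t ^ (k - i))) = (\<Sum>i\<le>k. a i * b (k - i) * t ^ k)"
      proof (rule sum.cong[OF refl])
        fix i assume "i \<in> {..k}"
        then have "t ^ k = t ^ i * t ^ (k - i)" by (simp flip: power_add)
        then show "(a i * t ^ i) * (b (k - i) * t ^ (k - i)) = a i * b (k - i) * t ^ k"
          by (simp only: mult_ac)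
      qed
      then show ?thesis by (simp add: c_def sum_distrib_right)
    qed
    ultimately show ?thesis using a(3)[OF t] b(3)[OF t] by (simp add: sums_iff)
  qed
  ultimately show ?thesis unfolding wiener_bounded_def using s' by blast
qed

lemma wiener_bounded_power:
  "wiener_bounded g M \<Longrightarrow> wiener_bounded (\<lambda>t. g t ^ n) (M ^ n)"
proof (induction n)
  case 0
  then show ?case using wiener_bounded_const[of 1] by simp
qed (simp add: wiener_bounded_mult)

lemma wiener_bounded_sum:
  "finite I \<Longrightarrow> (\<And>i. i \<in> I \<Longrightarrow> wiener_bounded (g i) (M i)) \<Longrightarrow>
     wiener_bounded (\<lambda>t. \<Sum>i\<in>I. g i t) (\<Sum>i\<in>I. M i)"
proof (induction rule: finite_induct)
  case empty
  then show ?case using wiener_bounded_const[of 0] by simp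
qed (simp add: wiener_bounded_add)

text \<open>Comparison with the series of \<open>exp 1 \<le> 3\<close>.\<close>
lemma wiener_bounded_inverse_fact:
  assumes "\<And>n. \<bar>f n\<bar> \<le> inverse (fact n)" "\<And>t. (\<lambda>n. f n * t ^ n) sums g t"
  shows "wiener_bounded g 3"
proof -
  have e: "(\<lambda>n. inverse (fact n)) sums exp (1::real)"
    using exp_converges[of "1::real"] by simp
  have s: "summable (\<lambda>n. \<bar>f n\<bar>)"
    by (rule summable_comparison_test[OF _ sums_summable[OF e]]) (use assms in auto)
  have "(\<Sum>n. \<bar>f n\<bar>) \<le> exp 1"
    using suminf_le[OF assms(1) s sums_summable[OF e]] e by (simp add: sums_iff)
  also have "\<dots> \<le> 3" by (rule exp_le)
  finally show ?thesis unfolding wiener_bounded_def using s assms(2) by blast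
qed

lemma wiener_bounded_cos: "wiener_bounded cos 3" and wiener_bounded_sin: "wiener_bounded sin 3"
proof -
  show "wiener_bounded cos 3"
  proof (rule wiener_bounded_inverse_fact[of cos_coeff])
    show "\<bar>cos_coeff n\<bar> \<le> inverse (fact n)" for n
      by (simp add: cos_coeff_def power_abs divide_inverse abs_mult)
    show "(\<lambda>n. cos_coeff n * t ^ n) sums cos t" for t using cos_converges[of t] by simp
  qed
  show "wiener_bounded sin 3"
  proof (rule wiener_bounded_inverse_fact[of sin_coeff])
    show "\<bar>sin_coeff n\<bar> \<le> inverse (fact n)" for n
      by (simp add: sin_coeff_def power_abs divide_inverse abs_mult)
    show "(\<lambda>n. sin_coeff n * t ^ n) sums sin t" for t using sin_converges[of t] by simp
  qed
qed

text \<open>The exponentially bounded norms of the functions \<open>P k\<close> make the double series absolutely convergent,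
so that it may be summed first over the powers of \<open>y\<close>.\<close>
lemma analytic_at_origin_series:
  assumes P: "\<And>k. wiener_bounded (P k) (A k)" and r: "r > 0" and A: "summable (\<lambda>k. A k * r ^ k)"
  shows "analytic_at_origin (\<lambda>x y. \<Sum>k. P k y * x ^ k)"
proof -
  obtain f where f: "\<And>k. summable (\<lambda>n. \<bar>f k n\<bar>)" "\<And>k. (\<Sum>n. \<bar>f k n\<bar>) \<le> A k"
    "\<And>k t. \<bar>t\<bar> \<le> 1 \<Longrightarrow> (\<lambda>n. f k n * t ^ n) sums P k t"
    using P unfolding wiener_bounded_def by metis
  have dom: "(\<lambda>(k, n). \<bar>f k n\<bar> * r ^ k) summable_on (UNIV \<times> UNIV)"
  proof (rule summable_on_SigmaI)
    fix k
    have "((\<lambda>n. \<bar>f k n\<bar>) has_sum (\<Sum>n. \<bar>f k n\<bar>)) UNIV"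
      using f(1) by (intro norm_summable_imp_has_sum) (auto simp: summable_sums)
    then show "((\<lambda>n. case (k, n) of (k, n) \<Rightarrow> \<bar>f k n\<bar> * r ^ k) has_sum ((\<Sum>n. \<bar>f k n\<bar>) * r ^ k)) UNIV"
      using has_sum_cmult_left by force
  next
    have "summable (\<lambda>k. (\<Sum>n. \<bar>f k n\<bar>) * r ^ k)"
      by (rule summable_comparison_test[OF _ A])
         (use f r in \<open>auto simp: abs_mult suminf_nonneg intro!: mult_right_mono\<close>)
    then show "(\<lambda>k. (\<Sum>n. \<bar>f k n\<bar>) * r ^ k) summable_on UNIV"
      using f r by (subst summable_on_UNIV_nonneg_real_iff) (auto intro!: mult_nonneg_nonneg suminf_nonneg)
  qed (use r in auto)
  have "has_power_series (\<lambda>x y. \<Sum>k. P k y * x ^ k) f"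
    unfolding has_power_series_def
  proof (intro exI[of _ "min r 1"] conjI allI impI)
    fix x y assume xy: "\<bar>x\<bar> < min r 1 \<and> \<bar>y\<bar> < min r 1"
    have abss: "summable (\<lambda>n. norm (f k n * y ^ n))" for k
      by (rule summable_comparison_test[OF _ f(1)[of k]])
         (use xy in \<open>auto simp: abs_mult power_abs power_le_one intro!: mult_left_le exI[of _ 0]\<close>)
    have "(\<lambda>p. norm (case p of (k, n) \<Rightarrow> f k n * x ^ k * y ^ n)) summable_on (UNIV \<times> UNIV)"
    proof (rule summable_on_comparison_test[OF dom], goal_cases)
      case (1 p)
      obtain k n where p: "p = (k, n)" by force
      have "\<bar>x\<bar> ^ k * \<bar>y\<bar> ^ n \<le> r ^ k * 1"
        using xy by (intro mult_mono power_mono power_le_one) auto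
      then have "\<bar>f k n\<bar> * (\<bar>x\<bar> ^ k * \<bar>y\<bar> ^ n) \<le> \<bar>f k n\<bar> * r ^ k"
        by (intro mult_left_mono) auto
      then show ?case by (simp add: p abs_mult power_abs mult_ac)
    qed auto
    then have "(\<lambda>(k, n). f k n * x ^ k * y ^ n) summable_on (UNIV \<times> UNIV)"
      by (subst summable_on_iff_abs_summable_on_real)
    then obtain S where S: "((\<lambda>(k, n). f k n * x ^ k * y ^ n) has_sum S) (UNIV \<times> UNIV)"
      by (auto simp: summable_on_def)
    then have "((\<lambda>k. P k y * x ^ k) has_sum S) UNIV"
    proof (rule has_sum_SigmaD)
      fix k
      have "((\<lambda>n. f k n * y ^ n) has_sum P k y) UNIV"
        using xy by (intro norm_summable_imp_has_sum abss f(3)) auto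
      then have "((\<lambda>n. f k n * y ^ n * x ^ k) has_sum (P k y * x ^ k)) UNIV"
        by (rule has_sum_cmult_left)
      then show "((\<lambda>n. case (k, n) of (k, n) \<Rightarrow> f k n * x ^ k * y ^ n) has_sum (P k y * x ^ k)) UNIV"
        by (simp add: mult_ac)
    qed
    then have "S = (\<Sum>k. P k y * x ^ k)"
      using has_sum_imp_sums sums_unique by blast
    then show "((\<lambda>(k, n). f k n * x ^ k * y ^ n) has_sum (\<Sum>k. P k y * x ^ k)) UNIV"
      using S by simp
  qed (use r in auto)
  then show ?thesis unfolding analytic_at_origin_def by blast
qed

text \<open>The absolutely convergent double series of \<open>F\<close> on the diagonal \<open>x = y = R\<close>, arranged by total degree.\<close>
lemma homogeneous_norms_summable:
  assumes "analytic_at_origin F"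
  obtains R where "R > 0"
    "\<And>r. 0 < r \<Longrightarrow> r \<le> R \<Longrightarrow> summable (\<lambda>k. (\<Sum>i\<le>k + m. \<bar>ps_coeff F i (k + m - i)\<bar>) * r ^ k)"
proof -
  define c where "c = ps_coeff F"
  define S where "S n = (\<Sum>i\<le>n. \<bar>c i (n - i)\<bar>)" for n
  obtain R where R: "R > 0" "(\<lambda>(i, j). \<bar>c i j\<bar> * R ^ i * R ^ j) summable_on UNIV"
    unfolding c_def by (rule has_power_series_absolutely[OF has_power_series_ps_coeff[OF assms]]) blast
  have "(\<lambda>(n, i). \<bar>c i (n - i)\<bar> * R ^ n) summable_on (SIGMA n:UNIV. {..n})"
    using R(2)
    by (rule summable_on_reindex_bij_witness[where i = "\<lambda>(i, j). (i + j, i)"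
          and j = "\<lambda>(n, i). (i, n - i)", THEN iffD2, rotated -1])
       (auto simp: mult.assoc simp flip: power_add)
  then have "(\<lambda>n. infsum (\<lambda>i. \<bar>c i (n - i)\<bar> * R ^ n) {..n}) summable_on UNIV"
    by (rule summable_on_Sigma_banach)
  then have "summable (\<lambda>n. S n * R ^ n)"
    by (intro summable_on_imp_summable) (simp add: S_def sum_distrib_right)
  then have "summable (\<lambda>k. S (k + m) * R ^ (k + m))"
    by (rule summable_ignore_initial_segment)
  then have "summable (\<lambda>k. S (k + m) * R ^ (k + m) * inverse (R ^ m))"
    by (rule summable_mult2)
  then have s: "summable (\<lambda>k. S (k + m) * R ^ k)"
    using R(1) by (simp add: power_add field_simps)
  have "summable (\<lambda>k. S (k + m) * r ^ k)" if "0 < r" "r \<le> R" for r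
    by (rule summable_comparison_test[OF _ s])
       (use that in \<open>auto simp: abs_mult S_def sum_nonneg intro!: mult_left_mono power_mono\<close>)
  then show ?thesis using that R(1) unfolding S_def c_def by blast
qed

lemma wiener_bounded_homogeneous_part:
  "wiener_bounded (\<lambda>t. homogeneous_part F n (cos t) (sin t)) ((\<Sum>i\<le>n. \<bar>ps_coeff F i (n - i)\<bar>) * 3 ^ n)"
proof -
  have "wiener_bounded (\<lambda>t. ps_coeff F i (n - i) * cos t ^ i * sin t ^ (n - i))
          (\<bar>ps_coeff F i (n - i)\<bar> * 3 ^ n)" if "i \<le> n" for i
  proof -
    have "wiener_bounded (\<lambda>t. ps_coeff F i (n - i) * cos t ^ i * sin t ^ (n - i))
            (\<bar>ps_coeff F i (n - i)\<bar> * 3 ^ i * 3 ^ (n - i))"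
      by (intro wiener_bounded_mult wiener_bounded_const wiener_bounded_power
            wiener_bounded_cos wiener_bounded_sin)
    then show ?thesis using that by (simp add: mult.assoc flip: power_add)
  qed
  then show ?thesis
    unfolding homogeneous_part_def sum_distrib_right by (intro wiener_bounded_sum) auto
qed

text \<open>The component of degree \<open>n\<close>, restricted to the unit circle, has norm at most \<open>3 ^ n\<close> times the sum of
the absolute values of its coefficients; the factor \<open>3 ^ n\<close> is absorbed by shrinking the radius.\<close>
lemma analytic_polar_combination:
  assumes "analytic_at_origin X" "analytic_at_origin Y"
    and g: "wiener_bounded g 3" "wiener_bounded h 3"
  shows "analytic_at_origin (\<lambda>x y. \<Sum>k. (homogeneous_part Y (k + m) (cos y) (sin y) * g y
           + homogeneous_part X (k + m) (cos y) (sin y) * h y) * x ^ k)"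
proof -
  define SX where "SX k = (\<Sum>i\<le>k + m. \<bar>ps_coeff X i (k + m - i)\<bar>)" for k
  define SY where "SY k = (\<Sum>i\<le>k + m. \<bar>ps_coeff Y i (k + m - i)\<bar>)" for k
  obtain R1 where R1: "R1 > 0" "\<And>r. 0 < r \<Longrightarrow> r \<le> R1 \<Longrightarrow> summable (\<lambda>k. SX k * r ^ k)"
    unfolding SX_def by (rule homogeneous_norms_summable[OF assms(1), of m]) blast
  obtain R2 where R2: "R2 > 0" "\<And>r. 0 < r \<Longrightarrow> r \<le> R2 \<Longrightarrow> summable (\<lambda>k. SY k * r ^ k)"
    unfolding SY_def by (rule homogeneous_norms_summable[OF assms(2), of m]) blast
  define r where "r = min R1 R2 / 3"
  have r: "r > 0" "3 * r \<le> R1" "3 * r \<le> R2" using R1 R2 by (auto simp: r_def)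
  have "summable (\<lambda>k. (SY k * (3 * r) ^ k + SX k * (3 * r) ^ k) * 3 ^ (m + 1))"
    using r by (intro summable_mult2 summable_add R1 R2) auto
  moreover have "(SY k * (3 * r) ^ k + SX k * (3 * r) ^ k) * 3 ^ (m + 1)
                 = (SY k * 3 ^ (k + m) * 3 + SX k * 3 ^ (k + m) * 3) * r ^ k" for k
    by (simp add: power_add power_mult_distrib algebra_simps)
  ultimately have s: "summable (\<lambda>k. (SY k * 3 ^ (k + m) * 3 + SX k * 3 ^ (k + m) * 3) * r ^ k)"
    by simp
  show ?thesis
    by (rule analytic_at_origin_series[OF _ r(1) s])
       (unfold SX_def SY_def, intro wiener_bounded_add wiener_bounded_mult wiener_bounded_homogeneous_part g)
qed

lemma analytic_angular:
  assumes "analytic_at_origin X" "analytic_at_origin Y"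
  shows "analytic_at_origin (angular X Y m)"
proof -
  have "wiener_bounded (\<lambda>t. - sin t) 3"
    using wiener_bounded_mult[OF wiener_bounded_const[of "-1"] wiener_bounded_sin] by simp
  from analytic_polar_combination[OF assms wiener_bounded_cos this, of m]
  show ?thesis by (simp add: angular_def[abs_def] angular_part_def)
qed

lemma analytic_radial:
  assumes "analytic_at_origin X" "analytic_at_origin Y"
  shows "analytic_at_origin (radial X Y m)"
  using analytic_polar_combination[OF assms wiener_bounded_sin wiener_bounded_cos, of m]
  by (simp add: radial_def[abs_def] radial_part_def add.commute)

section \<open>Dominant monomials\<close>

text \<open>Dickson's lemma: at most one minimal element lies in each of the columns to the left of a given
element and in each of the rows below it.\<close>
lemma dickson_plane:
  fixes V :: "(nat \<times> nat) set"
  obtains C where "finite C" "C \<subseteq> V" "\<And>p. p \<in> V \<Longrightarrow> \<exists>c\<in>C. fst c \<le> fst p \<and> snd c \<le> snd p"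
proof (cases "V = {}")
  case True
  then show ?thesis using that[of "{}"] by auto
next
  case False
  then obtain a b where ab: "(a, b) \<in> V" by auto
  define C where "C = insert (a, b)
      (((\<lambda>i. (i, LEAST j. (i, j) \<in> V)) ` {i. i < a \<and> (\<exists>j. (i, j) \<in> V)}) \<union>
       ((\<lambda>j. (LEAST i. (i, j) \<in> V, j)) ` {j. j < b \<and> (\<exists>i. (i, j) \<in> V)}))"
  show ?thesis
  proof
    show "finite C" by (simp add: C_def)
    show "C \<subseteq> V" using ab by (auto simp: C_def intro: LeastI)
  next
    fix p assume p: "p \<in> V"
    obtain i j where ij: "p = (i, j)" by force
    consider "a \<le> i \<and> b \<le> j" | "i < a" | "j < b" by linarith
    then show "\<exists>c\<in>C. fst c \<le> fst p \<and> snd c \<le> snd p"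
    proof cases
      case 1
      then show ?thesis by (intro bexI[of _ "(a, b)"]) (auto simp: C_def ij)
    next
      case 2
      then show ?thesis using p
        by (intro bexI[of _ "(i, LEAST j. (i, j) \<in> V)"]) (auto simp: C_def ij intro: Least_le)
    next
      case 3
      then show ?thesis using p
        by (intro bexI[of _ "(LEAST i. (i, j) \<in> V, j)"]) (auto simp: C_def ij intro: Least_le)
    qed
  qed
qed

definition mon :: "nat \<times> nat \<Rightarrow> real \<times> real \<Rightarrow> real" where
  "mon p z = fst z ^ fst p * snd z ^ snd p"

text \<open>Only the indices outside \<open>S\<close> are to be discarded. By Dickson's lemma they lie above finitely many of
them, and near the origin the sum of all terms above an index \<open>q\<close> is at most a constant times the
monomial of \<open>q\<close>. So it suffices that each single monomial is negligible.\<close>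
lemma power_series_asymptotics:
  assumes F: "has_power_series F c" and Fl: "Fl \<le> nhds (0, 0)" and S: "finite S"
    and dom: "\<And>p. c (fst p) (snd p) \<noteq> 0 \<Longrightarrow> p \<notin> S \<Longrightarrow> ((\<lambda>z. mon p z / m z) \<longlongrightarrow> 0) Fl"
  shows "((\<lambda>z. (F (fst z) (snd z) - (\<Sum>p\<in>S. c (fst p) (snd p) * mon p z)) / m z) \<longlongrightarrow> 0) Fl"
proof -
  obtain r where r: "r > 0"
    and s: "\<And>x y. \<bar>x\<bar> \<le> r \<Longrightarrow> \<bar>y\<bar> \<le> r \<Longrightarrow> ((\<lambda>(i, j). c i j * x ^ i * y ^ j) has_sum F x y) UNIV"
    and a: "(\<lambda>(i, j). \<bar>c i j\<bar> * r ^ i * r ^ j) summable_on UNIV"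
    by (rule has_power_series_absolutely[OF F]) blast
  define T where "T = {p. c (fst p) (snd p) \<noteq> 0 \<and> p \<notin> S}"
  obtain C where C: "finite C" "C \<subseteq> T" "\<And>p. p \<in> T \<Longrightarrow> \<exists>q\<in>C. fst q \<le> fst p \<and> snd q \<le> snd p"
    by (rule dickson_plane[of T]) blast
  define M where "M = infsum (\<lambda>(i, j). \<bar>c i j\<bar> * r ^ i * r ^ j) T"
  have M: "((\<lambda>(i, j). \<bar>c i j\<bar> * r ^ i * r ^ j) has_sum M) T"
    unfolding M_def by (intro has_sum_infsum summable_on_subset_banach[OF a]) auto
  define B where "B z = (\<Sum>q\<in>C. \<bar>mon q z\<bar> / (r ^ fst q * r ^ snd q))" for z
  have bound: "\<bar>F (fst z) (snd z) - (\<Sum>p\<in>S. c (fst p) (snd p) * mon p z)\<bar> \<le> B z * M"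
    if z: "\<bar>fst z\<bar> \<le> r" "\<bar>snd z\<bar> \<le> r" for z
  proof -
    let ?f = "\<lambda>p. c (fst p) (snd p) * mon p z"
    have "(?f has_sum F (fst z) (snd z)) UNIV"
      using s[OF z] by (simp add: mon_def case_prod_unfold mult.assoc)
    then have "(?f has_sum (F (fst z) (snd z) - sum ?f S)) (UNIV - S)"
      using S by (intro has_sum_Diff has_sum_finite) auto
    then have 1: "(?f has_sum (F (fst z) (snd z) - sum ?f S)) T"
      by (rule has_sum_cong_neutral[THEN iffD1, rotated 3]) (auto simp: T_def)
    have 2: "((\<lambda>p. B z * (case p of (i, j) \<Rightarrow> \<bar>c i j\<bar> * r ^ i * r ^ j)) has_sum B z * M) T"
      using M by (rule has_sum_cmult_right)
    show ?thesis
    proof (rule norm_infsum_le[OF 1 2, unfolded real_norm_def])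
      fix p assume p: "p \<in> T"
      obtain q where q: "q \<in> C" "fst q \<le> fst p" "snd q \<le> snd p" using C(3)[OF p] by blast
      have e: "x ^ k = x ^ l * x ^ (k - l)" if "l \<le> k" for x :: real and k l
        using that by (simp flip: power_add)
      have "\<bar>mon p z\<bar> = \<bar>mon q z\<bar> * (\<bar>fst z\<bar> ^ (fst p - fst q) * \<bar>snd z\<bar> ^ (snd p - snd q))"
        using e[OF q(2), of "fst z"] e[OF q(3), of "snd z"]
        by (simp add: mon_def abs_mult power_abs mult_ac)
      also have "\<dots> \<le> \<bar>mon q z\<bar> * (r ^ (fst p - fst q) * r ^ (snd p - snd q))"
        using z r by (intro mult_left_mono mult_mono power_mono) auto
      also have "\<dots> = \<bar>mon q z\<bar> / (r ^ fst q * r ^ snd q) * (r ^ fst p * r ^ snd p)"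
        using e[OF q(2), of r] e[OF q(3), of r] r by (simp add: field_simps)
      also have "\<dots> \<le> B z * (r ^ fst p * r ^ snd p)"
        unfolding B_def using r C(1) q(1)
        by (intro mult_right_mono member_le_sum[of q C "\<lambda>q. \<bar>mon q z\<bar> / (r ^ fst q * r ^ snd q)"]) auto
      finally have "\<bar>c (fst p) (snd p)\<bar> * \<bar>mon p z\<bar> \<le> \<bar>c (fst p) (snd p)\<bar> * (B z * (r ^ fst p * r ^ snd p))"
        by (intro mult_left_mono) auto
      then show "\<bar>?f p\<bar> \<le> B z * (case p of (i, j) \<Rightarrow> \<bar>c i j\<bar> * r ^ i * r ^ j)"
        by (simp add: abs_mult case_prod_unfold mult_ac)
    qed
  qed
  have "((\<lambda>z. (\<Sum>q\<in>C. \<bar>mon q z / m z\<bar> / (r ^ fst q * r ^ snd q)) * M) \<longlongrightarrow>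
          (\<Sum>q\<in>C. \<bar>0\<bar> / (r ^ fst q * r ^ snd q)) * M) Fl"
    by (intro tendsto_intros dom) (use C(2) r in \<open>auto simp: T_def\<close>)
  then have lim: "((\<lambda>z. B z * M / \<bar>m z\<bar>) \<longlongrightarrow> 0) Fl"
    by (simp add: B_def sum_distrib_left sum_distrib_right sum_divide_distrib mult_ac)
  have "eventually (\<lambda>z. z \<in> {-r<..<r} \<times> {-r<..<r}) Fl"
    by (rule filter_leD[OF Fl]) (use r in \<open>intro eventually_nhds_in_open open_Times, auto\<close>)
  then show ?thesis
  proof (rule Lim_null_comparison[OF eventually_mono lim])
    fix z assume "z \<in> {-r<..<r} \<times> {-r<..<r}"
    then have "\<bar>F (fst z) (snd z) - (\<Sum>p\<in>S. c (fst p) (snd p) * mon p z)\<bar> \<le> B z * M"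
      by (intro bound) auto
    then show "norm ((F (fst z) (snd z) - (\<Sum>p\<in>S. c (fst p) (snd p) * mon p z)) / m z) \<le> B z * M / \<bar>m z\<bar>"
      by (simp add: divide_right_mono)
  qed
qed

section \<open>The Newton polygon\<close>

text \<open>The weight of the monomial with exponent \<open>p\<close> when \<open>\<rho>\<close> has weight \<open>w\<close> and \<open>\<theta>\<close> has weight \<open>1\<close>. Its level
lines have slope \<open>-w\<close>.\<close>
definition weight :: "real \<Rightarrow> nat \<times> nat \<Rightarrow> real" where
  "weight w p = w * real (fst p) + real (snd p)"

lemma lattice_point_inject [simp]: "lattice_point p = lattice_point q \<longleftrightarrow> p = q"
  by (auto simp: lattice_point_def prod_eq_iff)

lemma lattice_point_in_region: "p \<in> valid_indices F \<Longrightarrow> lattice_point p \<in> newton_region F"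
  unfolding newton_region_def
  by (rule hull_inc, rule CollectI, intro exI[of _ p] exI[of _ "0::real"]) (auto simp: zero_prod_def[symmetric])

lemma convex_newton_region: "convex (newton_region F)"
  by (simp add: newton_region_def convex_convex_hull)

lemma newton_region_add:
  assumes "z \<in> newton_region F" "0 \<le> u" "0 \<le> v"
  shows "z + (u, v) \<in> newton_region F"
proof -
  let ?G = "{lattice_point p + (u, v) | p u v. p \<in> valid_indices F \<and> 0 \<le> u \<and> 0 \<le> v}"
  have "(+) (u, v) ` ?G \<subseteq> ?G"
  proof
    fix x assume "x \<in> (+) (u, v) ` ?G"
    then obtain p u' v' where x: "x = (u, v) + (lattice_point p + (u', v'))"
      and h: "p \<in> valid_indices F" "0 \<le> u'" "0 \<le> v'"
      by blast
    have "x = lattice_point p + (u + u', v + v')" by (simp add: x lattice_point_def)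
    then show "x \<in> ?G" using h assms(2,3)
      by (intro CollectI exI[of _ p] exI[of _ "u + u'"] exI[of _ "v + v'"]) auto
  qed
  then have "convex hull ((+) (u, v) ` ?G) \<subseteq> convex hull ?G"
    by (rule hull_mono)
  then have "(+) (u, v) ` newton_region F \<subseteq> newton_region F"
    by (simp add: newton_region_def convex_hull_translation)
  then show ?thesis using assms(1) by (auto simp: add.commute)
qed

text \<open>If \<open>a \<noteq> z\<close>, the ray from \<open>a\<close> through \<open>z\<close> stays in the region. A face containing \<open>z\<close> contains the whole
ray and cannot be compact.\<close>
lemma newton_polygon_minimal:
  assumes z: "z \<in> newton_polygon F" and a: "a \<in> newton_region F"
    and le: "fst a \<le> fst z" "snd a \<le> snd z"
  shows "a = z"
proof (rule ccontr)
  assume ne: "a \<noteq> z"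
  obtain f where f: "f face_of newton_region F" "compact f" "z \<in> f"
    using z unfolding newton_polygon_def by blast
  define d where "d = z - a"
  have d: "d \<noteq> 0" "fst d \<ge> 0" "snd d \<ge> 0" using ne le by (auto simp: d_def)
  have mem: "a + T *\<^sub>R d \<in> f" if "T > 1" for T
  proof -
    have "a + (T * fst d, T * snd d) \<in> newton_region F"
      using a d that by (intro newton_region_add) auto
    then have 1: "a + T *\<^sub>R d \<in> newton_region F" by (simp add: prod_eq_iff scaleR_prod_def)
    have "z = (1 - 1 / T) *\<^sub>R a + (1 / T) *\<^sub>R (a + T *\<^sub>R d)"
      using that by (simp add: d_def algebra_simps)
    moreover have "a \<noteq> a + T *\<^sub>R d" using d that by auto
    ultimately have "z \<in> open_segment a (a + T *\<^sub>R d)"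
      using that unfolding in_segment by (intro conjI exI[of _ "1 / T"]) auto
    then show ?thesis using face_ofD[OF f(1) _ a 1 f(3)] by blast
  qed
  obtain M where M: "\<And>x. x \<in> f \<Longrightarrow> norm x \<le> M"
    using compact_imp_bounded[OF f(2)] unfolding bounded_iff by blast
  \<comment> \<open>For this \<open>T\<close> the norm of \<open>a + T *\<^sub>R d\<close> is at least \<open>2 * norm d + \<bar>M\<bar>\<close>.\<close>
  define T where "T = 2 + (\<bar>M\<bar> + norm a) / norm d"
  have T: "T > 1" using d by (simp add: T_def add_pos_nonneg)
  have "T * norm d \<le> norm (a + T *\<^sub>R d) + norm a"
    using norm_triangle_ineq4[of "a + T *\<^sub>R d" a] T by simp
  also have "\<dots> \<le> M + norm a" using M[OF mem[OF T]] by simp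
  also have "\<dots> < 2 * norm d + (\<bar>M\<bar> + norm a)"
    using d zero_less_norm_iff[of d] abs_ge_self[of M] by linarith
  also have "\<dots> = T * norm d"
  proof -
    have "(\<bar>M\<bar> + norm a) / norm d * norm d = \<bar>M\<bar> + norm a" using d by simp
    then show ?thesis by (simp only: T_def distrib_right)
  qed
  finally show False by simp
qed

definition newton_extremes :: "(real \<Rightarrow> real \<Rightarrow> real) \<Rightarrow> (nat \<times> nat) set" where
  "newton_extremes F = {p. lattice_point p extreme_point_of newton_region F}"

text \<open>An extreme point is a compact face.\<close>
lemma newton_extremes_polygon: "p \<in> newton_extremes F \<Longrightarrow> lattice_point p \<in> newton_polygon F"
  unfolding newton_extremes_def newton_polygon_def mem_Collect_eq
  by (rule UnionI[of "{lattice_point p}"]) (auto simp: face_of_singleton)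

lemma newton_extremes_valid:
  assumes "p \<in> newton_extremes F"
  shows "p \<in> valid_indices F"
proof -
  have "lattice_point p \<in> {lattice_point p + (u, v) | p u v. p \<in> valid_indices F \<and> 0 \<le> u \<and> 0 \<le> v}"
    using assms unfolding newton_extremes_def newton_region_def
    by (intro extreme_point_of_convex_hull) simp
  then obtain q u v where q: "lattice_point p = lattice_point q + (u, v)" "q \<in> valid_indices F" "0 \<le> u" "0 \<le> v"
    by blast
  have "lattice_point q = lattice_point p"
  proof (rule newton_polygon_minimal[OF newton_extremes_polygon[OF assms] lattice_point_in_region[OF q(2)]])
    show "fst (lattice_point q) \<le> fst (lattice_point p)" "snd (lattice_point q) \<le> snd (lattice_point p)"
      unfolding q(1) using q(3,4) by simp_all
  qed
  then show ?thesis using q by simp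
qed

lemma newton_polygon_le:
  assumes "lattice_point p \<in> newton_polygon F" "a \<in> valid_indices F" "fst a \<le> fst p" "snd a \<le> snd p"
  shows "a = p"
  using newton_polygon_minimal[OF assms(1) lattice_point_in_region[OF assms(2)]] assms(3,4)
  by (auto simp: lattice_point_def prod_eq_iff)

lemma newton_region_chord:
  assumes "a \<in> valid_indices F" "b \<in> valid_indices F" "fst a \<le> fst p" "fst p \<le> fst b" "fst a < fst b"
    and "weight w a \<le> d" "weight w b \<le> d"
  obtains z where "z \<in> newton_region F" "fst z = real (fst p)" "w * fst z + snd z \<le> d"
    "fst a < fst p \<Longrightarrow> fst p < fst b \<Longrightarrow> z \<in> open_segment (lattice_point a) (lattice_point b)"
proof -
  define t where "t = (real (fst p) - real (fst a)) / (real (fst b) - real (fst a))"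
  define z where "z = (1 - t) *\<^sub>R lattice_point a + t *\<^sub>R lattice_point b"
  have t: "0 \<le> t" "t \<le> 1" using assms by (auto simp: t_def field_simps)
  have "z \<in> newton_region F"
    unfolding z_def using t assms convex_newton_region[of F]
    by (intro convexD_alt lattice_point_in_region) auto
  moreover have "fst z = real (fst p)"
  proof -
    have "t * (real (fst b) - real (fst a)) = real (fst p) - real (fst a)"
      using assms(5) by (simp add: t_def)
    then show ?thesis by (simp add: z_def lattice_point_def algebra_simps)
  qed
  moreover have "w * fst z + snd z \<le> d"
  proof -
    have "w * fst z + snd z = (1 - t) * weight w a + t * weight w b"
      by (simp add: z_def lattice_point_def weight_def algebra_simps)
    also have "\<dots> \<le> (1 - t) * d + t * d"
      using t assms by (intro add_mono mult_left_mono) auto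
    finally show ?thesis by (simp add: algebra_simps)
  qed
  moreover have "z \<in> open_segment (lattice_point a) (lattice_point b)" if "fst a < fst p" "fst p < fst b"
  proof -
    have "0 < t" "t < 1" using that by (auto simp: t_def field_simps)
    moreover have "lattice_point a \<noteq> lattice_point b" using that by auto
    ultimately show ?thesis unfolding in_segment z_def by blast
  qed
  ultimately show ?thesis using that by blast
qed

text \<open>The point of the chord with the same abscissa belongs to the region; if the weight of \<open>p\<close> exceeded \<open>d\<close>,
it would lie strictly below \<open>p\<close>.\<close>
lemma newton_polygon_below_chord:
  assumes "lattice_point p \<in> newton_polygon F"
    and "a \<in> valid_indices F" "b \<in> valid_indices F" "fst a \<le> fst p" "fst p \<le> fst b" "fst a < fst b"
    and "weight w a \<le> d" "weight w b \<le> d"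
  shows "weight w p \<le> d"
proof (rule ccontr)
  assume gt: "\<not> weight w p \<le> d"
  obtain z where z: "z \<in> newton_region F" "fst z = real (fst p)" "w * fst z + snd z \<le> d"
    by (rule newton_region_chord[OF assms(2-8)]) blast
  have "z = lattice_point p"
    using z gt by (intro newton_polygon_minimal[OF assms(1)]) (auto simp: lattice_point_def weight_def)
  then show False using z gt by (auto simp: lattice_point_def weight_def)
qed

text \<open>Otherwise \<open>p\<close> would lie on or above the chord from \<open>a\<close> to \<open>b\<close>, hence on it by minimality, and thus in the
interior of a segment in the region.\<close>
lemma newton_extreme_strictly_below_chord:
  assumes p: "p \<in> newton_extremes F"
    and ab: "a \<in> valid_indices F" "b \<in> valid_indices F" "fst a < fst p" "fst p < fst b"
    and le: "weight w a \<le> weight w p"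
  shows "weight w p < weight w b"
proof (rule ccontr)
  assume gt: "\<not> weight w p < weight w b"
  obtain z where z: "z \<in> newton_region F" "fst z = real (fst p)" "w * fst z + snd z \<le> weight w p"
    "z \<in> open_segment (lattice_point a) (lattice_point b)"
  proof (rule newton_region_chord[OF ab(1,2)])
    show "fst a \<le> fst p" "fst p \<le> fst b" "fst a < fst b" "weight w a \<le> weight w p"
      "weight w b \<le> weight w p"
      using ab le gt by auto
  qed (use ab in blast)
  have "z = lattice_point p"
    using z by (intro newton_polygon_minimal[OF newton_extremes_polygon[OF p]])
      (auto simp: lattice_point_def weight_def)
  then show False
    using z p lattice_point_in_region[OF ab(1)] lattice_point_in_region[OF ab(2)]
    by (auto simp: newton_extremes_def extreme_point_of_def)
qed

text \<open>The points of the plane that are lexicographically not smaller than \<open>p\<close>, with respect to two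
independent linear forms, form a convex set with extreme point \<open>p\<close>, and this set contains the region.
Suitable linear forms give the first vertex, the last vertex, and the left end of each face.\<close>
lemma lexicographic_minimum_extreme:
  fixes \<alpha> \<beta> \<gamma> \<delta> :: real
  assumes p: "p \<in> valid_indices F"
    and nn: "\<alpha> \<ge> 0" "\<beta> \<ge> 0" "\<gamma> \<ge> 0" "\<delta> \<ge> 0" and det: "\<alpha> * \<delta> \<noteq> \<beta> * \<gamma>"
    and min: "\<And>q. q \<in> valid_indices F \<Longrightarrow>
      \<alpha> * fst p + \<beta> * snd p < \<alpha> * fst q + \<beta> * snd q \<or>
      \<alpha> * fst p + \<beta> * snd p = \<alpha> * fst q + \<beta> * snd q \<and> \<gamma> * fst p + \<delta> * snd p \<le> \<gamma> * fst q + \<delta> * snd q"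
  shows "p \<in> newton_extremes F"
proof -
  define f :: "real \<times> real \<Rightarrow> real" where "f z = \<alpha> * fst z + \<beta> * snd z" for z
  define g :: "real \<times> real \<Rightarrow> real" where "g z = \<gamma> * fst z + \<delta> * snd z" for z
  define P where "P = lattice_point p"
  define K where "K = {z. f P < f z \<or> f P = f z \<and> g P \<le> g z}"
  have lin: "f (u *\<^sub>R x + v *\<^sub>R y) = u * f x + v * f y" "g (u *\<^sub>R x + v *\<^sub>R y) = u * g x + v * g y" for u v x y
    by (simp_all add: f_def g_def algebra_simps)
  have fK: "f P \<le> f z" if "z \<in> K" for z using that by (auto simp: K_def)
  have "convex K"
    unfolding convex_def
  proof (intro ballI allI impI)
    fix x y and u v :: real
    assume xy: "x \<in> K" "y \<in> K" and uv: "0 \<le> u" "0 \<le> v" "u + v = 1"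
    have e: "f P = u * f P + v * f P" "g P = u * g P + v * g P"
      using uv(3) by (simp_all flip: distrib_right)
    consider "u = 0" | "v = 0" | "u > 0" "v > 0" "f x = f P" "f y = f P"
      | "u > 0" "v > 0" "f P < f x" | "u > 0" "v > 0" "f P < f y"
      using uv fK[OF xy(1)] fK[OF xy(2)] by linarith
    then show "u *\<^sub>R x + v *\<^sub>R y \<in> K"
    proof cases
      case 3
      then have "u * g P + v * g P \<le> u * g x + v * g y"
        using xy by (intro add_mono mult_left_mono) (auto simp: K_def)
      then show ?thesis using e 3 by (auto simp: K_def lin)
    next
      case 4
      then have "u * f P + v * f P < u * f x + v * f y"
        using fK[OF xy(2)] by (intro add_less_le_mono mult_left_mono mult_strict_left_mono) auto
      then show ?thesis using e by (auto simp: K_def lin)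
    next
      case 5
      then have "u * f P + v * f P < u * f x + v * f y"
        using fK[OF xy(1)] by (intro add_le_less_mono mult_left_mono mult_strict_left_mono) auto
      then show ?thesis using e by (auto simp: K_def lin)
    qed (use uv xy in auto)
  qed
  moreover have "{lattice_point p + (u, v) | p u v. p \<in> valid_indices F \<and> 0 \<le> u \<and> 0 \<le> v} \<subseteq> K"
  proof
    fix x assume "x \<in> {lattice_point p + (u, v) | p u v. p \<in> valid_indices F \<and> 0 \<le> u \<and> 0 \<le> v}"
    then obtain q u v where x: "x = lattice_point q + (u, v)"
      and q: "q \<in> valid_indices F" and uv: "0 \<le> u" "0 \<le> v" by blast
    have 1: "f x = f (lattice_point q) + (\<alpha> * u + \<beta> * v)"
      "g x = g (lattice_point q) + (\<gamma> * u + \<delta> * v)"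
      by (simp_all add: x f_def g_def algebra_simps)
    have 2: "0 \<le> \<alpha> * u + \<beta> * v" "0 \<le> \<gamma> * u + \<delta> * v" using nn uv by auto
    have "f P < f (lattice_point q) \<or> f P = f (lattice_point q) \<and> g P \<le> g (lattice_point q)"
      using min[OF q] by (simp add: f_def g_def P_def lattice_point_def)
    then show "x \<in> K" using 1 2 unfolding K_def by auto
  qed
  ultimately have sub: "newton_region F \<subseteq> K"
    unfolding newton_region_def by (intro hull_minimal[of _ K convex])
  have "False" if ab: "a \<in> newton_region F" "b \<in> newton_region F" "P \<in> open_segment a b" for a b
  proof -
    obtain t where t: "a \<noteq> b" "0 < t" "t < 1" "P = (1 - t) *\<^sub>R a + t *\<^sub>R b"
      using ab(3) unfolding in_segment by auto
    have K: "a \<in> K" "b \<in> K" using ab sub by auto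
    have "f P = (1 - t) * f a + t * f b" by (simp add: t(4) lin)
    then have "(1 - t) * (f a - f P) + t * (f b - f P) = 0" by (simp add: algebra_simps)
    moreover have "(1 - t) * (f a - f P) \<ge> 0" "t * (f b - f P) \<ge> 0"
      using t fK[OF K(1)] fK[OF K(2)] by auto
    ultimately have "(1 - t) * (f a - f P) = 0" "t * (f b - f P) = 0" by linarith+
    then have fe: "f a = f P" "f b = f P" using t by auto
    then have gK: "g P \<le> g a" "g P \<le> g b" using K by (auto simp: K_def)
    have "g P = (1 - t) * g a + t * g b" by (simp add: t(4) lin)
    then have "(1 - t) * (g a - g P) + t * (g b - g P) = 0" by (simp add: algebra_simps)
    moreover have "(1 - t) * (g a - g P) \<ge> 0" "t * (g b - g P) \<ge> 0" using t gK by auto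
    ultimately have "(1 - t) * (g a - g P) = 0" "t * (g b - g P) = 0" by linarith+
    then have ge: "g a = g P" "g b = g P" using t by auto
    have e1: "\<alpha> * (fst a - fst b) + \<beta> * (snd a - snd b) = 0"
      and e2: "\<gamma> * (fst a - fst b) + \<delta> * (snd a - snd b) = 0"
      using fe ge by (simp_all add: f_def g_def algebra_simps)
    have "(\<alpha> * \<delta> - \<beta> * \<gamma>) * (fst a - fst b) =
        \<delta> * (\<alpha> * (fst a - fst b) + \<beta> * (snd a - snd b)) - \<beta> * (\<gamma> * (fst a - fst b) + \<delta> * (snd a - snd b))"
      "(\<alpha> * \<delta> - \<beta> * \<gamma>) * (snd a - snd b) =
        \<alpha> * (\<gamma> * (fst a - fst b) + \<delta> * (snd a - snd b)) - \<gamma> * (\<alpha> * (fst a - fst b) + \<beta> * (snd a - snd b))"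
      by (simp_all add: algebra_simps)
    then have "a = b" using det unfolding e1 e2 by (auto simp: prod_eq_iff)
    then show False using t by simp
  qed
  then show ?thesis
    using lattice_point_in_region[OF p] by (auto simp: newton_extremes_def extreme_point_of_def P_def)
qed

text \<open>Suited to keys such as the abscissa, which is injective on a Newton polygon but not on all pairs.\<close>
lemma (in linorder) sorted_key_list_of_set_inj_on:
  assumes "inj_on f A" "finite A"
  shows "set (sorted_key_list_of_set f A) = A"
    and "sorted_wrt (<) (map f (sorted_key_list_of_set f A))"
proof -
  interpret key: folding_insort_key "(\<le>)" "(<)" A f
    by unfold_locales (rule assms(1))
  show "set (sorted_key_list_of_set f A) = A"
    using assms(2) by (intro key.set_sorted_key_list_of_set) auto
  show "sorted_wrt (<) (map f (sorted_key_list_of_set f A))"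
    by (intro key.strict_sorted_key_list_of_set) auto
qed

lemma inj_on_fst_polygon: "inj_on fst {p \<in> valid_indices F. lattice_point p \<in> newton_polygon F}"
proof (rule inj_onI, clarsimp)
  fix i j k
  assume h: "(i, j) \<in> valid_indices F" "lattice_point (i, j) \<in> newton_polygon F"
    "(i, k) \<in> valid_indices F" "lattice_point (i, k) \<in> newton_polygon F"
  show "j = k"
    using newton_polygon_le[OF h(2) h(3)] newton_polygon_le[OF h(4) h(1)] by (cases "j \<le> k") auto
qed

lemma newton_extremes_subset:
  "newton_extremes F \<subseteq> {p \<in> valid_indices F. lattice_point p \<in> newton_polygon F}"
  using newton_extremes_valid newton_extremes_polygon by auto

lemma finite_newton_extremes: "finite (newton_extremes F)"
proof -
  obtain C where C: "finite C" "C \<subseteq> valid_indices F"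
    "\<And>p. p \<in> valid_indices F \<Longrightarrow> \<exists>c\<in>C. fst c \<le> fst p \<and> snd c \<le> snd p"
    by (rule dickson_plane[of "valid_indices F"]) blast
  have "newton_extremes F \<subseteq> C"
  proof
    fix p assume p: "p \<in> newton_extremes F"
    obtain c where "c \<in> C" "fst c \<le> fst p" "snd c \<le> snd p"
      using C(3)[OF newton_extremes_valid[OF p]] by blast
    then show "p \<in> C"
      using newton_polygon_le[OF newton_extremes_polygon[OF p], of c] C(2) by auto
  qed
  then show ?thesis using C(1) finite_subset by blast
qed

text \<open>The minimum exists because only the finitely many minimal indices compete; among those of
minimal weight the leftmost one is extreme.\<close>
lemma weight_minimum_extreme:
  assumes "valid_indices F \<noteq> {}" "w > 0"
  obtains e where "e \<in> newton_extremes F" "\<And>q. q \<in> valid_indices F \<Longrightarrow> weight w e \<le> weight w q"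
proof -
  obtain C where C: "finite C" "C \<subseteq> valid_indices F"
    "\<And>p. p \<in> valid_indices F \<Longrightarrow> \<exists>c\<in>C. fst c \<le> fst p \<and> snd c \<le> snd p"
    by (rule dickson_plane[of "valid_indices F"]) metis
  have ne: "C \<noteq> {}" using assms(1) C(3) by blast
  obtain m where m: "m \<in> C" "\<And>c. c \<in> C \<Longrightarrow> weight w m \<le> weight w c"
    using ex_min_if_finite[of "weight w ` C"] C(1) ne by (force simp: not_less)
  obtain e where e: "e \<in> C" "weight w e = weight w m"
    "\<And>c. c \<in> C \<Longrightarrow> weight w c = weight w m \<Longrightarrow> fst e \<le> fst c"
    using ex_has_least_nat[of "\<lambda>c. c \<in> C \<and> weight w c = weight w m" m fst] m(1) by blast
  have min: "weight w e < weight w q \<or> weight w e = weight w q \<and> fst e \<le> fst q"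
    if "q \<in> valid_indices F" for q
  proof -
    obtain c where c: "c \<in> C" "fst c \<le> fst q" "snd c \<le> snd q"
      using C(3)[of q] \<open>q \<in> valid_indices F\<close> by blast
    have "weight w c \<le> weight w q"
      unfolding weight_def using c assms(2) by (intro add_mono mult_left_mono) auto
    moreover have "weight w e \<le> weight w c" using e(2) m(2)[OF c(1)] by simp
    moreover have "fst e \<le> fst q" if "weight w c = weight w m" using e(3)[OF c(1) that] c(2) by simp
    ultimately show ?thesis using e(2) by linarith
  qed
  have "e \<in> newton_extremes F"
    by (rule lexicographic_minimum_extreme[of _ _ w 1 1 0])
       (use e(1) C(2) assms(2) min in \<open>auto simp: weight_def\<close>)
  moreover have "weight w e \<le> weight w q" if "q \<in> valid_indices F" for q using min[OF that] by auto
  ultimately show ?thesis using that by blast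
qed

lemma leftmost_extreme:
  assumes "valid_indices F \<noteq> {}"
  obtains e where "e \<in> newton_extremes F"
    "\<And>q. q \<in> valid_indices F \<Longrightarrow> fst e < fst q \<or> fst e = fst q \<and> snd e \<le> snd q"
proof -
  obtain p where p: "p \<in> valid_indices F" using assms by blast
  obtain m where m: "m \<in> valid_indices F" "\<And>q. q \<in> valid_indices F \<Longrightarrow> fst m \<le> fst q"
    using ex_has_least_nat[of "\<lambda>q. q \<in> valid_indices F" p fst] p by blast
  obtain e where e: "e \<in> valid_indices F" "fst e = fst m"
    "\<And>q. q \<in> valid_indices F \<Longrightarrow> fst q = fst m \<Longrightarrow> snd e \<le> snd q"
    using ex_has_least_nat[of "\<lambda>q. q \<in> valid_indices F \<and> fst q = fst m" m snd] m(1) by blast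
  have min: "fst e < fst q \<or> fst e = fst q \<and> snd e \<le> snd q" if "q \<in> valid_indices F" for q
    using e m(2)[OF that] that by fastforce
  have "e \<in> newton_extremes F"
    by (rule lexicographic_minimum_extreme[of _ _ 1 0 0 1]) (use e min in auto)
  then show ?thesis using that min by blast
qed

lemma lowest_extreme:
  assumes "valid_indices F \<noteq> {}"
  obtains e where "e \<in> newton_extremes F"
    "\<And>q. q \<in> valid_indices F \<Longrightarrow> snd e < snd q \<or> snd e = snd q \<and> fst e \<le> fst q"
proof -
  obtain p where p: "p \<in> valid_indices F" using assms by blast
  obtain m where m: "m \<in> valid_indices F" "\<And>q. q \<in> valid_indices F \<Longrightarrow> snd m \<le> snd q"
    using ex_has_least_nat[of "\<lambda>q. q \<in> valid_indices F" p snd] p by blast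
  obtain e where e: "e \<in> valid_indices F" "snd e = snd m"
    "\<And>q. q \<in> valid_indices F \<Longrightarrow> snd q = snd m \<Longrightarrow> fst e \<le> fst q"
    using ex_has_least_nat[of "\<lambda>q. q \<in> valid_indices F \<and> snd q = snd m" m fst] m(1) by blast
  have min: "snd e < snd q \<or> snd e = snd q \<and> fst e \<le> fst q" if "q \<in> valid_indices F" for q
    using e m(2)[OF that] that by fastforce
  have "e \<in> newton_extremes F"
    by (rule lexicographic_minimum_extreme[of _ _ 0 1 1 0]) (use e min in auto)
  then show ?thesis using that min by blast
qed

section \<open>The sequence of vertices\<close>

lemma newton_vertices_facts:
  shows set_newton_vertices: "set (newton_vertices F) = newton_extremes F"
    and sorted_newton_vertices: "sorted_wrt (<) (map fst (newton_vertices F))"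
proof -
  have "inj_on fst (newton_extremes F)"
    by (rule inj_on_subset[OF inj_on_fst_polygon newton_extremes_subset])
  from sorted_key_list_of_set_inj_on[OF this finite_newton_extremes]
  show "set (newton_vertices F) = newton_extremes F"
    "sorted_wrt (<) (map fst (newton_vertices F))"
    by (simp_all add: newton_vertices_def newton_extremes_def)
qed

lemma length_newton_vertices:
  assumes "valid_indices F \<noteq> {}"
  shows "length (newton_vertices F) = Suc (newton_s F)"
proof -
  have "newton_extremes F \<noteq> {}" by (rule leftmost_extreme[OF assms]) blast
  then have "newton_vertices F \<noteq> []" using set_newton_vertices[of F] by auto
  then show ?thesis by (simp add: newton_s_def)
qed

lemma newton_vertex_extreme:
  assumes "valid_indices F \<noteq> {}" "k \<le> newton_s F"
  shows "newton_vertex F k \<in> newton_extremes F"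
  using assms length_newton_vertices[OF assms(1)] set_newton_vertices[of F]
  by (metis less_Suc_eq_le newton_vertex_def nth_mem)

lemmas newton_vertex_valid = newton_extremes_valid[OF newton_vertex_extreme]

lemma newton_extremeE:
  assumes "valid_indices F \<noteq> {}" "p \<in> newton_extremes F"
  obtains k where "k \<le> newton_s F" "p = newton_vertex F k"
proof -
  obtain k where "k < length (newton_vertices F)" "newton_vertices F ! k = p"
    using assms(2) set_newton_vertices[of F] by (metis in_set_conv_nth)
  then show ?thesis
    using that[of k] length_newton_vertices[OF assms(1)] by (simp add: newton_vertex_def)
qed

lemma newton_vertex_fst:
  assumes "valid_indices F \<noteq> {}" "k < l" "l \<le> newton_s F"
  shows "fst (newton_vertex F k) < fst (newton_vertex F l)"
  using sorted_wrt_nth_less[OF sorted_newton_vertices[of F], of k l] assms length_newton_vertices[OF assms(1)]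
  by (simp add: newton_vertex_def)

lemma newton_vertex_snd:
  assumes "valid_indices F \<noteq> {}" "k < l" "l \<le> newton_s F"
  shows "snd (newton_vertex F l) < snd (newton_vertex F k)"
proof (rule ccontr)
  assume h: "\<not> ?thesis"
  have "newton_vertex F k = newton_vertex F l"
    using newton_vertex_fst[OF assms] h assms
    by (intro newton_polygon_le[of _ F] newton_extremes_polygon newton_vertex_extreme newton_vertex_valid) auto
  then show False using newton_vertex_fst[OF assms] by simp
qed

text \<open>Minus the slope of the edge that ends at the vertex number \<open>k\<close>, as a real number: with this \<open>w\<close> the
ends of the edge have the same weight. Meaningful for \<open>1 \<le> k \<le> newton_s F\<close>.\<close>
definition edge_weight :: "(real \<Rightarrow> real \<Rightarrow> real) \<Rightarrow> nat \<Rightarrow> real" where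
  "edge_weight F k = (real (snd (newton_vertex F (k - 1))) - real (snd (newton_vertex F k))) /
     (real (fst (newton_vertex F k)) - real (fst (newton_vertex F (k - 1))))"

lemma edge_slope_weight:
  assumes "1 \<le> k" "k \<le> newton_s F"
  shows "edge_slope F k = ereal (- edge_weight F k)"
  using assms by (simp add: edge_slope_def edge_weight_def minus_divide_left)

lemma edge_weight_pos:
  assumes "valid_indices F \<noteq> {}" "1 \<le> k" "k \<le> newton_s F"
  shows "edge_weight F k > 0"
  using newton_vertex_fst[OF assms(1), of "k - 1" k] newton_vertex_snd[OF assms(1), of "k - 1" k] assms
  by (auto simp: edge_weight_def)

lemma edge_weight_eq:
  assumes "valid_indices F \<noteq> {}" "1 \<le> k" "k \<le> newton_s F"
  shows "weight (edge_weight F k) (newton_vertex F (k - 1)) = weight (edge_weight F k) (newton_vertex F k)"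
proof -
  have "real (fst (newton_vertex F k)) - real (fst (newton_vertex F (k - 1))) > 0"
    using newton_vertex_fst[OF assms(1), of "k - 1" k] assms by auto
  then have "edge_weight F k * (real (fst (newton_vertex F k)) - real (fst (newton_vertex F (k - 1))))
     = real (snd (newton_vertex F (k - 1))) - real (snd (newton_vertex F k))"
    by (simp add: edge_weight_def)
  then show ?thesis by (simp add: weight_def algebra_simps)
qed

text \<open>An extreme point of smaller weight would lie to the left or to the right of both ends of the edge,
and then one of these ends would lie on or above a chord.\<close>
lemma edge_supports:
  assumes "valid_indices F \<noteq> {}" "1 \<le> k" "k \<le> newton_s F" "q \<in> valid_indices F"
  shows "weight (edge_weight F k) (newton_vertex F k) \<le> weight (edge_weight F k) q"
proof -
  let ?w = "edge_weight F k" and ?v = "newton_vertex F"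
  obtain e where e: "e \<in> newton_extremes F" "\<And>q. q \<in> valid_indices F \<Longrightarrow> weight ?w e \<le> weight ?w q"
    by (rule weight_minimum_extreme[OF assms(1) edge_weight_pos[OF assms(1-3)]]) blast
  obtain l where l: "l \<le> newton_s F" "e = ?v l" by (rule newton_extremeE[OF assms(1) e(1)])
  note eq = edge_weight_eq[OF assms(1-3)]
  have "weight ?w (?v k) \<le> weight ?w e"
  proof (rule ccontr)
    assume lt: "\<not> ?thesis"
    have lk: "l \<noteq> k" "l \<noteq> k - 1" using lt l eq by auto
    then consider "l < k - 1" | "k < l" by linarith
    then show False
    proof cases
      case 1
      have "weight ?w (?v (k - 1)) < weight ?w (?v k)"
        using 1 assms lt l eq
        by (intro newton_extreme_strictly_below_chord[of _ F "?v l" "?v k"] newton_vertex_extreme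
              newton_vertex_valid newton_vertex_fst) auto
      then show False using eq by simp
    next
      case 2
      have "weight ?w (?v k) < weight ?w (?v l)"
        using 2 assms lt l eq
        by (intro newton_extreme_strictly_below_chord[of _ F "?v (k - 1)" "?v l"] newton_vertex_extreme
              newton_vertex_valid newton_vertex_fst) auto
      then show False using lt l by simp
    qed
  qed
  then show ?thesis using e(2)[OF assms(4)] by simp
qed

text \<open>Strict convexity at a vertex, as a vertex does not lie on or above the chord of its two neighbours.\<close>
lemma edge_weight_Suc:
  assumes "valid_indices F \<noteq> {}" "1 \<le> k" "Suc k \<le> newton_s F"
  shows "edge_weight F (Suc k) < edge_weight F k"
proof (rule ccontr)
  let ?w = "edge_weight F (Suc k)" and ?v = "newton_vertex F"
  assume h: "\<not> ?thesis"
  have kk: "k \<le> newton_s F" using assms by simp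
  have d: "real (fst (?v k)) - real (fst (?v (k - 1))) \<ge> 0"
    using newton_vertex_fst[OF assms(1), of "k - 1" k] assms by auto
  have "weight (edge_weight F k) (?v k) - weight (edge_weight F k) (?v (k - 1)) = 0"
    using edge_weight_eq[OF assms(1,2) kk] by simp
  moreover have "(?w - edge_weight F k) * (real (fst (?v k)) - real (fst (?v (k - 1)))) \<ge> 0"
    using d h by (intro mult_nonneg_nonneg) auto
  ultimately have "weight ?w (?v (k - 1)) \<le> weight ?w (?v k)"
    by (simp add: weight_def algebra_simps)
  then have "weight ?w (?v k) < weight ?w (?v (Suc k))"
    using assms by (intro newton_extreme_strictly_below_chord[of _ F "?v (k - 1)" "?v (Suc k)"]
        newton_vertex_extreme newton_vertex_valid newton_vertex_fst) auto
  then show False using edge_weight_eq[OF assms(1) _ assms(3)] by simp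
qed

lemma edge_weight_strict_antimono:
  assumes "valid_indices F \<noteq> {}" "1 \<le> k" "k < l" "l \<le> newton_s F"
  shows "edge_weight F l < edge_weight F k"
  using assms(3,4)
proof (induction l)
  case (Suc l)
  show ?case
  proof (cases "k = l")
    case True
    then show ?thesis using edge_weight_Suc[OF assms(1,2)] Suc.prems by simp
  next
    case False
    then have "edge_weight F l < edge_weight F k" using Suc by simp
    then show ?thesis using edge_weight_Suc[OF assms(1), of l] Suc.prems assms(2) by simp
  qed
qed simp

lemma newton_vertex_first:
  assumes "valid_indices F \<noteq> {}" "q \<in> valid_indices F"
  shows "fst (newton_vertex F 0) < fst q \<or>
         fst (newton_vertex F 0) = fst q \<and> snd (newton_vertex F 0) \<le> snd q"
proof -
  obtain e where e: "e \<in> newton_extremes F"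
    "\<And>q. q \<in> valid_indices F \<Longrightarrow> fst e < fst q \<or> fst e = fst q \<and> snd e \<le> snd q"
    by (rule leftmost_extreme[OF assms(1)]) blast
  obtain l where l: "l \<le> newton_s F" "e = newton_vertex F l" by (rule newton_extremeE[OF assms(1) e(1)])
  have "l = 0"
    using newton_vertex_fst[OF assms(1), of 0 l] e(2)[OF newton_vertex_valid[OF assms(1), of 0]] l
    by (cases l) auto
  then show ?thesis using e(2)[OF assms(2)] l by simp
qed

lemma newton_vertex_last:
  assumes "valid_indices F \<noteq> {}" "q \<in> valid_indices F"
  shows "snd (newton_vertex F (newton_s F)) < snd q \<or>
         snd (newton_vertex F (newton_s F)) = snd q \<and> fst (newton_vertex F (newton_s F)) \<le> fst q"
proof -
  obtain e where e: "e \<in> newton_extremes F"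
    "\<And>q. q \<in> valid_indices F \<Longrightarrow> snd e < snd q \<or> snd e = snd q \<and> fst e \<le> fst q"
    by (rule lowest_extreme[OF assms(1)]) blast
  obtain l where l: "l \<le> newton_s F" "e = newton_vertex F l" by (rule newton_extremeE[OF assms(1) e(1)])
  have "l = newton_s F"
    using newton_vertex_snd[OF assms(1), of l "newton_s F"]
      e(2)[OF newton_vertex_valid[OF assms(1), of "newton_s F"]] l
    by (cases "l = newton_s F") auto
  then show ?thesis using e(2)[OF assms(2)] l by simp
qed

lemma edge_supports_right:
  assumes "valid_indices F \<noteq> {}" "Suc k \<le> newton_s F" "q \<in> valid_indices F"
  shows "weight (edge_weight F (Suc k)) (newton_vertex F k) \<le> weight (edge_weight F (Suc k)) q"
  using edge_supports[OF assms(1) _ assms(2,3)] edge_weight_eq[OF assms(1) _ assms(2)] by simp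

section \<open>Faces of the Newton polygon and componential polynomials\<close>

text \<open>For \<open>w > 0\<close> these are the valid indices in the component of slope \<open>-w\<close>.\<close>
definition newton_face :: "(real \<Rightarrow> real \<Rightarrow> real) \<Rightarrow> real \<Rightarrow> (nat \<times> nat) set" where
  "newton_face F w = {p \<in> valid_indices F. \<forall>q\<in>valid_indices F. weight w p \<le> weight w q}"

text \<open>The lines that support the two edges at the vertex leave every other index above the line of slope
\<open>-w\<close> through the vertex.\<close>
lemma vertex_strictly_lightest:
  assumes ne: "valid_indices F \<noteq> {}" and k: "k \<le> newton_s F" and w: "w > 0"
    and left: "k = 0 \<or> w < edge_weight F k" and right: "k = newton_s F \<or> edge_weight F (Suc k) < w"
    and q: "q \<in> valid_indices F" "q \<noteq> newton_vertex F k"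
  shows "weight w (newton_vertex F k) < weight w q"
proof -
  let ?v = "newton_vertex F k"
  define di where "di = real (fst q) - real (fst ?v)"
  define dj where "dj = real (snd q) - real (snd ?v)"
  have L: "0 \<le> edge_weight F k * di + dj" if "k \<noteq> 0"
    using edge_supports[OF ne _ k q(1)] that by (simp add: weight_def di_def dj_def algebra_simps)
  have R: "0 \<le> edge_weight F (Suc k) * di + dj" if "k \<noteq> newton_s F"
    using edge_supports_right[OF ne _ q(1)] that k by (simp add: weight_def di_def dj_def algebra_simps)
  have first: "0 < di \<or> di = 0 \<and> 0 \<le> dj" if "k = 0"
    using newton_vertex_first[OF ne q(1)] that by (auto simp: di_def dj_def)
  have last: "0 < dj \<or> dj = 0 \<and> 0 \<le> di" if "k = newton_s F"
    using newton_vertex_last[OF ne q(1)] that by (auto simp: di_def dj_def)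
  have "di \<noteq> 0 \<or> dj \<noteq> 0" using q(2) by (auto simp: di_def dj_def prod_eq_iff)
  then consider "0 < dj" "0 \<le> di" | "0 < dj" "di < 0" | "dj < 0" | "dj = 0" "di \<noteq> 0" by linarith
  then have "0 < w * di + dj"
  proof cases
    case 1
    then show ?thesis using w by (intro add_nonneg_pos) auto
  next
    case 2
    then have "k \<noteq> 0" using first by auto
    then have "(edge_weight F k - w) * (- di) > 0" using 2 left by (intro mult_pos_pos) auto
    then show ?thesis using L[OF \<open>k \<noteq> 0\<close>] by (simp add: algebra_simps)
  next
    case 3
    then have ks: "k \<noteq> newton_s F" using last by auto
    have ew: "edge_weight F (Suc k) > 0" using edge_weight_pos[OF ne] ks k by auto
    have "edge_weight F (Suc k) * di > 0" using R[OF ks] 3 by linarith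
    then have "di > 0" using ew by (simp add: zero_less_mult_iff)
    then have "(w - edge_weight F (Suc k)) * di > 0" using right ks by (intro mult_pos_pos) auto
    then show ?thesis using R[OF ks] by (simp add: algebra_simps)
  next
    case 4
    have "0 \<le> di"
    proof (cases "k = 0")
      case False
      then show ?thesis
        using L[OF False] 4 edge_weight_pos[OF ne _ k] by (simp add: zero_le_mult_iff)
    qed (use first in auto)
    then show ?thesis using 4 w by auto
  qed
  then show ?thesis by (simp add: weight_def di_def dj_def algebra_simps)
qed

lemma slopes_eq: "slopes F = (\<lambda>k. - edge_weight F k) ` {1..newton_s F}"
  unfolding slopes_def by (auto simp: edge_slope_weight)

lemma edge_weight_inj:
  assumes "valid_indices F \<noteq> {}" "k \<in> {1..newton_s F}" "l \<in> {1..newton_s F}" "edge_weight F k = edge_weight F l"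
  shows "k = l"
  using edge_weight_strict_antimono[OF assms(1), of k l] edge_weight_strict_antimono[OF assms(1), of l k] assms
  by (cases k l rule: linorder_cases) auto

lemma edge_weight_antimono:
  assumes "valid_indices F \<noteq> {}" "1 \<le> k" "k \<le> l" "l \<le> newton_s F"
  shows "edge_weight F l \<le> edge_weight F k"
  using edge_weight_strict_antimono[OF assms(1,2), of l] assms by (cases "k = l") auto

text \<open>An index on the line of an edge lies between the ends of the edge, because beyond them the lines of
the two neighbouring edges are strictly higher.\<close>
lemma newton_edge_face:
  assumes ne: "valid_indices F \<noteq> {}" and k: "1 \<le> k" "k \<le> newton_s F"
  shows "{p \<in> valid_indices F. lattice_point p \<in> newton_edge F k} = newton_face F (edge_weight F k)"
proof -
  let ?w = "edge_weight F k"
  define a where "a = newton_vertex F (k - 1)"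
  define b where "b = newton_vertex F k"
  have w: "?w > 0" by (rule edge_weight_pos[OF ne k])
  have ab: "fst a < fst b" using newton_vertex_fst[OF ne, of "k - 1" k] k by (simp add: a_def b_def)
  have eq: "weight ?w a = weight ?w b" using edge_weight_eq[OF ne k] by (simp add: a_def b_def)
  have bv: "b \<in> valid_indices F" using newton_vertex_valid[OF ne k(2)] by (simp add: b_def)
  have "lattice_point p \<in> closed_segment (lattice_point a) (lattice_point b) \<longleftrightarrow> p \<in> newton_face F ?w"
    if p: "p \<in> valid_indices F" for p
  proof
    assume "lattice_point p \<in> closed_segment (lattice_point a) (lattice_point b)"
    then obtain t where t: "lattice_point p = (1 - t) *\<^sub>R lattice_point a + t *\<^sub>R lattice_point b"
      by (auto simp: in_segment)
    have f: "real (fst p) = (1 - t) * real (fst a) + t * real (fst b)"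
      and s: "real (snd p) = (1 - t) * real (snd a) + t * real (snd b)"
      using arg_cong[OF t, of fst] arg_cong[OF t, of snd] by (simp_all add: lattice_point_def)
    have "weight ?w p = (1 - t) * weight ?w a + t * weight ?w b"
      unfolding weight_def f s by (simp add: algebra_simps)
    also have "\<dots> = weight ?w b" by (simp add: eq algebra_simps)
    finally show "p \<in> newton_face F ?w"
      using p edge_supports[OF ne k] by (simp add: newton_face_def b_def)
  next
    assume pf: "p \<in> newton_face F ?w"
    have "weight ?w p \<le> weight ?w b" using pf bv by (simp add: newton_face_def)
    then have pw: "weight ?w p = weight ?w b"
      using edge_supports[OF ne k p] by (simp add: b_def)
    have le_b: "fst p \<le> fst b"
    proof (rule ccontr)
      assume "\<not> fst p \<le> fst b"
      then have i: "real (fst p) - real (fst b) > 0" by simp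
      have "?w * (real (fst p) - real (fst b)) = real (snd b) - real (snd p)"
        using pw by (simp add: weight_def algebra_simps)
      then have "real (snd b) - real (snd p) > 0" using i w by (metis mult_pos_pos)
      then have "k \<noteq> newton_s F" using newton_vertex_last[OF ne p] by (auto simp: b_def)
      then have ks: "Suc k \<le> newton_s F" using k by simp
      have "weight (edge_weight F (Suc k)) b \<le> weight (edge_weight F (Suc k)) p"
        using edge_supports_right[OF ne ks p] by (simp add: b_def)
      moreover have "(?w - edge_weight F (Suc k)) * (real (fst p) - real (fst b)) > 0"
        using i edge_weight_Suc[OF ne k(1) ks] by (intro mult_pos_pos) auto
      ultimately show False using pw by (simp add: weight_def algebra_simps)
    qed
    have a_le: "fst a \<le> fst p"
    proof (rule ccontr)
      assume "\<not> fst a \<le> fst p"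
      then have i: "real (fst a) - real (fst p) > 0" by simp
      then have "k - 1 \<noteq> 0" using newton_vertex_first[OF ne p] by (auto simp: a_def)
      then have ks: "1 \<le> k - 1" "k - 1 \<le> newton_s F" using k by auto
      have "weight (edge_weight F (k - 1)) a \<le> weight (edge_weight F (k - 1)) p"
        using edge_supports[OF ne ks p] by (simp add: a_def)
      moreover have "(edge_weight F (k - 1) - ?w) * (real (fst a) - real (fst p)) > 0"
        using i edge_weight_Suc[OF ne ks(1)] k ks by (intro mult_pos_pos) auto
      ultimately show False using pw eq by (simp add: weight_def algebra_simps)
    qed
    define t where "t = (real (fst p) - real (fst a)) / (real (fst b) - real (fst a))"
    have t: "0 \<le> t" "t \<le> 1" using ab le_b a_le by (auto simp: t_def field_simps)
    have "t * (real (fst b) - real (fst a)) = real (fst p) - real (fst a)"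
      using ab by (simp add: t_def)
    then have f: "real (fst p) = (1 - t) * real (fst a) + t * real (fst b)" by (simp add: algebra_simps)
    have "real (snd p) = weight ?w b - ?w * ((1 - t) * real (fst a) + t * real (fst b))"
      using pw by (simp add: weight_def f)
    also have "\<dots> = (1 - t) * (weight ?w a - ?w * real (fst a)) + t * (weight ?w b - ?w * real (fst b))"
      unfolding eq by (simp add: algebra_simps)
    finally have s: "real (snd p) = (1 - t) * real (snd a) + t * real (snd b)"
      by (simp add: weight_def)
    show "lattice_point p \<in> closed_segment (lattice_point a) (lattice_point b)"
      unfolding in_segment using t f s by (auto simp: lattice_point_def intro!: exI[of _ t])
  qed
  then show ?thesis
    unfolding newton_edge_def a_def[symmetric] b_def[symmetric] by (auto simp: newton_face_def)
qed

lemma finite_newton_face: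
  assumes "w > 0"
  shows "finite (newton_face F w)"
proof -
  obtain C where C: "finite C" "C \<subseteq> valid_indices F"
    "\<And>p. p \<in> valid_indices F \<Longrightarrow> \<exists>c\<in>C. fst c \<le> fst p \<and> snd c \<le> snd p"
    by (rule dickson_plane[of "valid_indices F"]) blast
  have "newton_face F w \<subseteq> C"
  proof
    fix p assume p: "p \<in> newton_face F w"
    then have pv: "p \<in> valid_indices F" by (simp add: newton_face_def)
    obtain c where c: "c \<in> C" "fst c \<le> fst p" "snd c \<le> snd p" using C(3)[OF pv] by blast
    have "w * real (fst p) + real (snd p) \<le> w * real (fst c) + real (snd c)"
      using p c(1) C(2) by (auto simp: newton_face_def weight_def)
    moreover have "w * real (fst c) \<le> w * real (fst p)" using c assms by simp
    ultimately have "snd p = snd c" "w * real (fst p) = w * real (fst c)" using c(3) by linarith+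
    then have "c = p" using assms by (simp add: prod_eq_iff)
    then show "p \<in> C" using c by simp
  qed
  then show ?thesis using C(1) finite_subset by blast
qed

text \<open>For a set \<open>D\<close> of weights that is closed upwards, given as a predicate, vertex number \<open>k\<close> follows
exactly those edges whose weight belongs to \<open>D\<close>.\<close>
definition at_cut :: "(real \<Rightarrow> real \<Rightarrow> real) \<Rightarrow> (real \<Rightarrow> bool) \<Rightarrow> nat \<Rightarrow> bool" where
  "at_cut F D k \<longleftrightarrow> k \<le> newton_s F \<and> (k = 0 \<or> D (edge_weight F k)) \<and>
     (k = newton_s F \<or> \<not> D (edge_weight F (Suc k)))"

lemma at_cut_exists:
  obtains k where "at_cut F D k"
proof -
  let ?P = "\<lambda>k. k \<le> newton_s F \<and> (k = 0 \<or> D (edge_weight F k))"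
  obtain k where k: "?P k" "\<And>l. ?P l \<Longrightarrow> l \<le> k"
    using GreatestI_ex_nat[of ?P "newton_s F"] Greatest_le_nat[of ?P _ "newton_s F"] by blast
  have "at_cut F D k" using k(1) k(2)[of "Suc k"] by (auto simp: at_cut_def)
  then show ?thesis by (rule that)
qed

text \<open>The slope \<open>-w\<close> either belongs to an edge or lies strictly between the slopes at a unique vertex.\<close>
lemma componential_poly_face:
  assumes ne: "valid_indices F \<noteq> {}" and w: "w > 0"
  shows "componential_poly F (- w) = (\<Sum>p\<in>newton_face F w. monom (coeff_at F p) (snd p))"
proof -
  have "{p \<in> valid_indices F. lattice_point p \<in> xi_component F (- w)} = newton_face F w"
  proof (cases "- w \<in> slopes F")
    case True
    then obtain k where k: "k \<in> {1..newton_s F}" "w = edge_weight F k"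
      by (auto simp: slopes_eq)
    have "(THE k. k \<in> {1..newton_s F} \<and> edge_slope F k = ereal (- w)) = k"
      using k edge_weight_inj[OF ne _ k(1)] by (intro the_equality) (auto simp: edge_slope_weight)
    then show ?thesis using True newton_edge_face[OF ne, of k] k by (simp add: xi_component_def)
  next
    case False
    \<comment> \<open>The vertex between the edges steeper and those flatter than \<open>-w\<close>.\<close>
    obtain k where k: "at_cut F (\<lambda>u. w < u) k" by (rule at_cut_exists)
    then have kl: "k \<le> newton_s F" "k = 0 \<or> w < edge_weight F k"
      by (auto simp: at_cut_def)
    have kr: "k = newton_s F \<or> edge_weight F (Suc k) < w"
    proof (cases "k = newton_s F")
      case ks: False
      then have "edge_weight F (Suc k) \<noteq> w" using False kl by (auto simp: slopes_eq)
      then show ?thesis using k ks by (auto simp: at_cut_def)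
    qed simp
    have conv: "edge_slope F l < ereal (- w) \<and> ereal (- w) < edge_slope F (l + 1) \<longleftrightarrow>
        (l = 0 \<or> w < edge_weight F l) \<and> (l = newton_s F \<or> edge_weight F (Suc l) < w)"
      if "l \<le> newton_s F" for l
    proof -
      have "edge_slope F l < ereal (- w) \<longleftrightarrow> l = 0 \<or> w < edge_weight F l"
        using that by (cases "l = 0") (auto simp: edge_slope_weight edge_slope_def[of F 0])
      moreover have "ereal (- w) < edge_slope F (l + 1) \<longleftrightarrow> l = newton_s F \<or> edge_weight F (Suc l) < w"
      proof (cases "l = newton_s F")
        case True
        then show ?thesis using w by (simp add: edge_slope_def zero_ereal_def)
      qed (use that in \<open>auto simp: edge_slope_weight\<close>)
      ultimately show ?thesis by blast
    qed
    have "(THE l. l \<le> newton_s F \<and> edge_slope F l < ereal (- w) \<and> ereal (- w) < edge_slope F (l + 1)) = k"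
    proof (rule the_equality)
      fix l assume l: "l \<le> newton_s F \<and> edge_slope F l < ereal (- w) \<and> ereal (- w) < edge_slope F (l + 1)"
      then have l': "(l = 0 \<or> w < edge_weight F l) \<and> (l = newton_s F \<or> edge_weight F (Suc l) < w)"
        using conv by blast
      show "l = k"
      proof (cases l k rule: linorder_cases)
        case less
        then show ?thesis
          using edge_weight_antimono[OF ne, of "Suc l" k] l' kl by auto
      next
        case greater
        then show ?thesis
          using edge_weight_antimono[OF ne, of "Suc k" l] l l' kl kr by auto
      qed
    qed (use conv[OF kl(1)] kl kr in auto)
    then have x: "xi_component F (- w) = {lattice_point (newton_vertex F k)}"
      using False by (simp add: xi_component_def)
    have "newton_face F w = {newton_vertex F k}"
      using vertex_strictly_lightest[OF ne kl(1) w kl(2) kr] newton_vertex_valid[OF ne kl(1)]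
      unfolding newton_face_def by (fastforce simp: not_le[symmetric] intro: less_imp_le)
    then show ?thesis using x newton_vertex_valid[OF ne kl(1)] by auto
  qed
  then show ?thesis by (simp add: componential_poly_def coeff_at_def case_prod_unfold)
qed

section \<open>Parity of the ordinates of the dominant vertices\<close>

lemma cut_index_eq:
  assumes ne: "valid_indices F \<noteq> {}" and sub: "slopes G \<inter> slopes H \<subseteq> slopes F"
    and \<kappa>: "\<kappa> < num_common G H"
  obtains k where "1 \<le> k" "k \<le> newton_s F" "common_slopes G H ! \<kappa> = - edge_weight F k"
    "cut_index G H F \<kappa> = k - 1"
proof -
  have "finite (slopes G \<inter> slopes H)" by (simp add: slopes_eq)
  then have "common_slopes G H ! \<kappa> \<in> slopes G \<inter> slopes H"
    using nth_mem[of \<kappa> "common_slopes G H"] \<kappa> by (simp add: num_common_def common_slopes_def)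
  then obtain k where k: "k \<in> {1..newton_s F}" "common_slopes G H ! \<kappa> = - edge_weight F k"
    using sub by (auto simp: slopes_eq[of F])
  have "(THE l. l \<le> newton_s F \<and> edge_slope F (l + 1) = ereal (common_slopes G H ! \<kappa>)) = k - 1"
  proof (rule the_equality)
    fix l assume l: "l \<le> newton_s F \<and> edge_slope F (l + 1) = ereal (common_slopes G H ! \<kappa>)"
    have "l \<noteq> newton_s F"
      using l k edge_weight_pos[OF ne, of k] by (auto simp: edge_slope_def zero_ereal_def)
    then have "edge_weight F (l + 1) = edge_weight F k" using l k by (auto simp: edge_slope_weight)
    then show "l = k - 1" using edge_weight_inj[OF ne _ k(1), of "l + 1"] l \<open>l \<noteq> newton_s F\<close> by auto
  qed (use k in \<open>auto simp: edge_slope_weight\<close>)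
  then have "cut_index G H F \<kappa> = k - 1" using \<kappa> by (simp add: cut_index_def)
  then show ?thesis using that k by auto
qed

text \<open>The number of the block behind those common edges whose weight belongs to \<open>D\<close>. It depends on both
polygons, but not on which of them the block is taken from.\<close>
definition block_at :: "(real \<Rightarrow> real \<Rightarrow> real) \<Rightarrow> (real \<Rightarrow> real \<Rightarrow> real) \<Rightarrow> (real \<Rightarrow> bool) \<Rightarrow> nat \<Rightarrow> bool" where
  "block_at G H D \<kappa> \<longleftrightarrow> \<kappa> \<le> num_common G H \<and> (\<kappa> = 0 \<or> D (- (common_slopes G H ! (\<kappa> - 1)))) \<and>
     (\<kappa> = num_common G H \<or> \<not> D (- (common_slopes G H ! \<kappa>)))"

lemma block_at_exists:
  obtains \<kappa> where "block_at G H D \<kappa>"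
proof -
  let ?P = "\<lambda>\<kappa>. \<kappa> \<le> num_common G H \<and> (\<kappa> = 0 \<or> D (- (common_slopes G H ! (\<kappa> - 1))))"
  obtain \<kappa> where \<kappa>: "?P \<kappa>" "\<And>l. ?P l \<Longrightarrow> l \<le> \<kappa>"
    using GreatestI_ex_nat[of ?P "num_common G H"] Greatest_le_nat[of ?P _ "num_common G H"] by blast
  have "block_at G H D \<kappa>" using \<kappa>(1) \<kappa>(2)[of "Suc \<kappa>"] by (auto simp: block_at_def)
  then show ?thesis by (rule that)
qed

text \<open>The blocks end at the common edges, and comparing the vertex with these edges amounts to testing
whether their weights belong to \<open>D\<close>.\<close>
lemma at_cut_in_block:
  assumes ne: "valid_indices F \<noteq> {}" and sub: "slopes G \<inter> slopes H \<subseteq> slopes F"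
    and D: "\<And>u v. D u \<Longrightarrow> u \<le> v \<Longrightarrow> D v"
    and \<kappa>: "block_at G H D \<kappa>" and k: "at_cut F D k"
  shows "newton_vertex F k \<in> set (vertex_block G H F \<kappa>)"
    and "\<kappa> = num_common G H \<Longrightarrow> k < newton_s F \<Longrightarrow>
           newton_vertex F k \<in> set (butlast (vertex_block G H F \<kappa>))"
proof -
  define a where "a = (if \<kappa> = 0 then 0 else cut_index G H F (\<kappa> - 1) + 1)"
  have ks: "k \<le> newton_s F" using k by (simp add: at_cut_def)
  have a: "a \<le> k"
  proof (cases "\<kappa> = 0")
    case False
    then have "\<kappa> - 1 < num_common G H" using \<kappa> by (auto simp: block_at_def)
    then obtain l where l: "1 \<le> l" "l \<le> newton_s F" "common_slopes G H ! (\<kappa> - 1) = - edge_weight F l"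
      "cut_index G H F (\<kappa> - 1) = l - 1" by (rule cut_index_eq[OF ne sub])
    have Dl: "D (edge_weight F l)" using \<kappa> False l by (auto simp: block_at_def)
    have "l \<le> k"
    proof (rule ccontr)
      assume "\<not> l \<le> k"
      then have "edge_weight F l \<le> edge_weight F (Suc k)"
        using edge_weight_antimono[OF ne, of "Suc k" l] l by auto
      then show False using D[OF Dl] k l \<open>\<not> l \<le> k\<close> by (auto simp: at_cut_def)
    qed
    then show ?thesis using l False by (simp add: a_def)
  qed (simp add: a_def)
  have b: "k \<le> cut_index G H F \<kappa>"
  proof (cases "\<kappa> = num_common G H")
    case True
    then show ?thesis using ks by (simp add: cut_index_def)
  next
    case False
    then have "\<kappa> < num_common G H" using \<kappa> by (auto simp: block_at_def)
    then obtain l where l: "1 \<le> l" "l \<le> newton_s F" "common_slopes G H ! \<kappa> = - edge_weight F l"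
      "cut_index G H F \<kappa> = l - 1" by (rule cut_index_eq[OF ne sub])
    have Dl: "\<not> D (edge_weight F l)" using \<kappa> False l by (auto simp: block_at_def)
    have "k < l"
    proof (rule ccontr)
      assume "\<not> k < l"
      then have "edge_weight F k \<le> edge_weight F l"
        using edge_weight_antimono[OF ne, of l k] l ks by auto
      then show False using D[of "edge_weight F k"] Dl k l \<open>\<not> k < l\<close> by (auto simp: at_cut_def)
    qed
    then show ?thesis using l by simp
  qed
  have block: "vertex_block G H F \<kappa> = map (newton_vertex F) [a..<cut_index G H F \<kappa> + 1]"
    by (simp add: vertex_block_def a_def)
  show "newton_vertex F k \<in> set (vertex_block G H F \<kappa>)"
    unfolding block using a b by (auto simp del: upt_Suc)
  show "newton_vertex F k \<in> set (butlast (vertex_block G H F \<kappa>))"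
    if "\<kappa> = num_common G H" "k < newton_s F"
  proof -
    have "cut_index G H F \<kappa> = newton_s F" using that by (simp add: cut_index_def)
    then have "butlast (vertex_block G H F \<kappa>) = map (newton_vertex F) [a..<newton_s F]"
      unfolding block using a that by (simp add: map_butlast[symmetric])
    then show ?thesis using a that by auto
  qed
qed

lemma P1_opposite_parities_at_cut:
  assumes "cond_P1 G H" "valid_indices G \<noteq> {}" "valid_indices H \<noteq> {}"
    and D: "\<And>u v. D u \<Longrightarrow> u \<le> v \<Longrightarrow> D v"
    and "at_cut G D k" "at_cut H D l"
  shows "even (snd (newton_vertex G k)) \<noteq> even (snd (newton_vertex H l))"
proof -
  obtain \<kappa> where \<kappa>: "block_at G H D \<kappa>" by (rule block_at_exists)
  have "newton_vertex G k \<in> set (vertex_block G H G \<kappa>)"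
    by (rule at_cut_in_block(1)[OF assms(2) _ D \<kappa> assms(5)]) auto
  moreover have "newton_vertex H l \<in> set (vertex_block G H H \<kappa>)"
    by (rule at_cut_in_block(1)[OF assms(3) _ D \<kappa> assms(6)]) auto
  moreover have "opposite_parities (vertex_block G H G \<kappa>) (vertex_block G H H \<kappa>)"
    using assms(1) \<kappa> by (simp add: cond_P1_def block_at_def)
  ultimately show ?thesis unfolding opposite_parities_def by blast
qed

lemma P2_opposite_parities_at_cut:
  assumes "cond_P2 G H" "valid_indices G \<noteq> {}" "valid_indices H \<noteq> {}"
    and D: "\<And>u v. D u \<Longrightarrow> u \<le> v \<Longrightarrow> D v"
    and "at_cut G D k" "at_cut H D l" and k: "k < newton_s G"
  shows "even (snd (newton_vertex G k)) \<noteq> even (snd (newton_vertex H l))"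
proof -
  obtain \<kappa> where \<kappa>: "block_at G H D \<kappa>" by (rule block_at_exists)
  have G: "newton_vertex G k \<in> set (vertex_block G H G \<kappa>)"
    "\<kappa> = num_common G H \<Longrightarrow> newton_vertex G k \<in> set (butlast (vertex_block G H G \<kappa>))"
    using k by (intro at_cut_in_block[OF assms(2) _ D \<kappa> assms(5)]; simp)+
  have H: "newton_vertex H l \<in> set (vertex_block G H H \<kappa>)"
    by (rule at_cut_in_block(1)[OF assms(3) _ D \<kappa> assms(6)]) auto
  show ?thesis
  proof (cases "\<kappa> = num_common G H")
    case True
    then have "odd (snd (newton_vertex G k))" "even (snd (newton_vertex H l))"
      using assms(1) G(2) H unfolding cond_P2_def by blast+
    then show ?thesis by simp
  next
    case False
    then have "opposite_parities (vertex_block G H G \<kappa>) (vertex_block G H H \<kappa>)"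
      using assms(1) \<kappa> by (simp add: cond_P2_def block_at_def)
    then show ?thesis using G(1) H unfolding opposite_parities_def by blast
  qed
qed

section \<open>The last edge\<close>

lemma (in linorder) sorted_key_list_of_set_inj_infinite:
  assumes "inj_on f A" "infinite A"
  shows "sorted_key_list_of_set f A = []"
proof -
  interpret key: folding_insort_key "(\<le>)" "(<)" A f
    by unfold_locales (rule assms(1))
  show ?thesis using assms(2) by (rule key.fold_insort_key.infinite)
qed

text \<open>The last but one index on the polygon lies on the last edge: its abscissa is between those of
the two ends, and a point of the polygon does not lie above a chord.\<close>
lemma star_index_facts:
  assumes S: "cond_S1 F" and ne: "valid_indices F \<noteq> {}"
  shows "1 \<le> newton_s F" and "star_index F \<in> newton_face F (edge_weight F (newton_s F))"
    and "0 < snd (star_index F)" and "snd (last_vertex F) = 0"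
    and "\<And>q. q \<in> valid_indices F \<Longrightarrow> 0 < snd q \<Longrightarrow> snd (star_index F) \<le> snd q"
proof -
  define A where "A = {p \<in> valid_indices F. lattice_point p \<in> newton_polygon F}"
  define xs where "xs = polygon_indices F"
  define s where "s = newton_s F"
  define v where "v = newton_vertex F"
  have xs_A: "xs = sorted_key_list_of_set fst A" by (simp add: xs_def A_def polygon_indices_def)
  have inj: "inj_on fst A" unfolding A_def by (rule inj_on_fst_polygon)
  have len: "length xs \<ge> 2" and last: "last xs = v s" and zero: "snd (last_vertex F) = 0"
    and gap: "{(i, j) \<in> valid_indices F. 0 < j \<and> j < snd (star_index F)} = {}"
    using S by (simp_all add: cond_S1_def xs_def last_vertex_def v_def s_def)
  have fin: "finite A"
  proof (rule ccontr)
    assume "infinite A"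
    then have "xs = []" unfolding xs_A by (rule sorted_key_list_of_set_inj_infinite[OF inj])
    then show False using len by simp
  qed
  have set: "set xs = A" and srt: "sorted_wrt (<) (map fst xs)"
    unfolding xs_A by (rule sorted_key_list_of_set_inj_on[OF inj fin])+
  define n where "n = length xs - 2"
  have n: "Suc n < length xs" "length xs = Suc (Suc n)" using len by (auto simp: n_def)
  have star: "star_index F = xs ! n" by (simp add: star_index_def xs_def n_def)
  have vs: "v s = xs ! Suc n" using last n by (simp add: last_conv_nth flip: length_0_conv)
  have starA: "star_index F \<in> A" using n set star by (metis Suc_lessD nth_mem)
  then have star_valid: "star_index F \<in> valid_indices F"
    and star_poly: "lattice_point (star_index F) \<in> newton_polygon F" by (auto simp: A_def)
  have lt: "fst (star_index F) < fst (v s)"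
    using sorted_wrt_nth_less[OF srt, of n "Suc n"] n star vs by simp
  show zero': "snd (last_vertex F) = 0" by (rule zero)
  have s1: "1 \<le> s"
  proof (rule ccontr)
    assume "\<not> 1 \<le> s"
    then have "s = 0" by simp
    then show False using newton_vertex_first[OF ne star_valid] lt by (simp add: v_def)
  qed
  then show "1 \<le> newton_s F" by (simp add: s_def)
  let ?w = "edge_weight F s"
  have w: "?w > 0" using edge_weight_pos[OF ne s1] by (simp add: s_def)
  have prev: "v (s - 1) \<in> newton_extremes F" unfolding v_def by (rule newton_vertex_extreme[OF ne]) (simp add: s_def)
  have prev_lt: "fst (v (s - 1)) < fst (v s)"
    using newton_vertex_fst[OF ne, of "s - 1" s] s1 by (simp add: v_def s_def)
  have prev_le: "fst (v (s - 1)) \<le> fst (star_index F)"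
  proof -
    have "v (s - 1) \<in> set xs" using prev newton_extremes_subset set by (auto simp: A_def)
    then obtain m where m: "m < length xs" "xs ! m = v (s - 1)" by (metis in_set_conv_nth)
    have "m \<noteq> Suc n" using m vs prev_lt by auto
    then have "m = n \<or> m < n" using m n by linarith
    then show ?thesis using sorted_wrt_nth_less[OF srt, of m n] m n star by auto
  qed
  have "weight ?w (star_index F) \<le> weight ?w (v s)"
  proof (rule newton_polygon_below_chord[OF star_poly])
    show "v (s - 1) \<in> valid_indices F" by (rule newton_extremes_valid[OF prev])
    show "v s \<in> valid_indices F" unfolding v_def s_def by (rule newton_vertex_valid[OF ne]) simp
    show "weight ?w (v (s - 1)) \<le> weight ?w (v s)"
      using edge_weight_eq[OF ne s1] by (simp add: v_def s_def)
  qed (use prev_le lt prev_lt in auto)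
  then have face: "star_index F \<in> newton_face F ?w"
    using edge_supports[OF ne s1] star_valid by (auto simp: newton_face_def v_def s_def intro: order_trans)
  then show "star_index F \<in> newton_face F (edge_weight F (newton_s F))" by (simp add: s_def)
  have "v s \<in> valid_indices F" unfolding v_def s_def by (rule newton_vertex_valid[OF ne]) simp
  then have "weight ?w (star_index F) \<le> weight ?w (v s)" using face by (simp add: newton_face_def)
  moreover have "weight ?w (v s) \<le> weight ?w (star_index F)"
    using edge_supports[OF ne s1 _ star_valid] by (simp add: v_def s_def)
  ultimately have "weight ?w (star_index F) = weight ?w (v s)" by simp
  moreover have "?w * real (fst (star_index F)) < ?w * real (fst (v s))" using lt w by simp
  moreover have "snd (v s) = 0" using zero by (simp add: last_vertex_def v_def s_def)
  ultimately show "0 < snd (star_index F)" by (auto simp: weight_def)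
  show "snd (star_index F) \<le> snd q" if "q \<in> valid_indices F" "0 < snd q" for q
    using gap that by (cases q) (auto simp: not_less[symmetric])
qed

section \<open>Monomials along filters converging to the origin\<close>

text \<open>Filters on the half plane \<open>\<rho> > 0\<close> without the axis \<open>\<theta> = 0\<close> that converge to the origin. Unlike
sequences, they can be refined without relabelling.\<close>
definition approach :: "(real \<times> real) filter \<Rightarrow> bool" where
  "approach Fl \<longleftrightarrow> Fl \<noteq> bot \<and> Fl \<le> nhds (0, 0) \<and> (\<forall>\<^sub>F z in Fl. 0 < fst z \<and> snd z \<noteq> 0)"

lemma approachD:
  assumes "approach Fl"
  shows "Fl \<noteq> bot" "Fl \<le> nhds (0, 0)" "(fst \<longlongrightarrow> 0) Fl" "(snd \<longlongrightarrow> 0) Fl"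
    "\<forall>\<^sub>F z in Fl. 0 < fst z \<and> fst z < 1 \<and> snd z \<noteq> 0"
proof -
  show le: "Fl \<le> nhds (0, 0)" and "Fl \<noteq> bot" using assms by (auto simp: approach_def)
  have "((\<lambda>z. z) \<longlongrightarrow> (0, 0)) Fl" using le by (simp add: filterlim_def)
  from tendsto_fst[OF this] tendsto_snd[OF this]
  show f: "(fst \<longlongrightarrow> 0) Fl" and "(snd \<longlongrightarrow> 0) Fl" by simp_all
  have "\<forall>\<^sub>F z in Fl. fst z < 1" using f by (rule order_tendstoD) simp
  moreover have "\<forall>\<^sub>F z in Fl. 0 < fst z \<and> snd z \<noteq> 0" using assms by (simp add: approach_def)
  ultimately show "\<forall>\<^sub>F z in Fl. 0 < fst z \<and> fst z < 1 \<and> snd z \<noteq> 0" by eventually_elim auto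
qed

lemma approach_mono: "approach Fl \<Longrightarrow> Fl' \<le> Fl \<Longrightarrow> Fl' \<noteq> bot \<Longrightarrow> approach Fl'"
  unfolding approach_def by (auto intro: order_trans filter_leD)

text \<open>The coordinate along the curves \<open>\<theta> = t \<rho> powr (1 / w)\<close>, on which the monomials on a line of slope \<open>-w\<close>
have the same order of magnitude.\<close>
definition tau :: "real \<Rightarrow> real \<times> real \<Rightarrow> real" where
  "tau w z = snd z * fst z powr (- (1 / w))"

text \<open>In the coordinates \<open>\<rho>\<close> and \<open>tau w\<close> the exponent of \<open>\<rho>\<close> is proportional to the weight.
Quotients of monomials on or above a supporting line are thereby bounded by powers of \<open>tau w\<close>.\<close>
lemma mon_tau:
  assumes "0 < fst z" "w > 0"
  shows "mon p z = tau w z ^ snd p * fst z powr (weight w p / w)"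
proof -
  have "(fst z powr (- (1 / w))) ^ snd p = fst z powr (- (1 / w) * real (snd p))"
    using assms(1) by (simp add: powr_powr flip: powr_realpow)
  then have "(fst z powr (- (1 / w))) ^ snd p * fst z powr (weight w p / w) =
        fst z powr (- (1 / w) * real (snd p) + weight w p / w)"
    by (simp only: powr_add)
  also have "- (1 / w) * real (snd p) + weight w p / w = real (fst p)"
    using assms(2) by (simp add: weight_def field_simps)
  also have "fst z powr real (fst p) = fst z ^ fst p" using assms(1) by (rule powr_realpow)
  finally show ?thesis by (simp add: mon_def tau_def power_mult_distrib mult_ac)
qed

lemma mon_nonzero: "0 < fst z \<Longrightarrow> snd z \<noteq> 0 \<Longrightarrow> mon p z \<noteq> 0"
  by (simp add: mon_def)

lemma tau_nonzero: "0 < fst z \<Longrightarrow> snd z \<noteq> 0 \<Longrightarrow> tau w z \<noteq> 0"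
  by (simp add: tau_def)

lemma rho_powr_tendsto_0:
  assumes "approach Fl" "a > 0"
  shows "((\<lambda>z. fst z powr a) \<longlongrightarrow> 0) Fl"
  using approachD(3,5)[OF assms(1)] assms(2)
  by (intro tendsto_zero_powrI[OF _ tendsto_const]) (auto elim: eventually_mono)

text \<open>For \<open>0 < \<rho> < 1\<close> the absolute value of \<open>tau w\<close> does not increase with \<open>w\<close>.\<close>
lemma tau_tendsto_0_mono:
  assumes Fl: "approach Fl" and u: "0 < u" "u \<le> w" and lim: "(tau u \<longlongrightarrow> 0) Fl"
  shows "(tau w \<longlongrightarrow> 0) Fl"
proof (rule Lim_null_comparison)
  show "((\<lambda>z. \<bar>tau u z\<bar>) \<longlongrightarrow> 0) Fl" using tendsto_rabs[OF lim] by simp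
  show "\<forall>\<^sub>F z in Fl. norm (tau w z) \<le> \<bar>tau u z\<bar>"
    using approachD(5)[OF Fl]
  proof eventually_elim
    case (elim z)
    have "- (1 / u) \<le> - (1 / w)" using u by (simp add: field_simps)
    then have "fst z powr (- (1 / w)) \<le> fst z powr (- (1 / u))"
      using elim by (intro powr_mono') auto
    then show ?case by (simp add: tau_def abs_mult mult_left_mono)
  qed
qed

text \<open>If \<open>\<theta>\<close> behaves like \<open>t \<rho> powr (1 / w)\<close>, the monomials on a line of slope \<open>-w\<close> are comparable to the
same power of \<open>\<rho>\<close>, and those above this line are negligible.\<close>
lemma mon_face_limit:
  assumes Fl: "approach Fl" and w: "w > 0" and lim: "(tau w \<longlongrightarrow> t) Fl" and d: "d \<le> weight w p"
  shows "((\<lambda>z. mon p z / fst z powr (d / w)) \<longlongrightarrow> (if weight w p = d then t ^ snd p else 0)) Fl"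
proof -
  have "((\<lambda>z. tau w z ^ snd p * fst z powr ((weight w p - d) / w)) \<longlongrightarrow>
          (if weight w p = d then t ^ snd p else 0)) Fl"
  proof (cases "weight w p = d")
    case True
    have "\<forall>\<^sub>F z in Fl. tau w z ^ snd p = tau w z ^ snd p * fst z powr ((weight w p - d) / w)"
      using approachD(5)[OF Fl] by eventually_elim (simp add: True)
    moreover have "((\<lambda>z. tau w z ^ snd p) \<longlongrightarrow> t ^ snd p) Fl" by (intro tendsto_intros lim)
    ultimately show ?thesis using True by (auto intro: Lim_transform_eventually)
  next
    case False
    have "((\<lambda>z. tau w z ^ snd p * fst z powr ((weight w p - d) / w)) \<longlongrightarrow> t ^ snd p * 0) Fl"
      using w d False by (intro tendsto_intros lim rho_powr_tendsto_0[OF Fl]) auto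
    then show ?thesis using False by simp
  qed
  moreover have "\<forall>\<^sub>F z in Fl. tau w z ^ snd p * fst z powr ((weight w p - d) / w) = mon p z / fst z powr (d / w)"
    using approachD(5)[OF Fl]
    by eventually_elim (simp add: mon_tau[OF _ w] diff_divide_distrib powr_diff)
  ultimately show ?thesis by (rule Lim_transform_eventually)
qed

definition dominated :: "(real \<times> real) filter \<Rightarrow> nat \<times> nat \<Rightarrow> nat \<times> nat \<Rightarrow> bool" where
  "dominated Fl q v \<longleftrightarrow> ((\<lambda>z. mon q z / mon v z) \<longlongrightarrow> 0) Fl"

lemma dominated_small_tau:
  assumes Fl: "approach Fl" and w: "w > 0" and lim: "(tau w \<longlongrightarrow> 0) Fl"
    and le: "weight w v \<le> weight w q" and lt: "snd v < snd q"
  shows "dominated Fl q v"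
  unfolding dominated_def
proof (rule Lim_null_comparison)
  have "((\<lambda>z. \<bar>tau w z\<bar> ^ (snd q - snd v)) \<longlongrightarrow> \<bar>0\<bar> ^ (snd q - snd v)) Fl"
    by (intro tendsto_intros lim)
  then show "((\<lambda>z. \<bar>tau w z\<bar> ^ (snd q - snd v)) \<longlongrightarrow> 0) Fl" using lt by (simp add: power_0_left)
  show "\<forall>\<^sub>F z in Fl. norm (mon q z / mon v z) \<le> \<bar>tau w z\<bar> ^ (snd q - snd v)"
    using approachD(5)[OF Fl]
  proof eventually_elim
    case (elim z)
    have t: "tau w z \<noteq> 0" using elim by (simp add: tau_nonzero)
    have "tau w z ^ snd q = tau w z ^ (snd q - snd v) * tau w z ^ snd v"
      using lt by (simp flip: power_add)
    then have "mon q z / mon v z = tau w z ^ (snd q - snd v) * fst z powr ((weight w q - weight w v) / w)"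
      using elim t by (simp add: mon_tau[OF _ w] diff_divide_distrib powr_diff)
    moreover have "fst z powr ((weight w q - weight w v) / w) \<le> 1"
      using elim le w by (intro powr_le1) auto
    ultimately show ?case by (simp add: abs_mult power_abs mult_left_le)
  qed
qed

lemma dominated_large_tau:
  assumes Fl: "approach Fl" and w: "w > 0" and lim: "filterlim (\<lambda>z. \<bar>tau w z\<bar>) at_top Fl"
    and le: "weight w v \<le> weight w q" and lt: "snd q < snd v"
  shows "dominated Fl q v"
  unfolding dominated_def
proof (rule Lim_null_comparison)
  have "((\<lambda>z. inverse \<bar>tau w z\<bar> ^ (snd v - snd q)) \<longlongrightarrow> 0 ^ (snd v - snd q)) Fl"
    by (intro tendsto_intros tendsto_inverse_0_at_top lim)
  then show "((\<lambda>z. inverse \<bar>tau w z\<bar> ^ (snd v - snd q)) \<longlongrightarrow> 0) Fl" using lt by (simp add: power_0_left)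
  show "\<forall>\<^sub>F z in Fl. norm (mon q z / mon v z) \<le> inverse \<bar>tau w z\<bar> ^ (snd v - snd q)"
    using approachD(5)[OF Fl]
  proof eventually_elim
    case (elim z)
    have t: "tau w z \<noteq> 0" using elim by (simp add: tau_nonzero)
    have "tau w z ^ snd v = tau w z ^ (snd v - snd q) * tau w z ^ snd q"
      using lt by (simp flip: power_add)
    then have "mon q z / mon v z =
        inverse (tau w z) ^ (snd v - snd q) * fst z powr ((weight w q - weight w v) / w)"
      using elim t by (simp add: mon_tau[OF _ w] diff_divide_distrib powr_diff field_simps)
    moreover have "fst z powr ((weight w q - weight w v) / w) \<le> 1"
      using elim le w by (intro powr_le1) auto
    ultimately show ?case by (simp add: abs_mult power_abs mult_left_le)
  qed
qed

lemma dominated_componentwise: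
  assumes Fl: "approach Fl" and le: "fst v \<le> fst q" "snd v \<le> snd q" and ne: "q \<noteq> v"
  shows "dominated Fl q v"
proof -
  have "((\<lambda>z. fst z ^ (fst q - fst v) * snd z ^ (snd q - snd v)) \<longlongrightarrow>
          0 ^ (fst q - fst v) * 0 ^ (snd q - snd v)) Fl"
    by (intro tendsto_intros approachD[OF Fl])
  moreover have "0 ^ (fst q - fst v) * 0 ^ (snd q - snd v) = (0::real)"
    using le ne by (auto simp: power_0_left prod_eq_iff)
  moreover have "\<forall>\<^sub>F z in Fl. fst z ^ (fst q - fst v) * snd z ^ (snd q - snd v) = mon q z / mon v z"
    using approachD(5)[OF Fl] by eventually_elim (simp add: mon_def power_diff le)
  ultimately show ?thesis unfolding dominated_def by (auto intro: Lim_transform_eventually)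
qed

text \<open>Indices that are higher than the vertex are compared along the edge to the left of the vertex, lower
ones along the edge to the right.\<close>
lemma vertex_dominates:
  assumes Fl: "approach Fl" and ne: "valid_indices F \<noteq> {}" and k: "k \<le> newton_s F"
    and left: "k = 0 \<or> (tau (edge_weight F k) \<longlongrightarrow> 0) Fl"
    and right: "k = newton_s F \<or> filterlim (\<lambda>z. \<bar>tau (edge_weight F (Suc k)) z\<bar>) at_top Fl"
    and q: "q \<in> valid_indices F" "q \<noteq> newton_vertex F k"
  shows "dominated Fl q (newton_vertex F k)"
proof (cases "snd q" "snd (newton_vertex F k)" rule: linorder_cases)
  case less
  then have ks: "k \<noteq> newton_s F" using newton_vertex_last[OF ne q(1)] by auto
  show ?thesis
    by (rule dominated_large_tau[OF Fl _ _ _ less, where w = "edge_weight F (Suc k)"])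
       (use ks k right in \<open>auto intro!: edge_weight_pos[OF ne] edge_supports_right[OF ne _ q(1)]\<close>)
next
  case equal
  have "fst (newton_vertex F k) \<le> fst q"
  proof (cases "k = 0")
    case True
    then show ?thesis using newton_vertex_first[OF ne q(1)] by auto
  next
    case False
    then have "edge_weight F k > 0" using edge_weight_pos[OF ne _ k] by simp
    then show ?thesis
      using edge_supports[OF ne _ k q(1)] False equal by (simp add: weight_def)
  qed
  then show ?thesis using dominated_componentwise[OF Fl _ _ q(2)] equal by simp
next
  case greater
  show ?thesis
  proof (cases "k = 0")
    case True
    then show ?thesis
      using dominated_componentwise[OF Fl _ _ q(2)] newton_vertex_first[OF ne q(1)] greater by auto
  next
    case False
    then show ?thesis
      using left k
      by (intro dominated_small_tau[OF Fl _ _ _ greater, where w = "edge_weight F k"])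
         (auto intro!: edge_weight_pos[OF ne] edge_supports[OF ne _ _ q(1)])
  qed
qed

section \<open>Leading terms of a function and of its derivative\<close>

definition euler :: "(real \<Rightarrow> real \<Rightarrow> real) \<Rightarrow> real \<times> real \<Rightarrow> real" where
  "euler F z = snd z * deriv (F (fst z)) (snd z)"

lemma leading_monomial_general:
  assumes F: "has_power_series F c" and Fl: "approach Fl"
    and dom: "\<And>q. c (fst q) (snd q) \<noteq> 0 \<Longrightarrow> q \<noteq> v \<Longrightarrow> dominated Fl q v"
  shows "((\<lambda>z. F (fst z) (snd z) / mon v z) \<longlongrightarrow> c (fst v) (snd v)) Fl"
proof -
  have "((\<lambda>z. (F (fst z) (snd z) - (\<Sum>p\<in>{v}. c (fst p) (snd p) * mon p z)) / mon v z) \<longlongrightarrow> 0) Fl"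
    using dom unfolding dominated_def
    by (intro power_series_asymptotics[OF F approachD(2)[OF Fl]]) auto
  from tendsto_add[OF this tendsto_const[of "c (fst v) (snd v)"]]
  have "((\<lambda>z. (F (fst z) (snd z) - c (fst v) (snd v) * mon v z) / mon v z + c (fst v) (snd v)) \<longlongrightarrow>
           c (fst v) (snd v)) Fl"
    by simp
  moreover have "\<forall>\<^sub>F z in Fl. (F (fst z) (snd z) - c (fst v) (snd v) * mon v z) / mon v z + c (fst v) (snd v)
                   = F (fst z) (snd z) / mon v z"
    using approachD(5)[OF Fl]
    by eventually_elim (simp add: diff_divide_distrib mon_nonzero)
  ultimately show ?thesis by (rule Lim_transform_eventually)
qed

lemma leading_monomial:
  assumes F: "analytic_at_origin F" and Fl: "approach Fl"
    and dom: "\<And>q. q \<in> valid_indices F \<Longrightarrow> q \<noteq> v \<Longrightarrow> dominated Fl q v"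
  shows "((\<lambda>z. F (fst z) (snd z) / mon v z) \<longlongrightarrow> coeff_at F v) Fl"
  unfolding coeff_at_def
  by (rule leading_monomial_general[OF has_power_series_ps_coeff[OF F] Fl])
     (auto intro!: dom simp: valid_indices_def)

lemma leading_monomial_euler:
  assumes F: "analytic_at_origin F" and Fl: "approach Fl"
    and dom: "\<And>q. q \<in> valid_indices F \<Longrightarrow> 0 < snd q \<Longrightarrow> q \<noteq> v \<Longrightarrow> dominated Fl q v"
  shows "((\<lambda>z. euler F z / mon v z) \<longlongrightarrow> real (snd v) * coeff_at F v) Fl"
  unfolding coeff_at_def euler_def
  by (rule leading_monomial_general[OF euler_theta_power_series[OF has_power_series_ps_coeff[OF F]] Fl])
     (auto intro!: dom simp: valid_indices_def)

lemma leading_face_general: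
  assumes F: "has_power_series F c" and Fl: "approach Fl" and w: "w > 0" and lim: "(tau w \<longlongrightarrow> t) Fl"
    and S: "finite S" "\<And>p. p \<in> S \<Longrightarrow> weight w p = d"
    and above: "\<And>q. c (fst q) (snd q) \<noteq> 0 \<Longrightarrow> q \<notin> S \<Longrightarrow> d < weight w q"
  shows "((\<lambda>z. F (fst z) (snd z) / fst z powr (d / w)) \<longlongrightarrow> (\<Sum>p\<in>S. c (fst p) (snd p) * t ^ snd p)) Fl"
proof -
  let ?m = "\<lambda>z. fst z powr (d / w)"
  have 1: "((\<lambda>z. (F (fst z) (snd z) - (\<Sum>p\<in>S. c (fst p) (snd p) * mon p z)) / ?m z) \<longlongrightarrow> 0) Fl"
  proof (rule power_series_asymptotics[OF F approachD(2)[OF Fl] S(1)])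
    fix q assume "c (fst q) (snd q) \<noteq> 0" "q \<notin> S"
    then have "d < weight w q" by (rule above)
    then show "((\<lambda>z. mon q z / ?m z) \<longlongrightarrow> 0) Fl"
      using mon_face_limit[OF Fl w lim, of d q] by simp
  qed
  have 2: "((\<lambda>z. \<Sum>p\<in>S. c (fst p) (snd p) * (mon p z / ?m z)) \<longlongrightarrow>
             (\<Sum>p\<in>S. c (fst p) (snd p) * t ^ snd p)) Fl"
  proof (intro tendsto_sum tendsto_mult tendsto_const)
    fix p assume "p \<in> S"
    then show "((\<lambda>z. mon p z / ?m z) \<longlongrightarrow> t ^ snd p) Fl"
      using mon_face_limit[OF Fl w lim, of d p] S(2) by simp
  qed
  have "\<And>z. (F (fst z) (snd z) - (\<Sum>p\<in>S. c (fst p) (snd p) * mon p z)) / ?m z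
          + (\<Sum>p\<in>S. c (fst p) (snd p) * (mon p z / ?m z)) = F (fst z) (snd z) / ?m z"
    by (simp add: diff_divide_distrib sum_divide_distrib)
  with tendsto_add[OF 1 2] show ?thesis by simp
qed

text \<open>Both limits hold with the same exponent \<open>d\<close>, which is the minimal weight divided by \<open>w\<close>.\<close>
lemma leading_face:
  assumes F: "analytic_at_origin F" and ne: "valid_indices F \<noteq> {}" and Fl: "approach Fl"
    and w: "w > 0" and lim: "(tau w \<longlongrightarrow> t) Fl"
  obtains d where
    "((\<lambda>z. F (fst z) (snd z) / fst z powr d) \<longlongrightarrow> poly (componential_poly F (- w)) t) Fl"
    "((\<lambda>z. euler F z / fst z powr d) \<longlongrightarrow> t * poly (pderiv (componential_poly F (- w))) t) Fl"
proof -
  let ?S = "newton_face F w"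
  obtain e where e: "e \<in> newton_extremes F" "\<And>q. q \<in> valid_indices F \<Longrightarrow> weight w e \<le> weight w q"
    by (rule weight_minimum_extreme[OF ne w]) blast
  define d where "d = weight w e"
  have fin: "finite ?S" by (rule finite_newton_face[OF w])
  have S: "weight w p = d" if "p \<in> ?S" for p
  proof (rule antisym)
    show "weight w p \<le> d" using that newton_extremes_valid[OF e(1)] by (simp add: newton_face_def d_def)
    show "d \<le> weight w p" using that e(2)[of p] by (simp add: newton_face_def d_def)
  qed
  have above: "d < weight w q" if "q \<in> valid_indices F" "q \<notin> ?S" for q
    using that e(2) by (fastforce simp: newton_face_def d_def)
  have K: "componential_poly F (- w) = (\<Sum>p\<in>?S. monom (coeff_at F p) (snd p))"
    by (rule componential_poly_face[OF ne w])
  have "((\<lambda>z. F (fst z) (snd z) / fst z powr (d / w)) \<longlongrightarrow>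
          (\<Sum>p\<in>?S. ps_coeff F (fst p) (snd p) * t ^ snd p)) Fl"
    using above
    by (intro leading_face_general[OF has_power_series_ps_coeff[OF F] Fl w lim fin S])
       (auto simp: valid_indices_def)
  then have 1: "((\<lambda>z. F (fst z) (snd z) / fst z powr (d / w)) \<longlongrightarrow> poly (componential_poly F (- w)) t) Fl"
    by (simp add: K poly_sum poly_monom coeff_at_def)
  have "((\<lambda>z. snd z * deriv (F (fst z)) (snd z) / fst z powr (d / w)) \<longlongrightarrow>
          (\<Sum>p\<in>?S. (real (snd p) * ps_coeff F (fst p) (snd p)) * t ^ snd p)) Fl"
    using above
    by (intro leading_face_general[OF euler_theta_power_series[OF has_power_series_ps_coeff[OF F]] Fl w lim fin S])
       (auto simp: valid_indices_def)
  moreover have "t * poly (pderiv (componential_poly F (- w))) t =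
      (\<Sum>p\<in>?S. (real (snd p) * ps_coeff F (fst p) (snd p)) * t ^ snd p)"
  proof -
    have "t * poly (pderiv (monom c n)) t = real n * c * t ^ n" for c and n :: nat
      by (cases n) (simp_all add: pderiv_monom poly_monom)
    then show ?thesis
      by (simp add: K higher_pderiv_sum[of "Suc 0", simplified] poly_sum sum_distrib_left coeff_at_def)
  qed
  ultimately have 2: "((\<lambda>z. euler F z / fst z powr (d / w)) \<longlongrightarrow>
      t * poly (pderiv (componential_poly F (- w))) t) Fl"
    by (simp add: euler_def)
  from 1 2 show ?thesis by (rule that)
qed

section \<open>Limits of the bracket\<close>

lemma bracket_limit:
  assumes "((\<lambda>z. G (fst z) (snd z) / mG z) \<longlongrightarrow> g0) Fl" "((\<lambda>z. euler G z / mG z) \<longlongrightarrow> g1) Fl"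
    and "((\<lambda>z. H (fst z) (snd z) / mH z) \<longlongrightarrow> h0) Fl" "((\<lambda>z. euler H z / mH z) \<longlongrightarrow> h1) Fl"
  shows "((\<lambda>z. snd z * theta_bracket G H (fst z) (snd z) / (mG z * mH z)) \<longlongrightarrow> g1 * h0 - g0 * h1) Fl"
proof -
  have "\<And>z. euler G z / mG z * (H (fst z) (snd z) / mH z) - G (fst z) (snd z) / mG z * (euler H z / mH z)
        = snd z * theta_bracket G H (fst z) (snd z) / (mG z * mH z)"
    by (simp add: euler_def theta_bracket_def diff_divide_distrib right_diff_distrib mult_ac)
  with tendsto_diff[OF tendsto_mult[OF assms(2,3)] tendsto_mult[OF assms(1,4)]] show ?thesis by simp
qed

lemma eventually_bracket_nonzero:
  assumes "((\<lambda>z. snd z * theta_bracket G H (fst z) (snd z) / m z) \<longlongrightarrow> c) Fl" "c \<noteq> 0"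
  shows "\<forall>\<^sub>F z in Fl. theta_bracket G H (fst z) (snd z) \<noteq> 0"
  using tendsto_imp_eventually_ne[OF assms] by eventually_elim auto

lemma bracket_limit_vertices:
  assumes GH: "analytic_at_origin G" "analytic_at_origin H" and Fl: "approach Fl"
    and v: "\<And>q. q \<in> valid_indices G \<Longrightarrow> q \<noteq> v \<Longrightarrow> dominated Fl q v"
    and u: "\<And>q. q \<in> valid_indices H \<Longrightarrow> q \<noteq> u \<Longrightarrow> dominated Fl q u"
  shows "((\<lambda>z. snd z * theta_bracket G H (fst z) (snd z) / (mon v z * mon u z)) \<longlongrightarrow>
           (real (snd v) - real (snd u)) * coeff_at G v * coeff_at H u) Fl"
  using bracket_limit[OF leading_monomial[OF GH(1) Fl v] leading_monomial_euler[OF GH(1) Fl v]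
      leading_monomial[OF GH(2) Fl u] leading_monomial_euler[OF GH(2) Fl u]]
  by (simp add: algebra_simps)

text \<open>The limit is \<open>t\<close> times the bracket of the componential polynomials at \<open>t\<close>, to which (Q) applies.\<close>
lemma bracket_nonzero_on_slope:
  assumes GH: "analytic_at_origin G" "analytic_at_origin H"
    and ne: "valid_indices G \<noteq> {}" "valid_indices H \<noteq> {}"
    and Q: "cond_Q G H" and Fl: "approach Fl" and w: "w > 0" "- w \<in> slopes G \<union> slopes H"
    and lim: "(tau w \<longlongrightarrow> t) Fl" and t: "t \<noteq> 0"
  shows "\<forall>\<^sub>F z in Fl. theta_bracket G H (fst z) (snd z) \<noteq> 0"
proof -
  let ?K = "componential_poly G (- w)" and ?L = "componential_poly H (- w)"
  obtain d where d: "((\<lambda>z. G (fst z) (snd z) / fst z powr d) \<longlongrightarrow> poly ?K t) Fl"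
    "((\<lambda>z. euler G z / fst z powr d) \<longlongrightarrow> t * poly (pderiv ?K) t) Fl"
    by (rule leading_face[OF GH(1) ne(1) Fl w(1) lim])
  obtain e where e: "((\<lambda>z. H (fst z) (snd z) / fst z powr e) \<longlongrightarrow> poly ?L t) Fl"
    "((\<lambda>z. euler H z / fst z powr e) \<longlongrightarrow> t * poly (pderiv ?L) t) Fl"
    by (rule leading_face[OF GH(2) ne(2) Fl w(1) lim])
  have "t * poly (pderiv ?K) t * poly ?L t - poly ?K t * (t * poly (pderiv ?L) t)
        = t * poly (poly_bracket ?K ?L) t"
    by (simp add: poly_bracket_def algebra_simps)
  moreover have "poly (poly_bracket ?K ?L) t \<noteq> 0" using Q w(2) t by (auto simp: cond_Q_def)
  ultimately show ?thesis
    using t by (intro eventually_bracket_nonzero[OF bracket_limit[OF d e]]) simp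
qed

lemma coeff_at_nonzero: "p \<in> valid_indices F \<Longrightarrow> coeff_at F p \<noteq> 0"
  by (auto simp: valid_indices_def coeff_at_def)

section \<open>Real polynomials without nonzero roots\<close>

lemma odd_degree_real_root:
  fixes p :: "real poly"
  assumes "odd (degree p)"
  obtains x where "poly p x = 0"
proof -
  have *: "\<exists>x. poly q x = 0" if q: "odd (degree q)" "lead_coeff q > 0" for q :: "real poly"
  proof -
    obtain a where a: "\<And>x. x \<ge> a \<Longrightarrow> lead_coeff q \<le> poly q x"
      using poly_pinfty_gt_lc[OF q(2)] by blast
    \<comment> \<open>Since the degree is odd, \<open>- q (- x)\<close> has the same leading coefficient as \<open>q x\<close>.\<close>
    define r where "r = - pcompose q [:0, -1:]"
    have "lead_coeff r = lead_coeff q"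
      using q(1) by (simp add: r_def lead_coeff_comp)
    then obtain b where b: "\<And>x. x \<ge> b \<Longrightarrow> lead_coeff q \<le> poly r x"
      using poly_pinfty_gt_lc[of r] q(2) by auto
    define c where "c = \<bar>a\<bar> + \<bar>b\<bar> + 1"
    have c: "a \<le> c" "b \<le> c" by (auto simp: c_def)
    have "poly q c > 0" using a[OF c(1)] q(2) by linarith
    moreover have "poly q (- c) < 0" using b[OF c(2)] q(2) by (simp add: r_def poly_pcompose)
    moreover have "- c < c" by (auto simp: c_def)
    ultimately show ?thesis using poly_IVT_pos[of "- c" c q] by blast
  qed
  show ?thesis
  proof (cases "lead_coeff p > 0")
    case True
    then show ?thesis using *[OF assms] that by blast
  next
    case False
    then have "lead_coeff (- p) > 0" using assms by (cases "p = 0") (auto simp: not_less order_less_le)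
    then show ?thesis using *[of "- p"] assms that by auto
  qed
qed

text \<open>After division by the lowest power of the variable there is no real root at all, so the degree of
the quotient is even.\<close>
lemma no_nonzero_root_parity:
  fixes p :: "real poly"
  assumes roots: "\<And>t. t \<noteq> 0 \<Longrightarrow> poly p t \<noteq> 0"
    and low: "coeff p n \<noteq> 0" "\<And>i. i < n \<Longrightarrow> coeff p i = 0"
  shows "even (degree p) \<longleftrightarrow> even n"
proof -
  obtain q where q: "p = monom 1 n * q"
    using low(2) monom_1_dvd_iff'[of n p] by (auto elim: dvdE)
  have c: "coeff p n = coeff q 0" unfolding q by (simp add: coeff_monom_mult)
  then have q0: "q \<noteq> 0" using low(1) by auto
  have deg: "degree p = n + degree q"
    unfolding q using q0 by (subst degree_mult_eq) (auto simp: degree_monom_eq monom_eq_0_iff)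
  have "poly q t \<noteq> 0" for t
  proof (cases "t = 0")
    case True
    then show ?thesis using low(1) c by (simp add: poly_0_coeff_0)
  next
    case False
    then show ?thesis using roots[OF False] by (simp add: q poly_monom)
  qed
  then have "even (degree q)" using odd_degree_real_root by blast
  then show ?thesis using deg by simp
qed

section \<open>Near the axis \<open>\<theta> = 0\<close>\<close>

text \<open>By (S) no index with positive ordinate is lower than the last but one index on the polygon, and none
is below the line of the last edge. The higher ones are negligible since \<open>tau\<close> is small there, and
those of the same height lie to the right.\<close>
lemma star_dominates:
  assumes S: "cond_S1 F" and ne: "valid_indices F \<noteq> {}" and Fl: "approach Fl"
    and lim: "(tau (edge_weight F (newton_s F)) \<longlongrightarrow> 0) Fl"
    and q: "q \<in> valid_indices F" "0 < snd q" "q \<noteq> star_index F"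
  shows "dominated Fl q (star_index F)"
proof -
  note star = star_index_facts[OF S ne]
  let ?w = "edge_weight F (newton_s F)"
  have w: "?w > 0" using edge_weight_pos[OF ne star(1)] by simp
  have le: "weight ?w (star_index F) \<le> weight ?w q" using star(2) q(1) by (simp add: newton_face_def)
  have le2: "snd (star_index F) \<le> snd q" by (rule star(5)[OF q(1,2)])
  show ?thesis
  proof (cases "snd (star_index F) = snd q")
    case True
    then have "fst (star_index F) \<le> fst q" using le w by (simp add: weight_def)
    then show ?thesis using dominated_componentwise[OF Fl _ _ q(3)] True by simp
  next
    case False
    then show ?thesis using dominated_small_tau[OF Fl w lim le] le2 by simp
  qed
qed

lemma star_tau:
  assumes S: "cond_S1 F" and ne: "valid_indices F \<noteq> {}" and z: "0 < fst z"
  shows "mon (star_index F) z = tau (edge_weight F (newton_s F)) z ^ snd (star_index F) * mon (last_vertex F) z"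
proof -
  note star = star_index_facts[OF S ne]
  let ?w = "edge_weight F (newton_s F)" and ?v = "newton_vertex F (newton_s F)"
  have w: "?w > 0" using edge_weight_pos[OF ne star(1)] by simp
  have "?v \<in> valid_indices F" using newton_vertex_valid[OF ne] by simp
  then have "weight ?w (star_index F) \<le> weight ?w ?v" using star(2) by (simp add: newton_face_def)
  moreover have "weight ?w ?v \<le> weight ?w (star_index F)"
    using edge_supports[OF ne star(1)] star(2) by (simp add: newton_face_def)
  ultimately have "weight ?w (star_index F) = weight ?w (last_vertex F)" by (simp add: last_vertex_def)
  then show ?thesis using star(4) by (simp add: mon_tau[OF z w])
qed

text \<open>The last edge of \<open>\<G>\<close> is flatter than all edges of \<open>\<H>\<close>, so the componential polynomial of \<open>\<H>\<close> on its
slope is a constant, and (Q) says that the derivative of the componential polynomial of \<open>\<G>\<close> has no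
nonzero roots. Hence its lowest and its highest exponent have the same parity, and the highest one
comes from a vertex to which (P2) applies.\<close>
lemma last_edge_parity:
  assumes P2: "cond_P2 G H" and Q: "cond_Q G H"
    and ne: "valid_indices G \<noteq> {}" "valid_indices H \<noteq> {}"
    and S: "cond_S1 G" "cond_S1 H"
    and lt: "edge_weight G (newton_s G) < edge_weight H (newton_s H)"
  shows "odd (snd (star_index G))"
proof -
  note starG = star_index_facts[OF S(1) ne(1)] and starH = star_index_facts[OF S(2) ne(2)]
  define s where "s = newton_s G"
  define w where "w = edge_weight G s"
  define v where "v = newton_vertex G (s - 1)"
  have s: "1 \<le> s" using starG(1) by (simp add: s_def)
  have w: "w > 0" using edge_weight_pos[OF ne(1) s] by (simp add: w_def s_def)
  let ?K = "componential_poly G (- w)" and ?S = "newton_face G w"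
  have "odd (snd v)"
  proof -
    \<comment> \<open>This cut is just before the last edge of \<open>G\<close> and behind all edges of \<open>H\<close>.\<close>
    let ?D = "\<lambda>u. w < u"
    have "s - 1 = 0 \<or> w < edge_weight G (s - 1)"
      using s edge_weight_strict_antimono[OF ne(1), of "s - 1" s]
      by (cases "s = 1") (auto simp: w_def s_def)
    then have "at_cut G ?D (s - 1)"
      using s by (auto simp: at_cut_def w_def s_def)
    moreover have "at_cut H ?D (newton_s H)"
      using lt by (auto simp: at_cut_def w_def s_def)
    ultimately have "even (snd v) \<noteq> even (snd (newton_vertex H (newton_s H)))"
      unfolding v_def using s
      by (intro P2_opposite_parities_at_cut[OF P2 ne, of ?D]) (auto simp: s_def)
    then show ?thesis using starH(4) by (simp add: last_vertex_def)
  qed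
  have eqv: "weight w p = weight w v" if "p \<in> ?S" for p
  proof -
    have "v \<in> valid_indices G" unfolding v_def by (rule newton_vertex_valid[OF ne(1)]) (simp add: s_def)
    moreover have "weight w v \<le> weight w p"
      using edge_supports[OF ne(1) s, of p] edge_weight_eq[OF ne(1) s] that
      by (simp add: v_def w_def s_def newton_face_def)
    ultimately show ?thesis using that by (auto simp: newton_face_def intro: antisym)
  qed
  have vS: "v \<in> ?S"
    using newton_vertex_valid[OF ne(1), of "s - 1"] edge_supports[OF ne(1) s] edge_weight_eq[OF ne(1) s]
    by (simp add: v_def w_def s_def newton_face_def)
  have inj: "p = q" if "p \<in> ?S" "q \<in> ?S" "snd p = snd q" for p q
  proof -
    have "weight w p = weight w q" using eqv[OF that(1)] eqv[OF that(2)] by simp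
    then show ?thesis using that(3) w by (simp add: weight_def prod_eq_iff)
  qed
  have K: "?K = (\<Sum>p\<in>?S. monom (coeff_at G p) (snd p))"
    by (rule componential_poly_face[OF ne(1) w])
  have coeffK: "coeff ?K (snd p) = coeff_at G p" if p: "p \<in> ?S" for p
  proof -
    have "coeff ?K (snd p) = (\<Sum>q\<in>?S. if q = p then coeff_at G q else 0)"
      unfolding K coeff_sum by (rule sum.cong) (use inj[OF _ p] in auto)
    also have "\<dots> = coeff_at G p" using finite_newton_face[OF w] p by simp
    finally show ?thesis .
  qed
  have coeffK0: "coeff ?K i = 0" if "\<And>p. p \<in> ?S \<Longrightarrow> snd p \<noteq> i" for i
    unfolding K coeff_sum using that by (intro sum.neutral) auto
  have valid: "p \<in> valid_indices G" if "p \<in> ?S" for p using that by (simp add: newton_face_def)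
  have starS: "star_index G \<in> ?S" using starG(2) by (simp add: w_def s_def)
  have max: "snd p \<le> snd v" if p: "p \<in> ?S" for p
  proof -
    have "lattice_point p \<in> newton_edge G s"
      using newton_edge_face[OF ne(1) s] p by (auto simp: w_def s_def)
    then obtain t where t: "0 \<le> t" "t \<le> 1"
      "lattice_point p = (1 - t) *\<^sub>R lattice_point v + t *\<^sub>R lattice_point (newton_vertex G s)"
      by (auto simp: newton_edge_def in_segment v_def)
    have "real (snd p) = (1 - t) * real (snd v) + t * real (snd (newton_vertex G s))"
      using arg_cong[OF t(3), of snd] by (simp add: lattice_point_def)
    also have "\<dots> \<le> (1 - t) * real (snd v) + t * real (snd v)"
      using t newton_vertex_snd[OF ne(1), of "s - 1" s] s
      by (intro add_left_mono mult_left_mono) (auto simp: v_def s_def)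
    finally show ?thesis by (simp add: algebra_simps)
  qed
  have deg: "degree ?K = snd v"
  proof (rule antisym)
    show "degree ?K \<le> snd v"
      by (rule degree_le) (auto intro!: coeffK0 dest: max)
    show "snd v \<le> degree ?K"
      by (rule le_degree) (use coeffK[OF vS] coeff_at_nonzero[OF valid[OF vS]] in simp)
  qed
  have "even (degree (pderiv ?K)) \<longleftrightarrow> even (snd (star_index G) - 1)"
  proof (rule no_nonzero_root_parity)
    fix t :: real assume t: "t \<noteq> 0"
    have "- w \<in> slopes G \<union> slopes H" using s by (auto simp: slopes_eq w_def s_def)
    then have "poly (poly_bracket ?K (componential_poly H (- w))) t \<noteq> 0"
      using Q t by (auto simp: cond_Q_def)
    moreover have "componential_poly H (- w) = [:coeff_at H (last_vertex H):]"
    proof -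
      have "newton_face H w = {last_vertex H}"
        using vertex_strictly_lightest[OF ne(2) _ w, of "newton_s H"] lt
          newton_vertex_valid[OF ne(2), of "newton_s H"]
        by (fastforce simp: newton_face_def last_vertex_def w_def s_def not_le[symmetric] intro: less_imp_le)
      then show ?thesis
        using starH(4) by (simp add: componential_poly_face[OF ne(2) w] monom_0)
    qed
    ultimately show "poly (pderiv ?K) t \<noteq> 0" by (auto simp: poly_bracket_def)
  next
    have "coeff (pderiv ?K) (snd (star_index G) - 1) =
        real (snd (star_index G)) * coeff_at G (star_index G)"
      using starG(3) coeffK[OF starS] by (simp add: coeff_pderiv)
    then show "coeff (pderiv ?K) (snd (star_index G) - 1) \<noteq> 0"
      using starG(3) coeff_at_nonzero[OF valid[OF starS]] by simp
  next
    fix i assume i: "i < snd (star_index G) - 1"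
    have "coeff ?K (Suc i) = 0"
    proof (rule coeffK0)
      fix p assume "p \<in> ?S"
      then show "snd p \<noteq> Suc i" using starG(5)[OF valid, of p] i by auto
    qed
    then show "coeff (pderiv ?K) i = 0" by (simp add: coeff_pderiv)
  qed
  moreover have "even (degree (pderiv ?K))" using \<open>odd (snd v)\<close> deg by (simp add: degree_pderiv)
  ultimately show ?thesis using starG(3) by simp
qed

text \<open>Let \<open>j\<close> and \<open>l\<close> be the ordinates of the last but one indices on the two polygons. After division by two
monomials, \<open>\<theta> B\<close> becomes \<open>P - R r\<close>, where \<open>P\<close> and \<open>R\<close> have nonzero limits and
\<open>r = tau wH ^ l / tau wG ^ j\<close> compares the two competing terms. Under (H1) and (H3) the quantity \<open>r\<close>
tends to \<open>0\<close>, and under (H4) it equals \<open>1\<close> and the limits do not cancel. Under (H2) it may have any size,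
but it is positive since \<open>j\<close> and \<open>l\<close> are odd, and \<open>P\<close> and \<open>R\<close> have opposite signs.\<close>
lemma bracket_nonzero_near_axis:
  assumes GH: "analytic_at_origin G" "analytic_at_origin H"
    and ne: "valid_indices G \<noteq> {}" "valid_indices H \<noteq> {}"
    and P2: "cond_P2 G H" and Q: "cond_Q G H" and S: "cond_S G H"
    and cond: "cond_H1 G H \<or> cond_H2 G H \<or> cond_H3 G H \<or> cond_H4 G H"
    and Fl: "approach Fl"
    and limG: "(tau (edge_weight G (newton_s G)) \<longlongrightarrow> 0) Fl"
    and limH: "(tau (edge_weight H (newton_s H)) \<longlongrightarrow> 0) Fl"
  shows "\<forall>\<^sub>F z in Fl. theta_bracket G H (fst z) (snd z) \<noteq> 0"
proof -
  have SG: "cond_S1 G" and SH: "cond_S1 H" using S by (auto simp: cond_S_def)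
  note starG = star_index_facts[OF SG ne(1)] and starH = star_index_facts[OF SH ne(2)]
  define wG where "wG = edge_weight G (newton_s G)"
  define wH where "wH = edge_weight H (newton_s H)"
  define pG where "pG = star_index G"
  define pH where "pH = star_index H"
  define vG where "vG = last_vertex G"
  define vH where "vH = last_vertex H"
  define j where "j = snd pG"
  define l where "l = snd pH"
  define a where "a = coeff_at G vG"
  define b where "b = coeff_at H vH"
  define a' where "a' = coeff_at G pG"
  define b' where "b' = coeff_at H pH"
  have w: "wG > 0" "wH > 0"
    using edge_weight_pos[OF ne(1) starG(1)] edge_weight_pos[OF ne(2) starH(1)] by (auto simp: wG_def wH_def)
  have slope: "edge_slope G (newton_s G) = ereal (- wG)" "edge_slope H (newton_s H) = ereal (- wH)"
    using edge_slope_weight starG(1) starH(1) by (auto simp: wG_def wH_def)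
  have jl: "j > 0" "l > 0" using starG(3) starH(3) by (auto simp: j_def l_def pG_def pH_def)
  have nz: "a \<noteq> 0" "b \<noteq> 0" "a' \<noteq> 0" "b' \<noteq> 0"
    using newton_vertex_valid[OF ne(1), of "newton_s G"] newton_vertex_valid[OF ne(2), of "newton_s H"] starG(2) starH(2)
    by (auto simp: a_def b_def a'_def b'_def vG_def vH_def pG_def pH_def last_vertex_def newton_face_def
        intro!: coeff_at_nonzero)
  have lG: "((\<lambda>z. G (fst z) (snd z) / mon vG z) \<longlongrightarrow> a) Fl"
    unfolding a_def vG_def last_vertex_def
    by (rule leading_monomial[OF GH(1) Fl], rule vertex_dominates[OF Fl ne(1)]) (use limG in auto)
  have lH: "((\<lambda>z. H (fst z) (snd z) / mon vH z) \<longlongrightarrow> b) Fl"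
    unfolding b_def vH_def last_vertex_def
    by (rule leading_monomial[OF GH(2) Fl], rule vertex_dominates[OF Fl ne(2)]) (use limH in auto)
  have eG: "((\<lambda>z. euler G z / mon pG z) \<longlongrightarrow> real j * a') Fl"
    unfolding a'_def j_def pG_def
    by (rule leading_monomial_euler[OF GH(1) Fl], rule star_dominates[OF SG ne(1) Fl limG])
  have eH: "((\<lambda>z. euler H z / mon pH z) \<longlongrightarrow> real l * b') Fl"
    unfolding b'_def l_def pH_def
    by (rule leading_monomial_euler[OF GH(2) Fl], rule star_dominates[OF SH ne(2) Fl limH])
  define r where "r z = tau wH z ^ l / tau wG z ^ j" for z
  define P where "P z = euler G z / mon pG z * (H (fst z) (snd z) / mon vH z)" for z
  define R where "R z = G (fst z) (snd z) / mon vG z * (euler H z / mon pH z)" for z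
  have lP: "(P \<longlongrightarrow> real j * a' * b) Fl" unfolding P_def by (intro tendsto_mult eG lH)
  have lR: "(R \<longlongrightarrow> a * (real l * b')) Fl" unfolding R_def by (intro tendsto_mult eH lG)
  have expand: "\<forall>\<^sub>F z in Fl. P z - R z * r z = snd z * theta_bracket G H (fst z) (snd z) / (mon pG z * mon vH z)"
    using approachD(5)[OF Fl]
  proof eventually_elim
    case (elim z)
    have m: "mon p z \<noteq> 0" for p using elim by (simp add: mon_nonzero)
    have t: "tau u z \<noteq> 0" for u using elim by (simp add: tau_nonzero)
    have "r z = (mon pH z * mon vG z) / (mon pG z * mon vH z)"
      using elim m t by (simp add: r_def star_tau[OF SG ne(1)] star_tau[OF SH ne(2)] pG_def pH_def j_def l_def
          wG_def wH_def vG_def vH_def)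
    then have "R z * r z = G (fst z) (snd z) * euler H z / (mon pG z * mon vH z)"
      using m by (simp add: R_def)
    moreover have "P z = euler G z * H (fst z) (snd z) / (mon pG z * mon vH z)" by (simp add: P_def)
    ultimately show ?case
      by (simp add: euler_def theta_bracket_def diff_divide_distrib right_diff_distrib mult_ac)
  qed
  have concl: ?thesis if "(r \<longlongrightarrow> r0) Fl" "real j * a' * b - a * (real l * b') * r0 \<noteq> 0" for r0
    by (rule eventually_bracket_nonzero[OF Lim_transform_eventually[OF _ expand] that(2)])
       (intro tendsto_intros lP lR that(1))
  have r_eq: "\<forall>\<^sub>F z in Fl. tau wG z ^ (l - j) * (fst z powr (1 / wG - 1 / wH)) ^ l = r z" if "j \<le> l"
    using approachD(5)[OF Fl]
  proof eventually_elim
    case (elim z)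
    have t: "tau wG z \<noteq> 0" using elim by (simp add: tau_nonzero)
    have "tau wH z = tau wG z * fst z powr (1 / wG - 1 / wH)"
      by (simp add: tau_def mult.assoc flip: powr_add)
    then show ?case using t that by (simp add: r_def power_mult_distrib power_diff)
  qed
  have lt: "(tau wG \<longlongrightarrow> 0) Fl" using limG by (simp add: wG_def)
  from cond consider (H1) "wG < wH" "j \<le> l" | (H2) "cond_H2 G H"
    | (H3) "wG = wH" "j < l" | (H4) "wG = wH" "j = l" "a' * b \<noteq> a * b'"
    by (auto simp: cond_H1_def cond_H3_def cond_H4_def slope j_def l_def a_def b_def a'_def b'_def
        vG_def vH_def pG_def pH_def)
  then show ?thesis
  proof cases
    case H1
    have d: "1 / wG - 1 / wH > 0" using H1 w by (simp add: field_simps)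
    have "((\<lambda>z. tau wG z ^ (l - j) * (fst z powr (1 / wG - 1 / wH)) ^ l) \<longlongrightarrow> 0 ^ (l - j) * 0 ^ l) Fl"
      by (intro tendsto_intros lt rho_powr_tendsto_0[OF Fl d])
    then have "(r \<longlongrightarrow> 0) Fl"
      using Lim_transform_eventually[OF _ r_eq[OF H1(2)]] jl by (simp add: power_0_left)
    then show ?thesis by (rule concl) (use nz jl in simp)
  next
    case H3
    have "((\<lambda>z. tau wG z ^ (l - j)) \<longlongrightarrow> 0 ^ (l - j)) Fl"
      by (intro tendsto_intros lt)
    moreover have "\<forall>\<^sub>F z in Fl. tau wG z ^ (l - j) = r z"
      using r_eq approachD(5)[OF Fl] by (rule eventually_elim2) (use H3 in auto)
    ultimately have "(r \<longlongrightarrow> 0) Fl"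
      using Lim_transform_eventually H3 by (fastforce simp: power_0_left)
    then show ?thesis by (rule concl) (use nz jl in simp)
  next
    case H4
    have "\<forall>\<^sub>F z in Fl. 1 = r z"
      using r_eq approachD(5)[OF Fl] by (rule eventually_elim2) (use H4 in auto)
    then have "(r \<longlongrightarrow> 1) Fl" by (rule Lim_transform_eventually[OF tendsto_const])
    moreover have "real j * a' * b - a * (real l * b') * 1 = real j * (a' * b - a * b')"
      using H4 by (simp add: algebra_simps)
    ultimately show ?thesis by (intro concl) (use H4 jl in auto)
  next
    case H2
    then have lt': "wG < wH" and oddl: "odd l" and neg: "a' * b * a * b' < 0"
      by (auto simp: cond_H2_def slope l_def a_def b_def a'_def b'_def vG_def vH_def pG_def pH_def)
    have oddj: "odd j"
      using last_edge_parity[OF P2 Q ne SG SH] lt' by (simp add: j_def pG_def wG_def wH_def)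
    let ?P0 = "real j * a' * b"
    have P0: "?P0 \<noteq> 0" using nz jl by simp
    have "((\<lambda>z. P z * ?P0) \<longlongrightarrow> ?P0 * ?P0) Fl" by (intro tendsto_intros lP)
    then have 1: "\<forall>\<^sub>F z in Fl. P z * ?P0 > 0"
      by (rule order_tendstoD) (use P0 in \<open>metis not_real_square_gt_zero\<close>)
    have "((\<lambda>z. R z * ?P0) \<longlongrightarrow> a * (real l * b') * ?P0) Fl" by (intro tendsto_intros lR)
    moreover have "a * (real l * b') * ?P0 < 0"
    proof -
      have "a * (real l * b') * ?P0 = (real l * real j) * (a' * b * a * b')" by (simp add: mult_ac)
      also have "\<dots> < 0" by (rule mult_pos_neg[OF _ neg]) (use jl in simp)
      finally show ?thesis .
    qed
    ultimately have 2: "\<forall>\<^sub>F z in Fl. R z * ?P0 < 0" by (rule order_tendstoD)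
    show ?thesis
      using 1 2 expand approachD(5)[OF Fl]
    proof eventually_elim
      case (elim z)
      have "r z > 0"
      proof (cases "snd z > 0")
        case True
        then show ?thesis using elim by (simp add: r_def tau_def)
      next
        case False
        then have "tau wG z < 0" "tau wH z < 0" using elim by (auto simp: tau_def mult_less_0_iff)
        then have "tau wG z ^ j < 0" "tau wH z ^ l < 0"
          using oddj oddl by (auto simp: power_less_zero_eq)
        then show ?thesis unfolding r_def by (rule divide_neg_neg[rotated])
      qed
      then have "(R z * ?P0) * r z < 0" by (rule mult_neg_pos[OF elim(2)])
      then have "(P z - R z * r z) * ?P0 > 0" using elim by (simp add: algebra_simps)
      then show ?case using elim by auto
    qed
  qed
qed

section \<open>The bracket does not vanish off the axes\<close>

definition edge_weights :: "(real \<Rightarrow> real \<Rightarrow> real) \<Rightarrow> real set" where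
  "edge_weights F = edge_weight F ` {1..newton_s F}"

text \<open>The weights for which \<open>tau\<close> tends to \<open>0\<close> form an upwards closed set, and the vertices at the cut that
it defines in the two polygons dominate.\<close>
lemma bracket_nonzero_between_slopes:
  assumes GH: "analytic_at_origin G" "analytic_at_origin H"
    and ne: "valid_indices G \<noteq> {}" "valid_indices H \<noteq> {}"
    and L: "cond_L1 G H \<or> cond_L2 G H"
    and Fl: "approach Fl"
    and lims: "\<And>w. w \<in> edge_weights G \<union> edge_weights H \<Longrightarrow>
        (tau w \<longlongrightarrow> 0) Fl \<or> filterlim (\<lambda>z. \<bar>tau w z\<bar>) at_top Fl"
  shows "\<forall>\<^sub>F z in Fl. theta_bracket G H (fst z) (snd z) \<noteq> 0"
proof -
  define D where "D u \<longleftrightarrow> 0 < u \<and> (tau u \<longlongrightarrow> 0) Fl" for u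
  have D: "D v" if "D u" "u \<le> v" for u v
    using that tau_tendsto_0_mono[OF Fl, of u v] by (auto simp: D_def)
  obtain k where k: "at_cut G D k" by (rule at_cut_exists)
  obtain l where l: "at_cut H D l" by (rule at_cut_exists)
  have domG: "dominated Fl q (newton_vertex G k)" if "q \<in> valid_indices G" "q \<noteq> newton_vertex G k" for q
  proof (rule vertex_dominates[OF Fl ne(1) _ _ _ that])
    show "k = newton_s G \<or> filterlim (\<lambda>z. \<bar>tau (edge_weight G (Suc k)) z\<bar>) at_top Fl"
      using k lims[of "edge_weight G (Suc k)"] edge_weight_pos[OF ne(1), of "Suc k"]
      by (cases "k = newton_s G") (auto simp: at_cut_def D_def edge_weights_def)
  qed (use k in \<open>auto simp: at_cut_def D_def\<close>)
  have domH: "dominated Fl q (newton_vertex H l)" if "q \<in> valid_indices H" "q \<noteq> newton_vertex H l" for q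
  proof (rule vertex_dominates[OF Fl ne(2) _ _ _ that])
    show "l = newton_s H \<or> filterlim (\<lambda>z. \<bar>tau (edge_weight H (Suc l)) z\<bar>) at_top Fl"
      using l lims[of "edge_weight H (Suc l)"] edge_weight_pos[OF ne(2), of "Suc l"]
      by (cases "l = newton_s H") (auto simp: at_cut_def D_def edge_weights_def)
  qed (use l in \<open>auto simp: at_cut_def D_def\<close>)
  have generic: ?thesis if "even (snd (newton_vertex G k)) \<noteq> even (snd (newton_vertex H l))"
  proof (rule eventually_bracket_nonzero[OF bracket_limit_vertices[OF GH Fl domG domH]])
    have "newton_vertex G k \<in> valid_indices G" "newton_vertex H l \<in> valid_indices H"
      using k l by (auto simp: at_cut_def intro!: newton_vertex_valid ne)
    moreover have "snd (newton_vertex G k) \<noteq> snd (newton_vertex H l)" using that by auto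
    ultimately show "(real (snd (newton_vertex G k)) - real (snd (newton_vertex H l))) *
        coeff_at G (newton_vertex G k) * coeff_at H (newton_vertex H l) \<noteq> 0"
      by (simp add: coeff_at_nonzero)
  qed
  from L show ?thesis
  proof
    assume "cond_L1 G H"
    then have "cond_P1 G H" by (simp add: cond_L1_def)
    from P1_opposite_parities_at_cut[OF this ne D k l] show ?thesis by (rule generic)
  next
    assume L2: "cond_L2 G H"
    then have P2: "cond_P2 G H" and Q: "cond_Q G H" and S: "cond_S G H"
      and cond: "cond_H1 G H \<or> cond_H2 G H \<or> cond_H3 G H \<or> cond_H4 G H"
      by (simp_all add: cond_L2_def)
    show ?thesis
    proof (cases "k < newton_s G")
      case True
      from P2_opposite_parities_at_cut[OF P2 ne D k l True] show ?thesis by (rule generic)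
    next
      case False
      have SG: "cond_S1 G" and SH: "cond_S1 H" using S by (auto simp: cond_S_def)
      have sG: "1 \<le> newton_s G" and sH: "1 \<le> newton_s H"
        using star_index_facts(1)[OF SG ne(1)] star_index_facts(1)[OF SH ne(2)] .
      have DG: "D (edge_weight G (newton_s G))" using False k sG by (auto simp: at_cut_def)
      have "edge_slope H (newton_s H) \<le> edge_slope G (newton_s G)"
        using cond by (auto simp: cond_H1_def cond_H2_def cond_H3_def cond_H4_def)
      then have "edge_weight G (newton_s G) \<le> edge_weight H (newton_s H)"
        using sG sH by (simp add: edge_slope_weight)
      then have "D (edge_weight H (newton_s H))" by (rule D[OF DG])
      then show ?thesis
        using DG by (intro bracket_nonzero_near_axis[OF GH ne P2 Q S cond Fl]) (auto simp: D_def)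
    qed
  qed
qed

text \<open>The image filter on the compact extended real line has a cluster point \<open>l\<close>, and intersecting with the
preimages of the neighbourhoods of \<open>l\<close> makes it a limit.\<close>
lemma refine_filter:
  fixes f :: "'i \<Rightarrow> 'a \<Rightarrow> ereal"
  assumes "finite W" "Fl \<noteq> bot"
  obtains Fl' where "Fl' \<le> Fl" "Fl' \<noteq> bot" "\<And>w. w \<in> W \<Longrightarrow> \<exists>l. (f w \<longlongrightarrow> l) Fl'"
  using assms
proof (induction W arbitrary: thesis rule: finite_induct)
  case empty
  then show ?case by (metis empty_iff order_refl)
next
  case (insert w W)
  obtain F1 where F1: "F1 \<le> Fl" "F1 \<noteq> bot" "\<And>w. w \<in> W \<Longrightarrow> \<exists>l. (f w \<longlongrightarrow> l) F1"
    using insert.IH insert.prems(2) by blast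
  have "filtermap (f w) F1 \<noteq> bot" using F1(2) by (simp add: filtermap_bot_iff)
  then obtain l where l: "inf (nhds l) (filtermap (f w) F1) \<noteq> bot"
    using compact_UNIV[where 'a = ereal] unfolding compact_filter by fastforce
  define F2 where "F2 = inf F1 (filtercomap (f w) (nhds l))"
  have "F2 \<noteq> bot"
  proof
    assume "F2 = bot"
    then have "eventually (\<lambda>_. False) F2" by simp
    then obtain A B where A: "eventually A F1" and B: "eventually B (filtercomap (f w) (nhds l))"
      and AB: "\<And>x. A x \<Longrightarrow> B x \<Longrightarrow> False"
      unfolding F2_def eventually_inf by blast
    obtain C where C: "eventually C (nhds l)" "\<And>x. C (f w x) \<Longrightarrow> B x"
      using B unfolding eventually_filtercomap by blast
    have "eventually (\<lambda>y. \<not> C y) (filtermap (f w) F1)"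
      unfolding eventually_filtermap using A by eventually_elim (use AB C(2) in blast)
    then have "eventually (\<lambda>_. False) (inf (nhds l) (filtermap (f w) F1))"
      using C(1) unfolding eventually_inf by blast
    then show False using l by (simp add: trivial_limit_def)
  qed
  moreover have "F2 \<le> F1" "F2 \<le> filtercomap (f w) (nhds l)" by (auto simp: F2_def)
  moreover have "(f w \<longlongrightarrow> l) F2"
    using \<open>F2 \<le> filtercomap (f w) (nhds l)\<close> by (simp add: filterlim_iff_le_filtercomap)
  moreover have "\<exists>l. (f v \<longlongrightarrow> l) F2" if "v \<in> W" for v
    using F1(3)[OF that] \<open>F2 \<le> F1\<close> by (blast intro: tendsto_mono)
  ultimately show ?case using insert.prems(1)[of F2] F1(1) by (metis insert_iff order_trans)
qed

lemma bracket_nonzero_frequently: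
  assumes GH: "analytic_at_origin G" "analytic_at_origin H"
    and ne: "valid_indices G \<noteq> {}" "valid_indices H \<noteq> {}"
    and L: "cond_L1 G H \<or> cond_L2 G H" and Fl: "approach Fl"
  shows "\<exists>\<^sub>F z in Fl. theta_bracket G H (fst z) (snd z) \<noteq> 0"
proof -
  let ?W = "edge_weights G \<union> edge_weights H"
  have fin: "finite ?W" by (simp add: edge_weights_def)
  obtain F1 where F1: "F1 \<le> Fl" "F1 \<noteq> bot" "\<And>w. w \<in> ?W \<Longrightarrow> \<exists>l. ((\<lambda>z. ereal (tau w z)) \<longlongrightarrow> l) F1"
    using refine_filter[OF fin approachD(1)[OF Fl], of "\<lambda>w z. ereal (tau w z)"] by blast
  have Fl1: "approach F1" by (rule approach_mono[OF Fl F1(1,2)])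
  have Wpos: "w > 0" if "w \<in> ?W" for w
    using that edge_weight_pos[OF ne(1)] edge_weight_pos[OF ne(2)] by (auto simp: edge_weights_def)
  have Q: "cond_Q G H" using L by (auto simp: cond_L1_def cond_L2_def)
  have "\<forall>\<^sub>F z in F1. theta_bracket G H (fst z) (snd z) \<noteq> 0"
  proof (cases "\<exists>w\<in>?W. \<exists>t. t \<noteq> 0 \<and> (tau w \<longlongrightarrow> t) F1")
    case True
    then obtain w t where w: "w \<in> ?W" "t \<noteq> 0" "(tau w \<longlongrightarrow> t) F1" by blast
    have "- w \<in> slopes G \<union> slopes H" using w(1) by (auto simp: slopes_eq edge_weights_def)
    then show ?thesis by (rule bracket_nonzero_on_slope[OF GH ne Q Fl1 Wpos[OF w(1)] _ w(3,2)])
  next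
    case False
    show ?thesis
    proof (rule bracket_nonzero_between_slopes[OF GH ne L Fl1])
      fix w assume w: "w \<in> ?W"
      obtain l where l: "((\<lambda>z. ereal (tau w z)) \<longlongrightarrow> l) F1" using F1(3)[OF w] by blast
      show "(tau w \<longlongrightarrow> 0) F1 \<or> filterlim (\<lambda>z. \<bar>tau w z\<bar>) at_top F1"
      proof (cases l)
        case (real t)
        then have t: "(tau w \<longlongrightarrow> t) F1" using l by simp
        with False w have "t = 0" by fast
        then show ?thesis using t by simp
      next
        case PInf
        then have f: "filterlim (tau w) at_top F1" using l by (simp add: tendsto_PInfty_eq_at_top)
        show ?thesis
          by (intro disjI2 filterlim_at_top_mono[OF f] always_eventually allI) simp
      next
        case MInf
        then have "((\<lambda>z. - ereal (tau w z)) \<longlongrightarrow> \<infinity>) F1"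
          using tendsto_uminus_ereal[OF l] by simp
        then have "((\<lambda>z. ereal (- tau w z)) \<longlongrightarrow> \<infinity>) F1" by simp
        then have f: "filterlim (\<lambda>z. - tau w z) at_top F1" by (simp only: tendsto_PInfty_eq_at_top)
        show ?thesis
          by (intro disjI2 filterlim_at_top_mono[OF f] always_eventually allI) simp
      qed
    qed
  qed
  then have "\<exists>\<^sub>F z in F1. theta_bracket G H (fst z) (snd z) \<noteq> 0"
    using F1(2) by (rule eventually_frequently[rotated])
  then show ?thesis using F1(1) by (auto simp: frequently_def dest: filter_leD)
qed

section \<open>The sign of the bracket\<close>

lemma bracket_nonzero_punctured:
  assumes GH: "analytic_at_origin G" "analytic_at_origin H"
    and ne: "valid_indices G \<noteq> {}" "valid_indices H \<noteq> {}"
    and L: "cond_L1 G H \<or> cond_L2 G H"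
  obtains \<epsilon> where "\<epsilon> > 0"
    "\<And>\<rho> \<theta>. 0 < \<rho> \<Longrightarrow> \<rho> < \<epsilon> \<Longrightarrow> \<theta> \<noteq> 0 \<Longrightarrow> \<bar>\<theta>\<bar> < \<epsilon> \<Longrightarrow> theta_bracket G H \<rho> \<theta> \<noteq> 0"
proof -
  let ?Z = "{z. 0 < fst z \<and> snd z \<noteq> 0 \<and> theta_bracket G H (fst z) (snd z) = 0}"
  \<comment> \<open>Otherwise this is a filter of zeros converging to the origin.\<close>
  have "inf (nhds (0, 0)) (principal ?Z) = bot"
  proof (rule ccontr)
    assume ne_bot: "inf (nhds (0, 0)) (principal ?Z) \<noteq> bot"
    have ev: "\<forall>\<^sub>F z in inf (nhds (0, 0)) (principal ?Z). z \<in> ?Z"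
      by (simp add: eventually_inf_principal)
    have "approach (inf (nhds (0, 0)) (principal ?Z))"
      unfolding approach_def using ne_bot ev by (auto elim: eventually_mono)
    from bracket_nonzero_frequently[OF GH ne L this] show False
      using eventually_mono[OF ev, of "\<lambda>z. theta_bracket G H (fst z) (snd z) = 0"]
      by (simp add: frequently_def)
  qed
  then have "\<forall>\<^sub>F z in inf (nhds (0, 0)) (principal ?Z). False" by simp
  then have "\<forall>\<^sub>F z in nhds (0, 0). z \<notin> ?Z" by (simp add: eventually_inf_principal)
  then obtain d where d: "d > 0" "\<And>z. dist z (0, 0) < d \<Longrightarrow> z \<notin> ?Z"
    unfolding eventually_nhds_metric by blast
  show ?thesis
  proof (rule that[of "d / 2"])
    fix \<rho> \<theta> :: real assume h: "0 < \<rho>" "\<rho> < d / 2" "\<theta> \<noteq> 0" "\<bar>\<theta>\<bar> < d / 2"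
    have "dist (\<rho>, \<theta>) (0, 0) \<le> \<bar>\<rho>\<bar> + \<bar>\<theta>\<bar>"
      using norm_Pair_le[of \<rho> \<theta>] by (simp add: dist_norm)
    then show "theta_bracket G H \<rho> \<theta> \<noteq> 0" using h d(2)[of "(\<rho>, \<theta>)"] by auto
  qed (use d in simp)
qed

lemma first_vertices_parity:
  assumes ne: "valid_indices G \<noteq> {}" "valid_indices H \<noteq> {}"
    and L: "cond_L1 G H \<or> cond_L2 G H"
  shows "even (snd (newton_vertex G 0)) \<noteq> even (snd (newton_vertex H 0))"
proof -
  \<comment> \<open>The first vertices follow no edge, so they correspond to the empty set of weights.\<close>
  have cut: "at_cut F (\<lambda>_. False) 0" for F by (simp add: at_cut_def)
  from L show ?thesis
  proof
    assume "cond_L1 G H"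
    then show ?thesis
      by (intro P1_opposite_parities_at_cut[OF _ ne _ cut cut]) (auto simp: cond_L1_def)
  next
    assume L2: "cond_L2 G H"
    then have "cond_S1 G" by (simp add: cond_L2_def cond_S_def)
    then have "1 \<le> newton_s G" by (rule star_index_facts(1)[OF _ ne(1)])
    then show ?thesis
      using L2 by (intro P2_opposite_parities_at_cut[OF _ ne _ cut cut]) (auto simp: cond_L2_def)
  qed
qed

lemma C0_nonzero:
  assumes ne: "valid_indices G \<noteq> {}" "valid_indices H \<noteq> {}"
    and L: "cond_L1 G H \<or> cond_L2 G H"
  shows "C0 G H \<noteq> 0"
proof -
  have "snd (newton_vertex G 0) \<noteq> snd (newton_vertex H 0)" using first_vertices_parity[OF assms] by auto
  then show ?thesis
    using newton_vertex_valid[OF ne(1), of 0] newton_vertex_valid[OF ne(2), of 0]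
    by (simp add: C0_def coeff_at_nonzero)
qed

text \<open>Along the curve \<open>\<rho> = \<bar>\<theta>\<bar> ^ N\<close> with \<open>N\<close> larger than all edge weights, every \<open>tau\<close> is unbounded, so the
first vertices dominate. The sign \<open>s\<close> selects the side of the axis \<open>\<theta> = 0\<close>.\<close>
lemma bracket_sign_on_curve:
  assumes GH: "analytic_at_origin G" "analytic_at_origin H"
    and ne: "valid_indices G \<noteq> {}" "valid_indices H \<noteq> {}"
    and L: "cond_L1 G H \<or> cond_L2 G H" and s: "\<bar>s\<bar> = 1"
  obtains N where "N \<ge> 1" "\<forall>\<^sub>F h in at_right 0. 0 < theta_bracket G H (h ^ N) (s * h) * C0 G H"
proof -
  let ?W = "edge_weights G \<union> edge_weights H"
  have fin: "finite ?W" by (simp add: edge_weights_def)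
  define M where "M = Max (insert 0 ?W)"
  obtain N where N: "M < real N" using reals_Archimedean2 by blast
  have M: "w \<le> M" if "w \<in> ?W" for w unfolding M_def using fin that by (intro Max_ge) auto
  have "0 \<le> M" unfolding M_def using fin by (intro Max_ge) auto
  then have N1: "N \<ge> 1" using N by (cases N) auto
  have Wpos: "w > 0" if "w \<in> ?W" for w
    using that edge_weight_pos[OF ne(1)] edge_weight_pos[OF ne(2)] by (auto simp: edge_weights_def)
  define \<phi> where "\<phi> h = (h ^ N, s * h)" for h :: real
  define Fl where "Fl = filtermap \<phi> (at_right 0)"
  have pos: "\<forall>\<^sub>F h in at_right (0::real). 0 < h" by (simp add: eventually_at_right_less)
  have Fl: "approach Fl"
    unfolding approach_def
  proof (intro conjI)
    show "Fl \<noteq> bot" by (simp add: Fl_def filtermap_bot_iff)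
    have "((\<lambda>h. (h ^ N, s * h)) \<longlongrightarrow> (0 ^ N, s * 0)) (at_right 0)"
      by (intro tendsto_intros)
    then show "Fl \<le> nhds (0, 0)"
      using N1 by (simp add: Fl_def filterlim_def \<phi>_def[abs_def] power_0_left)
    show "\<forall>\<^sub>F z in Fl. 0 < fst z \<and> snd z \<noteq> 0"
      unfolding Fl_def eventually_filtermap using pos
      by eventually_elim (use s in \<open>auto simp: \<phi>_def\<close>)
  qed
  have big: "filterlim (\<lambda>z. \<bar>tau w z\<bar>) at_top Fl" if w: "w \<in> ?W" for w
  proof -
    have e: "1 - real N / w < 0" using M[OF w] Wpos[OF w] N by (simp add: field_simps)
    have "((\<lambda>h::real. h powr (real N / w - 1)) \<longlongrightarrow> 0) (at_right 0)"
      using e pos by (intro tendsto_zero_powrI[OF _ tendsto_const]) (auto elim: eventually_mono intro!: tendsto_intros)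
    then have "filterlim (\<lambda>h::real. inverse (h powr (real N / w - 1))) at_top (at_right 0)"
      by (rule filterlim_inverse_at_top) (use pos in \<open>auto elim: eventually_mono\<close>)
    moreover have "inverse (h powr (real N / w - 1)) = h powr (1 - real N / w)" for h :: real
      by (simp flip: powr_minus)
    ultimately have "filterlim (\<lambda>h::real. h powr (1 - real N / w)) at_top (at_right 0)"
      by simp
    moreover have "\<forall>\<^sub>F h in at_right (0::real). h powr (1 - real N / w) = \<bar>tau w (\<phi> h)\<bar>"
      using pos
    proof eventually_elim
      case (elim h)
      have "(h ^ N) powr (- (1 / w)) = h powr (- (real N / w))"
        using elim by (simp add: powr_powr flip: powr_realpow)
      then have "tau w (\<phi> h) = s * h powr (1 - real N / w)"
        using elim by (simp add: tau_def \<phi>_def powr_diff powr_minus divide_inverse)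
      then show ?case using s by (simp add: abs_mult)
    qed
    ultimately have "filterlim (\<lambda>h. \<bar>tau w (\<phi> h)\<bar>) at_top (at_right 0)"
      by (simp cong: filterlim_cong)
    then show ?thesis by (simp add: Fl_def filterlim_filtermap)
  qed
  let ?v = "newton_vertex G 0" and ?u = "newton_vertex H 0"
  have domG: "dominated Fl q ?v" if "q \<in> valid_indices G" "q \<noteq> ?v" for q
  proof (rule vertex_dominates[OF Fl ne(1) _ _ _ that])
    show "0 = newton_s G \<or> filterlim (\<lambda>z. \<bar>tau (edge_weight G (Suc 0)) z\<bar>) at_top Fl"
      using big[of "edge_weight G (Suc 0)"] by (cases "newton_s G") (auto simp: edge_weights_def)
  qed auto
  have domH: "dominated Fl q ?u" if "q \<in> valid_indices H" "q \<noteq> ?u" for q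
  proof (rule vertex_dominates[OF Fl ne(2) _ _ _ that])
    show "0 = newton_s H \<or> filterlim (\<lambda>z. \<bar>tau (edge_weight H (Suc 0)) z\<bar>) at_top Fl"
      using big[of "edge_weight H (Suc 0)"] by (cases "newton_s H") (auto simp: edge_weights_def)
  qed auto
  have "((\<lambda>z. snd z * theta_bracket G H (fst z) (snd z) / (mon ?v z * mon ?u z) * C0 G H) \<longlongrightarrow>
          C0 G H * C0 G H) Fl"
    using bracket_limit_vertices[OF GH Fl domG domH] by (intro tendsto_mult tendsto_const) (simp add: C0_def)
  moreover have "0 < C0 G H * C0 G H" using C0_nonzero[OF ne L] by (metis not_real_square_gt_zero)
  ultimately have "\<forall>\<^sub>F z in Fl. 0 < snd z * theta_bracket G H (fst z) (snd z) / (mon ?v z * mon ?u z) * C0 G H"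
    by (rule order_tendstoD)
  then have "\<forall>\<^sub>F z in Fl. 0 < theta_bracket G H (fst z) (snd z) * C0 G H"
    using approachD(5)[OF Fl]
  proof eventually_elim
    case (elim z)
    have odd: "odd (snd ?v + snd ?u)" using first_vertices_parity[OF ne L] by simp
    then obtain n where n: "snd ?v + snd ?u = Suc (2 * n)" by (metis oddE Suc_eq_plus1)
    have "mon ?v z * mon ?u z = fst z ^ (fst ?v + fst ?u) * snd z ^ (snd ?v + snd ?u)"
      by (simp add: mon_def power_add mult_ac)
    also have "\<dots> = snd z * (fst z ^ (fst ?v + fst ?u) * (snd z ^ n) ^ 2)"
      unfolding n by (simp add: power_mult[symmetric] mult_ac)
    finally have m: "mon ?v z * mon ?u z = snd z * (fst z ^ (fst ?v + fst ?u) * (snd z ^ n) ^ 2)" .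
    have p: "0 < fst z ^ (fst ?v + fst ?u) * (snd z ^ n) ^ 2" using elim by simp
    have "0 < (theta_bracket G H (fst z) (snd z) * C0 G H) / (fst z ^ (fst ?v + fst ?u) * (snd z ^ n) ^ 2)"
      using elim unfolding m by simp
    then show ?case using p by (simp add: zero_less_divide_iff)
  qed
  then have "\<forall>\<^sub>F h in at_right 0. 0 < theta_bracket G H (h ^ N) (s * h) * C0 G H"
    by (simp add: Fl_def eventually_filtermap \<phi>_def)
  then show ?thesis using that N1 by blast
qed

lemma theta_bracket_continuous:
  assumes "analytic_at_origin G" "analytic_at_origin H"
  obtains r where "r > 0" "continuous_on ({-r..r} \<times> {-r..r}) (\<lambda>(x, y). theta_bracket G H x y)"
proof -
  have D: "has_power_series (\<lambda>x y. deriv (F x) y) (\<lambda>i j. real (Suc j) * ps_coeff F i (Suc j))"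
    if "analytic_at_origin F" for F
    by (rule theta_derivative_power_series[OF has_power_series_ps_coeff[OF that]])
  obtain r1 where r1: "r1 > 0" "continuous_on ({-r1..r1} \<times> {-r1..r1}) (\<lambda>(x, y). G x y)"
    by (rule power_series_continuous[OF has_power_series_ps_coeff[OF assms(1)]])
  obtain r2 where r2: "r2 > 0" "continuous_on ({-r2..r2} \<times> {-r2..r2}) (\<lambda>(x, y). H x y)"
    by (rule power_series_continuous[OF has_power_series_ps_coeff[OF assms(2)]])
  obtain r3 where r3: "r3 > 0" "continuous_on ({-r3..r3} \<times> {-r3..r3}) (\<lambda>(x, y). deriv (G x) y)"
    by (rule power_series_continuous[OF D[OF assms(1)]])
  obtain r4 where r4: "r4 > 0" "continuous_on ({-r4..r4} \<times> {-r4..r4}) (\<lambda>(x, y). deriv (H x) y)"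
    by (rule power_series_continuous[OF D[OF assms(2)]])
  define r where "r = min (min r1 r2) (min r3 r4)"
  show ?thesis
  proof (rule that[of r])
    show "r > 0" using r1 r2 r3 r4 by (simp add: r_def)
    have sub: "{-r..r} \<times> {-r..r} \<subseteq> {-u..u} \<times> {-u..u}" if "r \<le> u" for u :: real
      using that by auto
    have "continuous_on ({-r..r} \<times> {-r..r})
            (\<lambda>z. (case z of (x, y) \<Rightarrow> deriv (G x) y) * (case z of (x, y) \<Rightarrow> H x y)
               - (case z of (x, y) \<Rightarrow> G x y) * (case z of (x, y) \<Rightarrow> deriv (H x) y))"
      by (intro continuous_on_diff continuous_on_mult
          continuous_on_subset[OF r1(2) sub] continuous_on_subset[OF r2(2) sub]
          continuous_on_subset[OF r3(2) sub] continuous_on_subset[OF r4(2) sub]) (simp_all add: r_def)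
    then show "continuous_on ({-r..r} \<times> {-r..r}) (\<lambda>(x, y). theta_bracket G H x y)"
      by (simp add: theta_bracket_def case_prod_unfold)
  qed
qed

text \<open>Each of the two squares is connected, so the sign on it is that on the curve; the axis \<open>\<theta> = 0\<close> is
reached by continuity.\<close>
lemma bracket_sign:
  assumes GH: "analytic_at_origin G" "analytic_at_origin H"
    and ne: "valid_indices G \<noteq> {}" "valid_indices H \<noteq> {}"
    and L: "cond_L1 G H \<or> cond_L2 G H"
  obtains \<epsilon> where "\<epsilon> > 0" "\<And>\<rho> \<theta>. (\<rho>, \<theta>) \<in> Omega \<epsilon> \<Longrightarrow> 0 \<le> theta_bracket G H \<rho> \<theta> * C0 G H"
proof -
  let ?B = "\<lambda>\<rho> \<theta>. theta_bracket G H \<rho> \<theta> * C0 G H"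
  obtain e where e: "e > 0"
    "\<And>\<rho> \<theta>. 0 < \<rho> \<Longrightarrow> \<rho> < e \<Longrightarrow> \<theta> \<noteq> 0 \<Longrightarrow> \<bar>\<theta>\<bar> < e \<Longrightarrow> theta_bracket G H \<rho> \<theta> \<noteq> 0"
    by (rule bracket_nonzero_punctured[OF GH ne L]) blast
  obtain r where r: "r > 0" "continuous_on ({-r..r} \<times> {-r..r}) (\<lambda>(x, y). theta_bracket G H x y)"
    by (rule theta_bracket_continuous[OF GH])
  define \<epsilon> where "\<epsilon> = min e r"
  have \<epsilon>: "\<epsilon> > 0" using e r by (simp add: \<epsilon>_def)
  have side: "0 < ?B \<rho> (s * h)" if s: "\<bar>s\<bar> = 1" and h: "0 < \<rho>" "\<rho> < \<epsilon>" "0 < h" "h < \<epsilon>" for s \<rho> h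
  proof (rule ccontr)
    assume neg: "\<not> 0 < ?B \<rho> (s * h)"
    let ?R = "{0<..<\<epsilon>} \<times> {0<..<\<epsilon>}"
    define f where "f z = ?B (fst z) (s * snd z)" for z
    have cont: "continuous_on ?R f"
    proof -
      have "continuous_on ?R ((\<lambda>(x, y). theta_bracket G H x y) \<circ> (\<lambda>z. (fst z, s * snd z)))"
      proof (rule continuous_on_compose)
        have "(fst z, s * snd z) \<in> {-r..r} \<times> {-r..r}" if "z \<in> ?R" for z
          using that s by (auto simp: \<epsilon>_def abs_if split: if_splits)
        then show "continuous_on ((\<lambda>z. (fst z, s * snd z)) ` ?R) (\<lambda>(x, y). theta_bracket G H x y)"
          by (intro continuous_on_subset[OF r(2)]) blast
      qed (intro continuous_intros)
      then show ?thesis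
        unfolding f_def[abs_def] by (intro continuous_intros) (simp add: o_def)
    qed
    have "connected (f ` ?R)"
      by (intro connected_continuous_image cont convex_connected convex_Times) auto
    moreover obtain z where z: "z \<in> ?R" "0 < f z"
    proof -
      obtain N where N: "N \<ge> 1" "\<forall>\<^sub>F h in at_right 0. 0 < ?B (h ^ N) (s * h)"
        by (rule bracket_sign_on_curve[OF GH ne L s])
      have "\<forall>\<^sub>F h in at_right (0::real). h \<in> {0<..<min 1 \<epsilon>}"
        using \<epsilon> by (intro eventually_at_right_real) simp
      with N(2) have "\<forall>\<^sub>F h in at_right (0::real). (h ^ N, h) \<in> ?R \<and> 0 < f (h ^ N, h)"
      proof eventually_elim
        case (elim h)
        have "h ^ N \<le> h ^ 1" using elim N(1) by (intro power_decreasing) auto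
        then show ?case using elim by (auto simp: f_def)
      qed
      then obtain h where "(h ^ N, h) \<in> ?R \<and> 0 < f (h ^ N, h)"
        using eventually_happens'[OF trivial_limit_at_right_real] by blast
      then show ?thesis using that by blast
    qed
    moreover have "f (\<rho>, h) \<in> f ` ?R" by (rule imageI) (use h in simp)
    moreover have "f (\<rho>, h) \<le> 0" using neg by (simp add: f_def)
    ultimately have "0 \<in> f ` ?R"
      using connectedD_interval[of "f ` ?R" "f (\<rho>, h)" "f z" 0] by auto
    then obtain y where "y \<in> ?R" "f y = 0" by auto
    moreover have "theta_bracket G H (fst y) (s * snd y) \<noteq> 0" if "y \<in> ?R" for y
      using that s by (intro e(2)) (auto simp: \<epsilon>_def abs_mult)
    ultimately show False using C0_nonzero[OF ne L] by (auto simp: f_def)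
  qed
  have "0 \<le> ?B \<rho> \<theta>" if "(\<rho>, \<theta>) \<in> Omega \<epsilon>" for \<rho> \<theta>
  proof (cases "\<theta> = 0")
    case False
    have "0 < ?B \<rho> (sgn \<theta> * \<bar>\<theta>\<bar>)"
      using that False by (intro side) (auto simp: Omega_def abs_sgn_eq)
    then show ?thesis by (simp add: sgn_mult_abs)
  next
    case True
    have \<rho>: "0 < \<rho>" "\<rho> < \<epsilon>" using that by (auto simp: Omega_def)
    have "continuous_on {0..\<epsilon>} ((\<lambda>(x, y). theta_bracket G H x y) \<circ> (\<lambda>h. (\<rho>, h)))"
    proof (rule continuous_on_compose)
      show "continuous_on ((\<lambda>h. (\<rho>, h)) ` {0..\<epsilon>}) (\<lambda>(x, y). theta_bracket G H x y)"
        by (rule continuous_on_subset[OF r(2)]) (use \<rho> in \<open>auto simp: \<epsilon>_def\<close>)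
    qed (intro continuous_intros)
    then have "continuous_on {0..\<epsilon>} (\<lambda>h. theta_bracket G H \<rho> h)" by (simp add: o_def)
    then have "((\<lambda>h. theta_bracket G H \<rho> h) \<longlongrightarrow> theta_bracket G H \<rho> 0) (at 0 within {0..\<epsilon>})"
      using \<epsilon> by (simp add: continuous_on_def)
    then have lim: "((\<lambda>h. ?B \<rho> h) \<longlongrightarrow> ?B \<rho> 0) (at_right 0)"
      using \<epsilon> by (intro tendsto_mult tendsto_const) (simp add: at_within_Icc_at_right)
    have "\<forall>\<^sub>F h in at_right (0::real). h \<in> {0<..<\<epsilon>}"
      using \<epsilon> by (rule eventually_at_right_real)
    then have "\<forall>\<^sub>F h in at_right (0::real). 0 \<le> ?B \<rho> h"
      by eventually_elim (use side[of 1 \<rho>] \<rho> in \<open>auto intro: less_imp_le\<close>)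
    then show ?thesis
      using tendsto_lowerbound[OF lim] True by simp
  qed
  then show ?thesis using that \<epsilon> by blast
qed

theorem lemma5p3:
  fixes X Y G H :: "real \<Rightarrow> real \<Rightarrow> real" and m :: nat
  assumes "analytic_at_origin X" and "analytic_at_origin Y"
    and "m \<ge> 2"
    and "\<And>k x y. k < m \<Longrightarrow> homogeneous_part X k x y = 0 \<and> homogeneous_part Y k x y = 0"
    and "\<exists>x y. (homogeneous_part X m x y)\<^sup>2 + (homogeneous_part Y m x y)\<^sup>2 \<noteq> 0"
    and "isolated_singular_origin X Y"
    and "G = angular X Y m" and "H = radial X Y m"
    and "nonzero_germ G" and "nonzero_germ H"
    and "angular_part X Y m 0 0 = 0" and "radial_part X Y m 0 0 = 0"
    and "cond_L1 G H \<or> cond_L2 G H"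
  shows "(\<exists>\<epsilon>>0. (\<forall>(\<rho>, \<theta>)\<in>Omega \<epsilon>. theta_bracket G H \<rho> \<theta> \<ge> 0)
              \<or> (\<forall>(\<rho>, \<theta>)\<in>Omega \<epsilon>. theta_bracket G H \<rho> \<theta> \<le> 0))
         \<and> (C0 G H > 0 \<longrightarrow> (\<exists>\<epsilon>>0. \<forall>(\<rho>, \<theta>)\<in>Omega \<epsilon>. theta_bracket G H \<rho> \<theta> \<ge> 0))
         \<and> (C0 G H < 0 \<longrightarrow> (\<exists>\<epsilon>>0. \<forall>(\<rho>, \<theta>)\<in>Omega \<epsilon>. theta_bracket G H \<rho> \<theta> \<le> 0))"
proof -
  have GH: "analytic_at_origin G" "analytic_at_origin H"
    using analytic_angular[OF assms(1,2)] analytic_radial[OF assms(1,2)] assms(7,8) by auto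
  have ne: "valid_indices G \<noteq> {}" "valid_indices H \<noteq> {}"
    using valid_indices_nonempty[OF GH(1) assms(9)] valid_indices_nonempty[OF GH(2) assms(10)] .
  obtain \<epsilon> where \<epsilon>: "\<epsilon> > 0" "\<And>\<rho> \<theta>. (\<rho>, \<theta>) \<in> Omega \<epsilon> \<Longrightarrow> 0 \<le> theta_bracket G H \<rho> \<theta> * C0 G H"
    by (rule bracket_sign[OF GH ne assms(13)]) blast
  have pos: "\<forall>(\<rho>, \<theta>)\<in>Omega \<epsilon>. theta_bracket G H \<rho> \<theta> \<ge> 0" if "C0 G H > 0"
    using \<epsilon>(2) that by (auto simp: zero_le_mult_iff)
  have neg: "\<forall>(\<rho>, \<theta>)\<in>Omega \<epsilon>. theta_bracket G H \<rho> \<theta> \<le> 0" if "C0 G H < 0"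
    using \<epsilon>(2) that by (auto simp: zero_le_mult_iff)
  have "C0 G H > 0 \<or> C0 G H < 0" using C0_nonzero[OF ne assms(13)] by linarith
  then show ?thesis using \<epsilon>(1) pos neg by blast
qed

end
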